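(* For spaces built from sequences of finite quotients of a group, geometric property (T) is strictly stronger than being an expander. That is: if $X=\bigsqcup_n\Gamma/\Gamma_n$ is the space associated to data $(\Gamma,(\Gamma_n))$ and $X$ has geometric property (T), then the sequence $(\Gamma/\Gamma_n)_n$ is an expander; and there exist data $(\Gamma,(\Gamma_n))$ such that $(\Gamma/\Gamma_n)_n$ is an expander but the associated space $X$ does not have geometric property (T).
   Context: Data $(\Gamma,(\Gamma_n))$: $\Gamma$ is an infinite finitely generated discrete group with a fixed finite generating set $S=S^{-1}$, and $\Gamma=\Gamma_0\unrhd\Gamma_1\unrhd\Gamma_2\unrhd\cdots$ is a nested sequence of finite index normal subgroups of $\Gamma$ with $\bigcap_n\Gamma_n=\{e\}$. Put $X_n=\Gamma/\Gamma_n$, $E_n=\{(x,y)\in X_n\times X_n: x^{-1}y\in S\}$ (meaning $x^{-1}y$ lies in the image of $S$), $X=\bigsqcup_nX_n$ and $E=\bigsqcup_nE_n\subseteq X\times X$; $X$ carries the coarse structure generated by $E$ (the smallest coarse structure containing $E$). Each $X_n$ is regarded as a connected graph, distinct $x,y$ being joined iff $(x,y)\in E_n$. A sequence $(X_n)$ of finite connected graphs is an expander if $|X_n|\to\infty$, the vertex degrees are uniformly bounded, and there is $c>0$ such that for all $n$ the spectrum of the graph Laplacian (degree matrix minus adjacency matrix) on $l^2(X_n)$ is contained in $\{0\}\sqcup[c,\infty)$. A coarse structure on a set $X$ is a collection of subsets of $X\times X$, called controlled sets, containing the diagonal and closed under passing to subsets, finite unions, compositions $E\circ F:=\{(x,y):\exists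 z,\ (x,z)\in E,\ (z,y)\in F\}$ and inverses $E^{-1}:=\{(x,y):(y,x)\in E\}$. A controlled set $E$ is generating if for every controlled $F$ there is $n$ with $F\subseteq E^{\circ n}$ ($n$-fold composition). The translation algebra $\mathbb{C}_u[X]$ is the $*$-algebra of matrices $T=(T_{xy})_{x,y\in X}$ with complex entries such that $\sup_{x,y}|T_{xy}|<\infty$ and the support $\{(x,y):T_{xy}\ne0\}$ is controlled. A partial translation is a bijection $t:A\to B$ of subsets of $X$ with $\{(t(x),x):x\in A\}$ controlled; it is identified with the operator $v\in\mathbb{C}_u[X]$ with $v_{xy}=1$ if $t(y)=x$ and $0$ otherwise. A representation is a unital $*$-homomorphism $\mathbb{C}_u[X]\to\mathcal{B}(\mathcal{H})$. A vector $\xi\in\mathcal{H}$ is constant if $v\xi=vv^*\xi$ for all partial translations $v$; $\mathcal{H}_c$ is the closed subspace of constant vectors. $X$ has geometric property (T) if for every controlled generating set $E$ there is $c>0$ such that for every representation $\mathcal{H}$ and every $\xi\in\mathcal{H}_c^\perp$ there is a partial translation $v$ with support in $E$ and $\|(vv^*-v)\xi\|\ge c\|\xi\|$. *)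

theory Defs
  imports
    "HOL-Analysis.Analysis"
    "HOL-Algebra.Coset"
    "HOL-Algebra.Generated_Groups"
    "HOL-Algebra.Module"
    "Graph_Theory.Digraph_Component"
begin

section \<open>Coarse structures\<close>

definition coarse_structure :: "'x set \<Rightarrow> 'x rel set \<Rightarrow> bool" where
  "coarse_structure X \<E> \<longleftrightarrow>
     \<E> \<subseteq> Pow (X \<times> X) \<and>
     Id_on X \<in> \<E> \<and>
     (\<forall>E\<in>\<E>. \<forall>F. F \<subseteq> E \<longrightarrow> F \<in> \<E>) \<and>
     (\<forall>E\<in>\<E>. \<forall>F\<in>\<E>. E \<union> F \<in> \<E>) \<and>
     (\<forall>E\<in>\<E>. \<forall>F\<in>\<E>. E O F \<in> \<E>) \<and>
     (\<forall>E\<in>\<E>. E\<inverse> \<in> \<E>)"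

definition coarse_structure_generated :: "'x set \<Rightarrow> 'x rel \<Rightarrow> 'x rel set" where
  "coarse_structure_generated X E = \<Inter>{\<E>. coarse_structure X \<E> \<and> E \<in> \<E>}"

text \<open>The exponent \<open>0\<close> is excluded because \<open>E ^^ 0\<close> is the diagonal of the whole type.\<close>

definition coarse_generating :: "'x rel set \<Rightarrow> 'x rel \<Rightarrow> bool" where
  "coarse_generating \<E> E \<longleftrightarrow> E \<in> \<E> \<and> (\<forall>F\<in>\<E>. \<exists>n\<ge>1. F \<subseteq> E ^^ n)"


section \<open>The translation algebra\<close>

text \<open>
  Matrices indexed by \<open>X\<close> are functions on the whole type; since controlled sets are subsets of
  \<open>X \<times> X\<close>, the elements of the translation algebra vanish off \<open>X \<times> X\<close>.
\<close>

type_synonym 'x cmatrix = "'x \<Rightarrow> 'x \<Rightarrow> complex"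

definition mat_support :: "'x cmatrix \<Rightarrow> 'x rel" where
  "mat_support T = {(x, y). T x y \<noteq> 0}"

definition translation_algebra :: "'x rel set \<Rightarrow> 'x cmatrix set" where
  "translation_algebra \<E> = {T. (\<exists>B. \<forall>x y. cmod (T x y) \<le> B) \<and> mat_support T \<in> \<E>}"

definition mat_one :: "'x set \<Rightarrow> 'x cmatrix" where
  "mat_one X = (\<lambda>x y. if x = y \<and> x \<in> X then 1 else 0)"

definition mat_plus :: "'x cmatrix \<Rightarrow> 'x cmatrix \<Rightarrow> 'x cmatrix" where
  "mat_plus S T = (\<lambda>x y. S x y + T x y)"

definition mat_scale :: "complex \<Rightarrow> 'x cmatrix \<Rightarrow> 'x cmatrix" where
  "mat_scale a T = (\<lambda>x y. a * T x y)"

text \<open>The sum over \<open>z\<close> is restricted to its nonzero terms, which are finite in number for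
  elements of the translation algebra of a space of bounded geometry.\<close>

definition mat_times :: "'x cmatrix \<Rightarrow> 'x cmatrix \<Rightarrow> 'x cmatrix" where
  "mat_times S T = (\<lambda>x y. \<Sum>z | S x z \<noteq> 0 \<and> T z y \<noteq> 0. S x z * T z y)"

definition mat_star :: "'x cmatrix \<Rightarrow> 'x cmatrix" where
  "mat_star T = (\<lambda>x y. cnj (T y x))"

definition translation_matrix :: "'x set \<Rightarrow> ('x \<Rightarrow> 'x) \<Rightarrow> 'x cmatrix" where
  "translation_matrix A t = (\<lambda>x y. if y \<in> A \<and> t y = x then 1 else 0)"

definition partial_translations :: "'x set \<Rightarrow> 'x rel set \<Rightarrow> 'x cmatrix set" where
  "partial_translations X \<E> =
     {translation_matrix A t | A B t.
        A \<subseteq> X \<and> B \<subseteq> X \<and> bij_betw t A B \<and> {(t x, x) | x. x \<in> A} \<in> \<E>}"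


section \<open>Hilbert spaces and representations\<close>

text \<open>
  Hilbert spaces are carrier-based, so that one can quantify over them inside a definition.
  The fields \<^const>\<open>mult\<close> and \<^const>\<open>one\<close>, which the library's module record inherits from
  rings, carry no meaning.
\<close>

definition complex_ring :: "complex ring" where
  "complex_ring = \<lparr>carrier = UNIV, mult = (*), one = 1, zero = 0, add = (+)\<rparr>"

record 'h hilbert = "(complex, 'h) module" +
  cinner :: "'h \<Rightarrow> 'h \<Rightarrow> complex"

definition hnorm :: "('h, 'b) hilbert_scheme \<Rightarrow> 'h \<Rightarrow> real" where
  "hnorm H x = sqrt (Re (cinner H x x))"

locale hilbert_space = module complex_ring H for H :: "('h, 'b) hilbert_scheme" (structure) +
  assumes cinner_add_left:
      "\<lbrakk>x \<in> carrier H; y \<in> carrier H; z \<in> carrier H\<rbrakk>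
        \<Longrightarrow> cinner H (x \<oplus> y) z = cinner H x z + cinner H y z"
    and cinner_smult_left:
      "\<lbrakk>x \<in> carrier H; y \<in> carrier H\<rbrakk> \<Longrightarrow> cinner H (a \<odot> x) y = a * cinner H x y"
    and cinner_commute:
      "\<lbrakk>x \<in> carrier H; y \<in> carrier H\<rbrakk> \<Longrightarrow> cinner H x y = cnj (cinner H y x)"
    and cinner_pos:
      "\<lbrakk>x \<in> carrier H; x \<noteq> \<zero>\<rbrakk> \<Longrightarrow> Re (cinner H x x) > 0"
    and complete:
      "\<lbrakk>range \<sigma> \<subseteq> carrier H;
        \<forall>e>0. \<exists>N. \<forall>m\<ge>N. \<forall>n\<ge>N. hnorm H (\<sigma> m \<ominus> \<sigma> n) < e\<rbrakk>
        \<Longrightarrow> \<exists>l\<in>carrier H. (\<lambda>n. hnorm H (\<sigma> n \<ominus> l)) \<longlonglongrightarrow> 0"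

definition bounded_operator :: "('h, 'b) hilbert_scheme \<Rightarrow> ('h \<Rightarrow> 'h) \<Rightarrow> bool" where
  "bounded_operator H T \<longleftrightarrow>
     T \<in> carrier H \<rightarrow> carrier H \<and>
     (\<forall>x\<in>carrier H. \<forall>y\<in>carrier H. T (x \<oplus>\<^bsub>H\<^esub> y) = T x \<oplus>\<^bsub>H\<^esub> T y) \<and>
     (\<forall>a. \<forall>x\<in>carrier H. T (a \<odot>\<^bsub>H\<^esub> x) = a \<odot>\<^bsub>H\<^esub> T x) \<and>
     (\<exists>B. \<forall>x\<in>carrier H. hnorm H (T x) \<le> B * hnorm H x)"

text \<open>Operators are only relevant through their values on \<^term>\<open>carrier H\<close>, and equality of
  operators is equality there.\<close>

locale representation = hilbert_space H
  for X :: "'x set" and \<E> :: "'x rel set" and H :: "('h, 'b) hilbert_scheme" (structure) +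
  fixes \<pi> :: "'x cmatrix \<Rightarrow> 'h \<Rightarrow> 'h"
  assumes rep_bounded: "T \<in> translation_algebra \<E> \<Longrightarrow> bounded_operator H (\<pi> T)"
    and rep_one: "\<xi> \<in> carrier H \<Longrightarrow> \<pi> (mat_one X) \<xi> = \<xi>"
    and rep_plus: "\<lbrakk>S \<in> translation_algebra \<E>; T \<in> translation_algebra \<E>; \<xi> \<in> carrier H\<rbrakk>
        \<Longrightarrow> \<pi> (mat_plus S T) \<xi> = \<pi> S \<xi> \<oplus> \<pi> T \<xi>"
    and rep_scale: "\<lbrakk>T \<in> translation_algebra \<E>; \<xi> \<in> carrier H\<rbrakk>
        \<Longrightarrow> \<pi> (mat_scale a T) \<xi> = a \<odot> \<pi> T \<xi>"
    and rep_times: "\<lbrakk>S \<in> translation_algebra \<E>; T \<in> translation_algebra \<E>; \<xi> \<in> carrier H\<rbrakk>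
        \<Longrightarrow> \<pi> (mat_times S T) \<xi> = \<pi> S (\<pi> T \<xi>)"
    and rep_star: "\<lbrakk>T \<in> translation_algebra \<E>; \<xi> \<in> carrier H; \<eta> \<in> carrier H\<rbrakk>
        \<Longrightarrow> cinner H (\<pi> T \<xi>) \<eta> = cinner H \<xi> (\<pi> (mat_star T) \<eta>)"

definition constant_vectors ::
    "'x set \<Rightarrow> 'x rel set \<Rightarrow> ('h, 'b) hilbert_scheme \<Rightarrow> ('x cmatrix \<Rightarrow> 'h \<Rightarrow> 'h) \<Rightarrow> 'h set" where
  "constant_vectors X \<E> H \<pi> =
     {\<xi> \<in> carrier H. \<forall>v\<in>partial_translations X \<E>. \<pi> v \<xi> = \<pi> (mat_times v (mat_star v)) \<xi>}"

definition orthogonal_complement :: "('h, 'b) hilbert_scheme \<Rightarrow> 'h set \<Rightarrow> 'h set" where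
  "orthogonal_complement H A = {\<xi> \<in> carrier H. \<forall>\<eta>\<in>A. cinner H \<xi> \<eta> = 0}"


section \<open>Geometric property (T)\<close>

definition displaces_nonconstant_vectors ::
    "'x set \<Rightarrow> 'x rel set \<Rightarrow> 'x rel \<Rightarrow> real \<Rightarrow> ('h, 'b) hilbert_scheme \<Rightarrow>
      ('x cmatrix \<Rightarrow> 'h \<Rightarrow> 'h) \<Rightarrow> bool" where
  "displaces_nonconstant_vectors X \<E> E c H \<pi> \<longleftrightarrow>
     (\<forall>\<xi> \<in> orthogonal_complement H (constant_vectors X \<E> H \<pi>).
        \<exists>v\<in>partial_translations X \<E>. mat_support v \<subseteq> E \<and>
          hnorm H (\<pi> (mat_times v (mat_star v)) \<xi> \<ominus>\<^bsub>H\<^esub> \<pi> v \<xi>) \<ge> c * hnorm H \<xi>)"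

text \<open>
  A definition cannot quantify over types, so \<open>H\<close> ranges over all Hilbert spaces whose carrier
  consists of sequences of matrices. In bounded geometry this is no restriction: the closed
  invariant subspace generated by \<open>\<xi>\<close> consists of limits of sequences \<open>\<pi> (T\<^sub>n) \<xi>\<close>, hence embeds
  in this type. See \<open>geometric_property_T_any_type\<close> below.
\<close>

definition geometric_property_T :: "'x set \<Rightarrow> 'x rel set \<Rightarrow> bool" where
  "geometric_property_T X \<E> \<longleftrightarrow>
     (\<forall>E. coarse_generating \<E> E \<longrightarrow>
        (\<exists>c>0. \<forall>(H :: (nat \<Rightarrow> 'x cmatrix) hilbert) \<pi>.
           representation X \<E> H \<pi> \<longrightarrow> displaces_nonconstant_vectors X \<E> E c H \<pi>))"


section \<open>Expanders\<close>

definition ell2 :: "'v pair_pre_digraph \<Rightarrow> ('v \<Rightarrow> complex) set" where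
  "ell2 \<G> = {f. \<forall>x. x \<notin> pverts \<G> \<longrightarrow> f x = 0}"

definition graph_laplacian :: "'v pair_pre_digraph \<Rightarrow> ('v \<Rightarrow> complex) \<Rightarrow> 'v \<Rightarrow> complex" where
  "graph_laplacian \<G> f =
     (\<lambda>x. of_nat (out_degree \<G> x) * f x - (\<Sum>y | (x, y) \<in> parcs \<G>. f y))"

text \<open>For a finite graph \<^term>\<open>ell2 \<G>\<close> is finite-dimensional, so that boundedness of the
  inverse is automatic.\<close>

definition laplacian_spectrum :: "'v pair_pre_digraph \<Rightarrow> complex set" where
  "laplacian_spectrum \<G> =
     {l. \<not> bij_betw (\<lambda>f x. graph_laplacian \<G> f x - l * f x) (ell2 \<G>) (ell2 \<G>)}"

definition expander :: "(nat \<Rightarrow> 'v pair_pre_digraph) \<Rightarrow> bool" where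
  "expander \<G> \<longleftrightarrow>
     (\<forall>n. pair_graph (\<G> n) \<and> Digraph_Component.connected (\<G> n)) \<and>
     filterlim (\<lambda>n. card (pverts (\<G> n))) at_top sequentially \<and>
     (\<exists>d. \<forall>n. \<forall>x\<in>pverts (\<G> n). out_degree (\<G> n) x \<le> d) \<and>
     (\<exists>c>0. \<forall>n. laplacian_spectrum (\<G> n) \<subseteq> {0} \<union> complex_of_real ` {c..})"


section \<open>Sequences of finite quotients\<close>

locale quotient_data = group G for G (structure) +
  fixes S :: "'a set" and N :: "nat \<Rightarrow> 'a set"
  assumes infinite_carrier: "infinite (carrier G)"
    and finite_gens: "finite S"
    and gens_closed: "S \<subseteq> carrier G"
    and gens_sym: "S = (\<lambda>s. inv s) ` S"
    and gens_generate: "generate G S = carrier G"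
    and N_0: "N 0 = carrier G"
    and N_decreasing: "N (Suc n) \<subseteq> N n"
    and N_normal: "N n \<lhd> G"
    and N_finite_index: "finite (rcosets (N n))"
    and N_Inter: "(\<Inter>n. N n) = {\<one>}"

definition quotient_edges :: "('a, 'b) monoid_scheme \<Rightarrow> 'a set \<Rightarrow> 'a set \<Rightarrow> 'a set rel" where
  "quotient_edges G S K =
     {(x, y). x \<in> carrier (G Mod K) \<and> y \<in> carrier (G Mod K) \<and>
        inv\<^bsub>G Mod K\<^esub> x \<otimes>\<^bsub>G Mod K\<^esub> y \<in> (\<lambda>s. K #>\<^bsub>G\<^esub> s) ` S}"

definition quotient_graph :: "('a, 'b) monoid_scheme \<Rightarrow> 'a set \<Rightarrow> 'a set \<Rightarrow> 'a set pair_pre_digraph" where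
  "quotient_graph G S K =
     \<lparr>pverts = carrier (G Mod K), parcs = {(x, y) \<in> quotient_edges G S K. x \<noteq> y}\<rparr>"

definition box_space :: "('a, 'b) monoid_scheme \<Rightarrow> (nat \<Rightarrow> 'a set) \<Rightarrow> (nat \<times> 'a set) set" where
  "box_space G N = (SIGMA n:UNIV. carrier (G Mod N n))"

definition box_edges ::
    "('a, 'b) monoid_scheme \<Rightarrow> 'a set \<Rightarrow> (nat \<Rightarrow> 'a set) \<Rightarrow> (nat \<times> 'a set) rel" where
  "box_edges G S N = {((n, x), (n, y)) | n x y. (x, y) \<in> quotient_edges G S (N n)}"

definition box_coarse_structure ::
    "('a, 'b) monoid_scheme \<Rightarrow> 'a set \<Rightarrow> (nat \<Rightarrow> 'a set) \<Rightarrow> (nat \<times> 'a set) rel set" where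
  "box_coarse_structure G S N = coarse_structure_generated (box_space G N) (box_edges G S N)"


section \<open>Independence of the carrier type\<close>

definition bounded_geometry :: "'x rel set \<Rightarrow> bool" where
  "bounded_geometry \<E> \<longleftrightarrow>
     (\<forall>E\<in>\<E>. \<exists>k. \<forall>x. finite (E `` {x}) \<and> card (E `` {x}) \<le> k)"

lemma translation_algebra_one:
  assumes "coarse_structure X \<E>"
  shows "mat_one X \<in> translation_algebra \<E>"
proof -
  have "mat_support (mat_one X) = Id_on X"
    by (auto simp: mat_support_def mat_one_def split: if_splits)
  moreover have "\<exists>B. \<forall>x y. cmod (mat_one X x y) \<le> B"
    by (rule exI[of _ 1]) (auto simp: mat_one_def)
  ultimately show ?thesis
    using assms by (simp add: translation_algebra_def coarse_structure_def)
qed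

lemma translation_algebra_plus:
  assumes "coarse_structure X \<E>" "S \<in> translation_algebra \<E>" "T \<in> translation_algebra \<E>"
  shows "mat_plus S T \<in> translation_algebra \<E>"
proof -
  obtain B C where B: "\<And>x y. cmod (S x y) \<le> B" and C: "\<And>x y. cmod (T x y) \<le> C"
    using assms by (auto simp: translation_algebra_def)
  have "mat_support (mat_plus S T) \<subseteq> mat_support S \<union> mat_support T"
    by (auto simp: mat_support_def mat_plus_def)
  moreover have "mat_support S \<union> mat_support T \<in> \<E>"
    using assms by (simp add: translation_algebra_def coarse_structure_def)
  ultimately have "mat_support (mat_plus S T) \<in> \<E>"
    using assms(1) unfolding coarse_structure_def by metis
  moreover have "\<forall>x y. cmod (mat_plus S T x y) \<le> B + C"
    by (auto simp: mat_plus_def intro!: norm_triangle_mono B C)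
  ultimately show ?thesis by (auto simp: translation_algebra_def)
qed

lemma translation_algebra_scale:
  assumes "coarse_structure X \<E>" "T \<in> translation_algebra \<E>"
  shows "mat_scale a T \<in> translation_algebra \<E>"
proof -
  obtain C where C: "\<And>x y. cmod (T x y) \<le> C"
    using assms by (auto simp: translation_algebra_def)
  have "mat_support (mat_scale a T) \<subseteq> mat_support T"
    by (auto simp: mat_support_def mat_scale_def)
  moreover have "mat_support T \<in> \<E>"
    using assms by (simp add: translation_algebra_def)
  ultimately have "mat_support (mat_scale a T) \<in> \<E>"
    using assms(1) unfolding coarse_structure_def by metis
  moreover have "\<forall>x y. cmod (mat_scale a T x y) \<le> cmod a * C"
    by (auto simp: mat_scale_def norm_mult intro!: mult_left_mono C)
  ultimately show ?thesis by (auto simp: translation_algebra_def)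
qed

lemma translation_algebra_star:
  assumes "coarse_structure X \<E>" "T \<in> translation_algebra \<E>"
  shows "mat_star T \<in> translation_algebra \<E>"
proof -
  have "mat_support (mat_star T) = (mat_support T)\<inverse>"
    by (auto simp: mat_support_def mat_star_def)
  then have "mat_support (mat_star T) \<in> \<E>"
    using assms by (simp add: translation_algebra_def coarse_structure_def)
  then show ?thesis
    using assms by (auto simp: translation_algebra_def mat_star_def)
qed

lemma translation_algebra_times:
  assumes "coarse_structure X \<E>" "bounded_geometry \<E>"
    and S: "S \<in> translation_algebra \<E>" and T: "T \<in> translation_algebra \<E>"
  shows "mat_times S T \<in> translation_algebra \<E>"
proof -
  obtain B C where B: "\<And>x y. cmod (S x y) \<le> B" and C: "\<And>x y. cmod (T x y) \<le> C"
    using S T by (auto simp: translation_algebra_def)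
  have B0: "0 \<le> B" using B[of undefined undefined] norm_ge_zero order_trans by blast
  have C0: "0 \<le> C" using C[of undefined undefined] norm_ge_zero order_trans by blast
  obtain k where k: "\<And>x. finite (mat_support S `` {x})" "\<And>x. card (mat_support S `` {x}) \<le> k"
    using assms(2) S unfolding bounded_geometry_def translation_algebra_def by blast
  have "mat_support (mat_times S T) \<subseteq> mat_support S O mat_support T"
  proof (rule subrelI)
    fix x y assume "(x, y) \<in> mat_support (mat_times S T)"
    then have "(\<Sum>z | S x z \<noteq> 0 \<and> T z y \<noteq> 0. S x z * T z y) \<noteq> 0"
      by (simp add: mat_support_def mat_times_def)
    then have "{z. S x z \<noteq> 0 \<and> T z y \<noteq> 0} \<noteq> {}" by force
    then show "(x, y) \<in> mat_support S O mat_support T" by (auto simp: mat_support_def)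
  qed
  moreover have "mat_support S O mat_support T \<in> \<E>"
    using assms by (simp add: translation_algebra_def coarse_structure_def)
  ultimately have "mat_support (mat_times S T) \<in> \<E>"
    using assms(1) unfolding coarse_structure_def by metis
  moreover have "cmod (mat_times S T x y) \<le> real k * (B * C)" for x y
  proof -
    let ?Z = "{z. S x z \<noteq> 0 \<and> T z y \<noteq> 0}"
    have sub: "?Z \<subseteq> mat_support S `` {x}" by (auto simp: mat_support_def)
    have "cmod (mat_times S T x y) \<le> (\<Sum>z\<in>?Z. B * C)"
      unfolding mat_times_def
      by (rule order_trans[OF norm_sum sum_mono]) (auto simp: norm_mult intro!: mult_mono B C B0)
    also have "\<dots> = real (card ?Z) * (B * C)" by simp
    also have "\<dots> \<le> real k * (B * C)"
      using card_mono[OF k(1) sub] k(2)[of x] B0 C0 by (intro mult_right_mono) auto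
    finally show ?thesis .
  qed
  ultimately show ?thesis by (auto simp: translation_algebra_def)
qed

lemma partial_translations_in_algebra:
  "partial_translations X \<E> \<subseteq> translation_algebra \<E>"
proof
  fix v assume "v \<in> partial_translations X \<E>"
  then obtain A t where v: "v = translation_matrix A t" and E: "{(t x, x) | x. x \<in> A} \<in> \<E>"
    by (auto simp: partial_translations_def)
  have "mat_support v = {(t x, x) | x. x \<in> A}"
    unfolding v by (auto simp: mat_support_def translation_matrix_def)
  moreover have "\<forall>x y. cmod (v x y) \<le> 1" by (simp add: v translation_matrix_def)
  ultimately show "v \<in> translation_algebra \<E>"
    using E by (auto simp: translation_algebra_def)
qed

context hilbert_space
begin

lemma carrier_complex_ring [simp]: "carrier complex_ring = UNIV"
  by (simp add: complex_ring_def)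

lemma smult_in [simp, intro]: "x \<in> carrier H \<Longrightarrow> a \<odot> x \<in> carrier H"
  by (rule smult_closed) simp_all

lemma uminus_conv_smult: "x \<in> carrier H \<Longrightarrow> \<ominus> x = (- 1) \<odot> x"
proof -
  assume x: "x \<in> carrier H"
  have "(- 1) \<odot> x \<oplus> 1 \<odot> x = ((- 1) + 1) \<odot> x"
    using smult_l_distr[of "- 1" 1 x] x by (simp add: complex_ring_def)
  also have "\<dots> = \<zero>" using smult_l_null[OF x] by (simp add: complex_ring_def)
  finally have "(- 1) \<odot> x \<oplus> x = \<zero>"
    using smult_one[OF x] by (simp add: complex_ring_def)
  then show ?thesis using M.minus_equality x by blast
qed

lemma minus_conv_smult: "y \<in> carrier H \<Longrightarrow> x \<ominus> y = x \<oplus> (- 1) \<odot> y"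
  by (simp add: a_minus_def uminus_conv_smult)

lemma cinner_add_right:
  "\<lbrakk>x \<in> carrier H; y \<in> carrier H; z \<in> carrier H\<rbrakk>
    \<Longrightarrow> cinner H z (x \<oplus> y) = cinner H z x + cinner H z y"
  using cinner_commute[of z "x \<oplus> y"] cinner_commute[of z x] cinner_commute[of z y]
  by (simp add: cinner_add_left)

lemma cinner_smult_right:
  "\<lbrakk>x \<in> carrier H; y \<in> carrier H\<rbrakk> \<Longrightarrow> cinner H x (a \<odot> y) = cnj a * cinner H x y"
  using cinner_commute[of x "a \<odot> y"] cinner_commute[of x y] by (simp add: cinner_smult_left)

lemma cinner_zero: "cinner H \<zero> \<zero> = 0"
  using cinner_smult_left[of \<zero> \<zero> 0] smult_l_null[of \<zero>] by (simp add: complex_ring_def)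

lemma cinner_self_nonneg: "x \<in> carrier H \<Longrightarrow> Re (cinner H x x) \<ge> 0"
  using cinner_pos[of x] cinner_zero by (cases "x = \<zero>") auto

lemma hnorm_nonneg: "x \<in> carrier H \<Longrightarrow> hnorm H x \<ge> 0"
  by (simp add: hnorm_def cinner_self_nonneg)

lemma hnorm_power2: "x \<in> carrier H \<Longrightarrow> (hnorm H x)\<^sup>2 = Re (cinner H x x)"
  by (simp add: hnorm_def cinner_self_nonneg)

lemma hnorm_zero [simp]: "hnorm H \<zero> = 0"
  by (simp add: hnorm_def cinner_zero)

lemma hnorm_smult: "x \<in> carrier H \<Longrightarrow> hnorm H (a \<odot> x) = cmod a * hnorm H x"
proof -
  assume x: "x \<in> carrier H"
  have "cinner H (a \<odot> x) (a \<odot> x) = of_real ((cmod a)\<^sup>2) * cinner H x x"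
    using x complex_norm_square[of a]
    by (simp add: cinner_smult_left cinner_smult_right mult.assoc[symmetric])
  then show ?thesis by (simp add: hnorm_def real_sqrt_mult)
qed

lemma hnorm_minus_commute:
  assumes "x \<in> carrier H" "y \<in> carrier H"
  shows "hnorm H (x \<ominus> y) = hnorm H (y \<ominus> x)"
proof -
  have "\<ominus> (y \<ominus> x) = x \<ominus> y"
    using assms by (simp add: a_minus_def M.minus_add M.a_comm)
  then show ?thesis
    using assms hnorm_smult[of "y \<ominus> x" "- 1"] uminus_conv_smult[of "y \<ominus> x"] by simp
qed

lemma hnorm_add_less:
  assumes x: "x \<in> carrier H" and y: "y \<in> carrier H"
    and less: "hnorm H x < e / 2" "hnorm H y < e / 2"
  shows "hnorm H (x \<oplus> y) < e"
proof -
  let ?y = "(- 1) \<odot> y"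
  have "Re (cinner H (x \<oplus> y) (x \<oplus> y)) + Re (cinner H (x \<oplus> ?y) (x \<oplus> ?y))
      = 2 * Re (cinner H x x) + 2 * Re (cinner H y y)"
    using x y
    by (simp add: cinner_add_left cinner_add_right cinner_smult_left cinner_smult_right)
  then have "(hnorm H (x \<oplus> y))\<^sup>2 \<le> 2 * (hnorm H x)\<^sup>2 + 2 * (hnorm H y)\<^sup>2"
    using x y cinner_self_nonneg[of "x \<oplus> ?y"] by (simp add: hnorm_power2)
  also have "\<dots> < 2 * (e / 2)\<^sup>2 + 2 * (e / 2)\<^sup>2"
    using less x y by (intro add_strict_mono mult_strict_left_mono power_strict_mono)
      (auto simp: hnorm_nonneg)
  also have "\<dots> = e\<^sup>2" by (simp add: power2_eq_square)
  finally show ?thesis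
    using less hnorm_nonneg[OF x] by (intro power_less_imp_less_base[of _ 2 e]) auto
qed

lemma hnorm_triangle_less:
  assumes x: "x \<in> carrier H" and y: "y \<in> carrier H" and z: "z \<in> carrier H"
    and "hnorm H (x \<ominus> y) < e / 2" "hnorm H (y \<ominus> z) < e / 2"
  shows "hnorm H (x \<ominus> z) < e"
proof -
  have "(\<ominus> y) \<oplus> (y \<oplus> (\<ominus> z)) = \<ominus> z"
    using y z by (simp add: M.a_assoc[symmetric] M.l_neg)
  then have "(x \<ominus> y) \<oplus> (y \<ominus> z) = x \<ominus> z"
    using x y z by (simp add: a_minus_def M.a_assoc)
  then show ?thesis using hnorm_add_less[of "x \<ominus> y" "y \<ominus> z" e] assms by simp
qed

lemma hnorm_minus_eq_0:
  assumes x: "x \<in> carrier H" and y: "y \<in> carrier H"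
    and small: "\<And>e. e > 0 \<Longrightarrow> hnorm H (x \<ominus> y) < e"
  shows "x = y"
proof -
  have d: "x \<ominus> y \<in> carrier H" using x y by simp
  have "hnorm H (x \<ominus> y) = 0"
    using small[of "hnorm H (x \<ominus> y)"] hnorm_nonneg[OF d] by fastforce
  then have "x \<ominus> y = \<zero>" using cinner_pos[OF d] hnorm_power2[OF d] by fastforce
  moreover have "(x \<ominus> y) \<oplus> y = x"
    using x y by (simp add: a_minus_def M.a_assoc M.l_neg)
  ultimately show ?thesis using y by simp
qed

end

text \<open>Restriction of a Hilbert space to a subset \<open>K\<close>, transported along an injection \<open>f\<close>.\<close>

definition transport_hilbert :: "'h hilbert \<Rightarrow> 'h set \<Rightarrow> ('h \<Rightarrow> 'k) \<Rightarrow> 'k hilbert" where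
  "transport_hilbert H K f = (let g = inv_into K f in
     \<lparr>carrier = f ` K, mult = undefined, one = undefined, zero = f \<zero>\<^bsub>H\<^esub>,
      add = (\<lambda>a b. f (g a \<oplus>\<^bsub>H\<^esub> g b)), smult = (\<lambda>c a. f (c \<odot>\<^bsub>H\<^esub> g a)),
      cinner = (\<lambda>a b. cinner H (g a) (g b))\<rparr>)"

locale hilbert_transport = hilbert_space H for H :: "'h hilbert" (structure) +
  fixes K :: "'h set" and f :: "'h \<Rightarrow> 'k"
  assumes K_sub: "K \<subseteq> carrier H"
    and K_zero: "\<zero> \<in> K"
    and K_add: "\<lbrakk>x \<in> K; y \<in> K\<rbrakk> \<Longrightarrow> x \<oplus> y \<in> K"
    and K_smult: "x \<in> K \<Longrightarrow> a \<odot> x \<in> K"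
    and K_closed: "\<lbrakk>l \<in> carrier H; \<And>e. e > 0 \<Longrightarrow> \<exists>x\<in>K. hnorm H (x \<ominus> l) < e\<rbrakk> \<Longrightarrow> l \<in> K"
    and f_inj: "inj_on f K"
begin

abbreviation "H' \<equiv> transport_hilbert H K f"

lemma transport_simps:
  "carrier H' = f ` K" "\<zero>\<^bsub>H'\<^esub> = f \<zero>"
  "\<lbrakk>x \<in> K; y \<in> K\<rbrakk> \<Longrightarrow> f x \<oplus>\<^bsub>H'\<^esub> f y = f (x \<oplus> y)"
  "x \<in> K \<Longrightarrow> a \<odot>\<^bsub>H'\<^esub> f x = f (a \<odot> x)"
  "\<lbrakk>x \<in> K; y \<in> K\<rbrakk> \<Longrightarrow> cinner H' (f x) (f y) = cinner H x y"
  "x \<in> K \<Longrightarrow> hnorm H' (f x) = hnorm H x"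
  using f_inj by (simp_all add: transport_hilbert_def Let_def hnorm_def)

lemma K_carrier: "x \<in> K \<Longrightarrow> x \<in> carrier H"
  using K_sub by blast

lemma K_minus: "\<lbrakk>x \<in> K; y \<in> K\<rbrakk> \<Longrightarrow> x \<ominus> y \<in> K"
  using K_carrier by (simp add: minus_conv_smult K_add K_smult)

lemma f_eq_iff: "\<lbrakk>x \<in> K; y \<in> K\<rbrakk> \<Longrightarrow> f x = f y \<longleftrightarrow> x = y"
  using f_inj by (auto dest: inj_onD)

lemma module_transport: "module complex_ring H'"
proof (rule moduleI)
  show "cring complex_ring" by (rule R.is_cring)
  show "abelian_group H'"
  proof (rule abelian_groupI)
    fix x assume "x \<in> carrier H'"
    then obtain a where a: "a \<in> K" "x = f a" by (auto simp: transport_simps)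
    have "f ((- 1) \<odot> a) \<oplus>\<^bsub>H'\<^esub> f a = f ((- 1) \<odot> a \<oplus> a)"
      using a K_smult by (simp add: transport_simps)
    also have "(- 1) \<odot> a \<oplus> a = \<zero>"
      using a K_carrier by (simp add: uminus_conv_smult[symmetric] M.l_neg)
    finally show "\<exists>y\<in>carrier H'. y \<oplus>\<^bsub>H'\<^esub> x = \<zero>\<^bsub>H'\<^esub>"
      using a K_smult by (auto simp: transport_simps)
  qed (auto simp: transport_simps K_zero K_add K_carrier M.a_ac)
next
  fix a b :: complex and x y
  assume "x \<in> carrier H'"
  then obtain u where u: "u \<in> K" "x = f u" by (auto simp: transport_simps)
  show "a \<odot>\<^bsub>H'\<^esub> x \<in> carrier H'" using u by (simp add: transport_simps K_smult)
  show "(a \<oplus>\<^bsub>complex_ring\<^esub> b) \<odot>\<^bsub>H'\<^esub> x = a \<odot>\<^bsub>H'\<^esub> x \<oplus>\<^bsub>H'\<^esub> b \<odot>\<^bsub>H'\<^esub> x"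
    using u by (simp add: transport_simps K_smult K_carrier smult_l_distr)
  show "(a \<otimes>\<^bsub>complex_ring\<^esub> b) \<odot>\<^bsub>H'\<^esub> x = a \<odot>\<^bsub>H'\<^esub> (b \<odot>\<^bsub>H'\<^esub> x)"
    using u by (simp add: transport_simps K_smult K_carrier smult_assoc1)
  show "\<one>\<^bsub>complex_ring\<^esub> \<odot>\<^bsub>H'\<^esub> x = x"
    using u by (simp add: transport_simps K_carrier)
  assume "y \<in> carrier H'"
  then obtain v where v: "v \<in> K" "y = f v" by (auto simp: transport_simps)
  show "a \<odot>\<^bsub>H'\<^esub> (x \<oplus>\<^bsub>H'\<^esub> y) = a \<odot>\<^bsub>H'\<^esub> x \<oplus>\<^bsub>H'\<^esub> a \<odot>\<^bsub>H'\<^esub> y"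
    using u v by (simp add: transport_simps K_smult K_add K_carrier smult_r_distr)
qed

lemma transport_minus:
  assumes "x \<in> K" "y \<in> K"
  shows "f x \<ominus>\<^bsub>H'\<^esub> f y = f (x \<ominus> y)"
proof -
  interpret H': module complex_ring H' by (rule module_transport)
  have "f ((- 1) \<odot> y) \<oplus>\<^bsub>H'\<^esub> f y = f ((- 1) \<odot> y \<oplus> y)"
    using assms K_smult by (simp add: transport_simps)
  also have "(- 1) \<odot> y \<oplus> y = \<zero>"
    using assms K_carrier by (simp add: uminus_conv_smult[symmetric] M.l_neg)
  finally have "\<ominus>\<^bsub>H'\<^esub> f y = f ((- 1) \<odot> y)"
    using assms K_smult by (intro H'.M.minus_equality) (auto simp: transport_simps)
  then show ?thesis
    using assms K_carrier K_smult by (simp add: a_minus_def[of H'] minus_conv_smult transport_simps)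
qed

lemma hilbert_space_transport: "hilbert_space H'"
proof (intro hilbert_space.intro hilbert_space_axioms.intro module_transport)
  fix \<sigma> :: "nat \<Rightarrow> 'k"
  assume \<sigma>: "range \<sigma> \<subseteq> carrier H'"
    and cauchy: "\<forall>e>0. \<exists>N. \<forall>m\<ge>N. \<forall>n\<ge>N. hnorm H' (\<sigma> m \<ominus>\<^bsub>H'\<^esub> \<sigma> n) < e"
  define \<tau> where "\<tau> n = inv_into K f (\<sigma> n)" for n
  have \<tau>: "\<tau> n \<in> K" "\<sigma> n = f (\<tau> n)" for n
    using \<sigma> by (auto simp: \<tau>_def transport_simps image_subset_iff inv_into_into f_inv_into_f)
  have "\<forall>e>0. \<exists>N. \<forall>m\<ge>N. \<forall>n\<ge>N. hnorm H (\<tau> m \<ominus> \<tau> n) < e"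
    using cauchy by (simp add: \<tau> transport_minus transport_simps K_minus)
  moreover have "range \<tau> \<subseteq> carrier H" using \<tau> K_carrier by auto
  ultimately obtain l where l: "l \<in> carrier H" and lim: "(\<lambda>n. hnorm H (\<tau> n \<ominus> l)) \<longlonglongrightarrow> 0"
    using complete by blast
  have "l \<in> K"
  proof (rule K_closed[OF l])
    fix e :: real assume "e > 0"
    then have "\<forall>\<^sub>F n in sequentially. hnorm H (\<tau> n \<ominus> l) < e"
      using order_tendstoD(2)[OF lim] by simp
    then show "\<exists>x\<in>K. hnorm H (x \<ominus> l) < e"
      using \<tau>(1) by (auto simp: eventually_sequentially)
  qed
  then show "\<exists>l\<in>carrier H'. (\<lambda>n. hnorm H' (\<sigma> n \<ominus>\<^bsub>H'\<^esub> l)) \<longlonglongrightarrow> 0"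
    using lim by (intro bexI[of _ "f l"])
      (simp_all add: \<tau> transport_minus transport_simps K_minus)
next
  show "0 < Re (cinner H' x x)" if "x \<in> carrier H'" "x \<noteq> \<zero>\<^bsub>H'\<^esub>" for x
  proof -
    obtain u where "u \<in> K" "x = f u" using \<open>x \<in> carrier H'\<close> by (auto simp: transport_simps)
    then show ?thesis using that(2) cinner_pos[of u] by (auto simp: transport_simps K_carrier)
  qed
  show "cinner H' x y = cnj (cinner H' y x)" if xy: "x \<in> carrier H'" "y \<in> carrier H'" for x y
  proof -
    obtain u v where "u \<in> K" "x = f u" "v \<in> K" "y = f v"
      using xy by (auto simp: transport_simps)
    then show ?thesis using cinner_commute[of u v] by (simp add: transport_simps K_carrier)
  qed
qed (auto simp: transport_simps K_add K_smult K_carrier cinner_add_left cinner_smult_left)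

end

context representation
begin

lemma rep_op:
  assumes "T \<in> translation_algebra \<E>"
  shows "\<xi> \<in> carrier H \<Longrightarrow> \<pi> T \<xi> \<in> carrier H"
    and "\<lbrakk>\<xi> \<in> carrier H; \<eta> \<in> carrier H\<rbrakk> \<Longrightarrow> \<pi> T (\<xi> \<oplus> \<eta>) = \<pi> T \<xi> \<oplus> \<pi> T \<eta>"
    and "\<xi> \<in> carrier H \<Longrightarrow> \<pi> T (a \<odot> \<xi>) = a \<odot> \<pi> T \<xi>"
    and "\<lbrakk>\<xi> \<in> carrier H; \<eta> \<in> carrier H\<rbrakk> \<Longrightarrow> \<pi> T (\<xi> \<ominus> \<eta>) = \<pi> T \<xi> \<ominus> \<pi> T \<eta>"
  using rep_bounded[OF assms] by (auto simp: bounded_operator_def Pi_iff minus_conv_smult)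

definition cyclic_subspace :: "'h \<Rightarrow> 'h set" where
  "cyclic_subspace \<xi> =
     {\<eta> \<in> carrier H. \<forall>e>0. \<exists>T\<in>translation_algebra \<E>. hnorm H (\<pi> T \<xi> \<ominus> \<eta>) < e}"

lemma cyclic_subspaceD:
  "\<lbrakk>\<eta> \<in> cyclic_subspace \<xi>; e > 0\<rbrakk>
    \<Longrightarrow> \<exists>T\<in>translation_algebra \<E>. hnorm H (\<pi> T \<xi> \<ominus> \<eta>) < e"
  by (simp add: cyclic_subspace_def)

lemma cyclic_subspace_carrier: "\<eta> \<in> cyclic_subspace \<xi> \<Longrightarrow> \<eta> \<in> carrier H"
  by (simp add: cyclic_subspace_def)

lemma cyclic_subspace_orbit:
  assumes "\<xi> \<in> carrier H" "T \<in> translation_algebra \<E>"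
  shows "\<pi> T \<xi> \<in> cyclic_subspace \<xi>"
  using assms rep_op(1)[OF assms(2,1)] M.r_neg[of "\<pi> T \<xi>"]
  by (auto simp: cyclic_subspace_def a_minus_def intro!: bexI[of _ T])

lemma cyclic_subspace_closed:
  assumes \<xi>: "\<xi> \<in> carrier H" and l: "l \<in> carrier H"
    and close: "\<And>e. e > 0 \<Longrightarrow> \<exists>x\<in>cyclic_subspace \<xi>. hnorm H (x \<ominus> l) < e"
  shows "l \<in> cyclic_subspace \<xi>"
  unfolding cyclic_subspace_def
proof (intro CollectI conjI l allI impI)
  fix e :: real assume "e > 0"
  then obtain x where x: "x \<in> cyclic_subspace \<xi>" "hnorm H (x \<ominus> l) < e / 2"
    using close[of "e / 2"] by auto
  then obtain T where "T \<in> translation_algebra \<E>" "hnorm H (\<pi> T \<xi> \<ominus> x) < e / 2"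
    using cyclic_subspaceD[of x \<xi> "e / 2"] \<open>e > 0\<close> by auto
  then show "\<exists>T\<in>translation_algebra \<E>. hnorm H (\<pi> T \<xi> \<ominus> l) < e"
    using x l \<xi> by (meson hnorm_triangle_less rep_op(1) cyclic_subspace_carrier)
qed

lemma cyclic_subspace_add:
  assumes coarse: "coarse_structure X \<E>" and \<xi>: "\<xi> \<in> carrier H"
    and x: "x \<in> cyclic_subspace \<xi>" and y: "y \<in> cyclic_subspace \<xi>"
  shows "x \<oplus> y \<in> cyclic_subspace \<xi>"
  unfolding cyclic_subspace_def
proof (intro CollectI conjI allI impI)
  have xc: "x \<in> carrier H" and yc: "y \<in> carrier H" using x y cyclic_subspace_carrier by auto
  then show "x \<oplus> y \<in> carrier H" by simp
  fix e :: real assume "e > 0"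
  then obtain S T where S: "S \<in> translation_algebra \<E>" "hnorm H (\<pi> S \<xi> \<ominus> x) < e / 2"
    and T: "T \<in> translation_algebra \<E>" "hnorm H (\<pi> T \<xi> \<ominus> y) < e / 2"
    using cyclic_subspaceD[OF x, of "e / 2"] cyclic_subspaceD[OF y, of "e / 2"] by auto
  have c: "\<pi> S \<xi> \<in> carrier H" "\<pi> T \<xi> \<in> carrier H" using S T \<xi> rep_op(1) by auto
  have "(\<pi> S \<xi> \<ominus> x) \<oplus> (\<pi> T \<xi> \<ominus> y) = (\<pi> S \<xi> \<oplus> \<pi> T \<xi>) \<ominus> (x \<oplus> y)"
    using c xc yc by (simp add: a_minus_def M.minus_add M.a_ac)
  then have "hnorm H (\<pi> (mat_plus S T) \<xi> \<ominus> (x \<oplus> y)) < e"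
    using hnorm_add_less[of "\<pi> S \<xi> \<ominus> x" "\<pi> T \<xi> \<ominus> y" e] c xc yc S T \<xi> by (simp add: rep_plus)
  then show "\<exists>T\<in>translation_algebra \<E>. hnorm H (\<pi> T \<xi> \<ominus> (x \<oplus> y)) < e"
    using translation_algebra_plus[OF coarse S(1) T(1)] by blast
qed

lemma cyclic_subspace_smult:
  assumes coarse: "coarse_structure X \<E>" and \<xi>: "\<xi> \<in> carrier H" and x: "x \<in> cyclic_subspace \<xi>"
  shows "a \<odot> x \<in> cyclic_subspace \<xi>"
  unfolding cyclic_subspace_def
proof (intro CollectI conjI allI impI)
  have xc: "x \<in> carrier H" using x cyclic_subspace_carrier by auto
  then show "a \<odot> x \<in> carrier H" by simp
  fix e :: real assume e: "e > 0"
  have pos: "cmod a + 1 > 0" by (simp add: add_nonneg_pos)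
  obtain T where T: "T \<in> translation_algebra \<E>" "hnorm H (\<pi> T \<xi> \<ominus> x) < e / (cmod a + 1)"
    using cyclic_subspaceD[OF x, of "e / (cmod a + 1)"] e pos by auto
  have c: "\<pi> T \<xi> \<in> carrier H" using T \<xi> rep_op(1) by auto
  have "a \<odot> (\<pi> T \<xi> \<ominus> x) = \<pi> (mat_scale a T) \<xi> \<ominus> a \<odot> x"
    using c xc T \<xi>
    by (simp add: rep_scale a_minus_def smult_r_distr smult_r_minus)
  then have "hnorm H (\<pi> (mat_scale a T) \<xi> \<ominus> a \<odot> x) = cmod a * hnorm H (\<pi> T \<xi> \<ominus> x)"
    using hnorm_smult[of "\<pi> T \<xi> \<ominus> x" a] c xc by simp
  also have "\<dots> \<le> (cmod a + 1) * hnorm H (\<pi> T \<xi> \<ominus> x)"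
    using c xc by (intro mult_right_mono hnorm_nonneg) auto
  also have "\<dots> < e" using T(2) pos by (simp add: pos_less_divide_eq mult.commute)
  finally show "\<exists>T\<in>translation_algebra \<E>. hnorm H (\<pi> T \<xi> \<ominus> a \<odot> x) < e"
    using translation_algebra_scale[OF coarse T(1)] by blast
qed

lemma cyclic_subspace_invariant:
  assumes coarse: "coarse_structure X \<E>" and bg: "bounded_geometry \<E>"
    and \<xi>: "\<xi> \<in> carrier H" and x: "x \<in> cyclic_subspace \<xi>" and S: "S \<in> translation_algebra \<E>"
  shows "\<pi> S x \<in> cyclic_subspace \<xi>"
  unfolding cyclic_subspace_def
proof (intro CollectI conjI allI impI)
  have xc: "x \<in> carrier H" using x cyclic_subspace_carrier by auto
  then show "\<pi> S x \<in> carrier H" using S by (simp add: rep_op)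
  fix e :: real assume e: "e > 0"
  obtain B where B: "\<And>y. y \<in> carrier H \<Longrightarrow> hnorm H (\<pi> S y) \<le> B * hnorm H y"
    using rep_bounded[OF S] unfolding bounded_operator_def by blast
  have pos: "\<bar>B\<bar> + 1 > 0" by (simp add: add_nonneg_pos)
  obtain T where T: "T \<in> translation_algebra \<E>" "hnorm H (\<pi> T \<xi> \<ominus> x) < e / (\<bar>B\<bar> + 1)"
    using cyclic_subspaceD[OF x, of "e / (\<bar>B\<bar> + 1)"] e pos by auto
  have c: "\<pi> T \<xi> \<in> carrier H" using T \<xi> rep_op(1) by auto
  have "hnorm H (\<pi> (mat_times S T) \<xi> \<ominus> \<pi> S x) = hnorm H (\<pi> S (\<pi> T \<xi> \<ominus> x))"
    using c xc S T \<xi> by (simp add: rep_times rep_op)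
  also have "\<dots> \<le> B * hnorm H (\<pi> T \<xi> \<ominus> x)" using B c xc by simp
  also have "\<dots> \<le> (\<bar>B\<bar> + 1) * hnorm H (\<pi> T \<xi> \<ominus> x)"
    using c xc by (intro mult_right_mono hnorm_nonneg) auto
  also have "\<dots> < e" using T(2) pos by (simp add: pos_less_divide_eq mult.commute)
  finally show "\<exists>T\<in>translation_algebra \<E>. hnorm H (\<pi> T \<xi> \<ominus> \<pi> S x) < e"
    using translation_algebra_times[OF coarse bg S T(1)] by blast
qed

lemma cyclic_subspace_encoding:
  assumes \<xi>: "\<xi> \<in> carrier H"
  obtains f :: "'h \<Rightarrow> nat \<Rightarrow> 'x cmatrix" where "inj_on f (cyclic_subspace \<xi>)"
proof -
  have "\<forall>\<eta>. \<exists>\<sigma>. \<eta> \<in> cyclic_subspace \<xi> \<longrightarrow>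
      (\<forall>n. \<sigma> n \<in> translation_algebra \<E> \<and> hnorm H (\<pi> (\<sigma> n) \<xi> \<ominus> \<eta>) < 1 / real (Suc n))"
  proof
    fix \<eta>
    show "\<exists>\<sigma>. \<eta> \<in> cyclic_subspace \<xi> \<longrightarrow>
      (\<forall>n. \<sigma> n \<in> translation_algebra \<E> \<and> hnorm H (\<pi> (\<sigma> n) \<xi> \<ominus> \<eta>) < 1 / real (Suc n))"
    proof (cases "\<eta> \<in> cyclic_subspace \<xi>")
      case True
      then have "\<forall>n. \<exists>T. T \<in> translation_algebra \<E> \<and>
          hnorm H (\<pi> T \<xi> \<ominus> \<eta>) < 1 / real (Suc n)"
        using cyclic_subspaceD[OF True] by (auto simp: Bex_def)
      then show ?thesis by metis
    qed simp
  qed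
  then obtain f where f: "\<And>\<eta> n. \<eta> \<in> cyclic_subspace \<xi> \<Longrightarrow> f \<eta> n \<in> translation_algebra \<E>"
      "\<And>\<eta> n. \<eta> \<in> cyclic_subspace \<xi> \<Longrightarrow> hnorm H (\<pi> (f \<eta> n) \<xi> \<ominus> \<eta>) < 1 / real (Suc n)"
    by metis
  have "inj_on f (cyclic_subspace \<xi>)"
  proof (rule inj_onI)
    fix x y assume x: "x \<in> cyclic_subspace \<xi>" and y: "y \<in> cyclic_subspace \<xi>" and eq: "f x = f y"
    have xc: "x \<in> carrier H" and yc: "y \<in> carrier H" using x y cyclic_subspace_carrier by auto
    show "x = y"
    proof (rule hnorm_minus_eq_0[OF xc yc])
      fix e :: real assume "e > 0"
      then obtain n where n: "1 / real (Suc n) < e / 2"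
        using nat_approx_posE[of "e / 2"] by auto
      let ?z = "\<pi> (f x n) \<xi>"
      have z: "?z \<in> carrier H" using f(1)[OF x] \<xi> rep_op(1) by blast
      have "hnorm H (x \<ominus> ?z) < e / 2"
        using f(2)[OF x, of n] n hnorm_minus_commute[OF xc z] by simp
      moreover have "hnorm H (?z \<ominus> y) < e / 2"
        using f(2)[OF y, of n] n eq by simp
      ultimately show "hnorm H (x \<ominus> y) < e" by (rule hnorm_triangle_less[OF xc z yc])
    qed
  qed
  then show thesis by (rule that)
qed

end

theorem geometric_property_T_any_type:
  fixes X :: "'x set"
  assumes coarse: "coarse_structure X \<E>" and bg: "bounded_geometry \<E>"
    and T: "geometric_property_T X \<E>" and E: "coarse_generating \<E> E"
  shows "\<exists>c>0. \<forall>(H :: 'h hilbert) \<pi>.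
           representation X \<E> H \<pi> \<longrightarrow> displaces_nonconstant_vectors X \<E> E c H \<pi>"
proof -
  obtain c where c: "c > 0" and disp:
    "\<And>(H :: (nat \<Rightarrow> 'x cmatrix) hilbert) \<pi>.
       representation X \<E> H \<pi> \<Longrightarrow> displaces_nonconstant_vectors X \<E> E c H \<pi>"
    using T E unfolding geometric_property_T_def by meson
  have "displaces_nonconstant_vectors X \<E> E c H \<pi>" if rep: "representation X \<E> H \<pi>"
    for H :: "'h hilbert" and \<pi>
    unfolding displaces_nonconstant_vectors_def
  proof
    fix \<xi> assume orth: "\<xi> \<in> orthogonal_complement H (constant_vectors X \<E> H \<pi>)"
    then have \<xi>: "\<xi> \<in> carrier H" by (simp add: orthogonal_complement_def)
    interpret representation X \<E> H \<pi> by (rule rep)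
    define K where "K = cyclic_subspace \<xi>"
    have \<xi>K: "\<xi> \<in> K"
      using cyclic_subspace_orbit[OF \<xi> translation_algebra_one[OF coarse]] \<xi>
      by (simp add: rep_one K_def)
    have K_zero: "\<zero>\<^bsub>H\<^esub> \<in> K"
      using cyclic_subspace_smult[OF coarse \<xi> \<xi>K[unfolded K_def], of 0] smult_l_null[OF \<xi>]
      by (simp add: K_def complex_ring_def)
    obtain f :: "'h \<Rightarrow> nat \<Rightarrow> 'x cmatrix" where f: "inj_on f K"
      using cyclic_subspace_encoding[OF \<xi>] by (auto simp: K_def)
    interpret hilbert_transport H K f
    proof
      show "K \<subseteq> carrier H" using cyclic_subspace_carrier by (auto simp: K_def)
      show "l \<in> K" if "l \<in> carrier H" "\<And>e. e > 0 \<Longrightarrow> \<exists>x\<in>K. hnorm H (x \<ominus>\<^bsub>H\<^esub> l) < e" for l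
        using that cyclic_subspace_closed[OF \<xi>] by (auto simp: K_def)
    qed (use K_zero f cyclic_subspace_add[OF coarse \<xi>] cyclic_subspace_smult[OF coarse \<xi>]
          in \<open>simp_all add: K_def\<close>)
    have K_inv: "\<pi> S x \<in> K" if "S \<in> translation_algebra \<E>" "x \<in> K" for S x
      using that cyclic_subspace_invariant[OF coarse bg \<xi>] by (simp add: K_def)
    define \<rho> where "\<rho> S a = f (\<pi> S (inv_into K f a))" for S a
    have \<rho>: "\<rho> S (f x) = f (\<pi> S x)" if "x \<in> K" for S x
      using that f by (simp add: \<rho>_def)
    have star: "mat_star S \<in> translation_algebra \<E>" if "S \<in> translation_algebra \<E>" for S
      using that by (rule translation_algebra_star[OF coarse])
    have rep': "representation X \<E> H' \<rho>"
    proof (intro representation.intro representation_axioms.intro hilbert_space_transport)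
      fix S assume S: "S \<in> translation_algebra \<E>"
      obtain B where B: "\<And>y. y \<in> carrier H \<Longrightarrow> hnorm H (\<pi> S y) \<le> B * hnorm H y"
        using rep_bounded[OF S] unfolding bounded_operator_def by blast
      have "\<forall>x\<in>carrier H'. hnorm H' (\<rho> S x) \<le> B * hnorm H' x"
        using S B by (auto simp: transport_simps \<rho> K_inv K_carrier)
      then show "bounded_operator H' (\<rho> S)"
        using S unfolding bounded_operator_def
        by (auto simp: transport_simps \<rho> K_inv K_carrier K_add K_smult rep_op)
    qed (auto simp: transport_simps \<rho> K_inv K_carrier star rep_one rep_plus rep_scale
          rep_times rep_star)
    have pt: "v \<in> translation_algebra \<E>" "mat_times v (mat_star v) \<in> translation_algebra \<E>"
      if "v \<in> partial_translations X \<E>" for v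
    proof -
      show v: "v \<in> translation_algebra \<E>" using that partial_translations_in_algebra by blast
      show "mat_times v (mat_star v) \<in> translation_algebra \<E>"
        by (rule translation_algebra_times[OF coarse bg v star[OF v]])
    qed
    have "f \<xi> \<in> orthogonal_complement H' (constant_vectors X \<E> H' \<rho>)"
      unfolding orthogonal_complement_def
    proof (intro CollectI conjI ballI)
      show "f \<xi> \<in> carrier H'" using \<xi>K by (simp add: transport_simps)
      fix \<eta> assume "\<eta> \<in> constant_vectors X \<E> H' \<rho>"
      then obtain y where y: "y \<in> K" "\<eta> = f y"
        and const: "\<And>v. v \<in> partial_translations X \<E> \<Longrightarrow>
          \<rho> v (f y) = \<rho> (mat_times v (mat_star v)) (f y)"
        by (auto simp: constant_vectors_def transport_simps)
      have "y \<in> constant_vectors X \<E> H \<pi>"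
        unfolding constant_vectors_def
        using y const pt by (auto simp: K_carrier \<rho> f_eq_iff K_inv)
      then have "cinner H \<xi> y = 0" using orth by (simp add: orthogonal_complement_def)
      then show "cinner H' (f \<xi>) \<eta> = 0" using y \<xi>K by (simp add: transport_simps)
    qed
    then obtain v where v: "v \<in> partial_translations X \<E>" "mat_support v \<subseteq> E"
      and "hnorm H' (\<rho> (mat_times v (mat_star v)) (f \<xi>) \<ominus>\<^bsub>H'\<^esub> \<rho> v (f \<xi>)) \<ge> c * hnorm H' (f \<xi>)"
      using disp[OF rep'] unfolding displaces_nonconstant_vectors_def by blast
    then have "hnorm H (\<pi> (mat_times v (mat_star v)) \<xi> \<ominus>\<^bsub>H\<^esub> \<pi> v \<xi>) \<ge> c * hnorm H \<xi>"
      using pt[OF v(1)] \<xi>K by (simp add: \<rho> transport_simps transport_minus K_minus K_inv)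
    with v show "\<exists>v\<in>partial_translations X \<E>. mat_support v \<subseteq> E \<and>
        c * hnorm H \<xi> \<le> hnorm H (\<pi> (mat_times v (mat_star v)) \<xi> \<ominus>\<^bsub>H\<^esub> \<pi> v \<xi>)"
      by blast
  qed
  with c show ?thesis by blast
qed

lemma coarse_structure_generatedD:
  "\<lbrakk>F \<in> coarse_structure_generated X E; coarse_structure X \<E>; E \<in> \<E>\<rbrakk> \<Longrightarrow> F \<in> \<E>"
  by (simp add: coarse_structure_generated_def)

lemma coarse_structure_generatedI:
  "(\<And>\<E>. \<lbrakk>coarse_structure X \<E>; E \<in> \<E>\<rbrakk> \<Longrightarrow> F \<in> \<E>) \<Longrightarrow> F \<in> coarse_structure_generated X E"
  by (simp add: coarse_structure_generated_def)

lemma coarse_structure_coarse_structure_generated: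
  assumes "E \<subseteq> X \<times> X"
  shows "coarse_structure X (coarse_structure_generated X E)"
  unfolding coarse_structure_def[of X "coarse_structure_generated X E"]
proof (intro conjI ballI allI impI)
  have "coarse_structure X (Pow (X \<times> X))" by (auto simp: coarse_structure_def)
  then show "coarse_structure_generated X E \<subseteq> Pow (X \<times> X)"
    using coarse_structure_generatedD[of _ X E "Pow (X \<times> X)"] assms by blast
  show "Id_on X \<in> coarse_structure_generated X E"
    by (rule coarse_structure_generatedI) (simp add: coarse_structure_def)
next
  fix A F assume A: "A \<in> coarse_structure_generated X E" and "F \<subseteq> A"
  show "F \<in> coarse_structure_generated X E"
  proof (rule coarse_structure_generatedI)
    fix \<E> assume M: "coarse_structure X \<E>" "E \<in> \<E>"
    show "F \<in> \<E>"
      using coarse_structure_generatedD[OF A M] M(1) \<open>F \<subseteq> A\<close> by (simp add: coarse_structure_def)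
  qed
next
  fix A B
  assume A: "A \<in> coarse_structure_generated X E" and B: "B \<in> coarse_structure_generated X E"
  have *: "A \<union> B \<in> \<E> \<and> A O B \<in> \<E>" if M: "coarse_structure X \<E>" "E \<in> \<E>" for \<E>
    using coarse_structure_generatedD[OF A M] coarse_structure_generatedD[OF B M] M(1)
    by (simp add: coarse_structure_def)
  show "A \<union> B \<in> coarse_structure_generated X E" "A O B \<in> coarse_structure_generated X E"
    using * by (simp_all add: coarse_structure_generatedI)
next
  fix A assume A: "A \<in> coarse_structure_generated X E"
  show "A\<inverse> \<in> coarse_structure_generated X E"
  proof (rule coarse_structure_generatedI)
    fix \<E> assume M: "coarse_structure X \<E>" "E \<in> \<E>"
    show "A\<inverse> \<in> \<E>"
      using coarse_structure_generatedD[OF A M] M(1) by (simp add: coarse_structure_def)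
  qed
qed

definition row_bounded :: "nat \<Rightarrow> 'x rel \<Rightarrow> bool" where
  "row_bounded k E \<longleftrightarrow> (\<forall>x. finite (E `` {x}) \<and> card (E `` {x}) \<le> k)"

lemma row_bounded_subset:
  assumes "row_bounded k E" "F \<subseteq> E" shows "row_bounded k F"
  unfolding row_bounded_def
proof
  fix x
  have sub: "F `` {x} \<subseteq> E `` {x}" using assms(2) by blast
  have E: "finite (E `` {x})" "card (E `` {x}) \<le> k" using assms(1) by (auto simp: row_bounded_def)
  show "finite (F `` {x}) \<and> card (F `` {x}) \<le> k"
    using finite_subset[OF sub E(1)] card_mono[OF E(1) sub] E(2) by linarith
qed

lemma row_bounded_Un:
  assumes "row_bounded k E" "row_bounded l F" shows "row_bounded (k + l) (E \<union> F)"
  using assms unfolding row_bounded_def Un_Image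
  by (auto intro!: order_trans[OF card_Un_le] add_mono)

lemma row_bounded_relcomp:
  assumes "row_bounded k E" "row_bounded l F" shows "row_bounded (k * l) (E O F)"
  unfolding row_bounded_def
proof
  fix x
  have eq: "(E O F) `` {x} = (\<Union>z\<in>E `` {x}. F `` {z})" by auto
  have "card (\<Union>z\<in>E `` {x}. F `` {z}) \<le> (\<Sum>z\<in>E `` {x}. card (F `` {z}))"
    using assms by (intro card_UN_le) (simp add: row_bounded_def)
  also have "\<dots> \<le> (\<Sum>z\<in>E `` {x}. l)"
    using assms by (intro sum_mono) (simp add: row_bounded_def)
  also have "\<dots> \<le> k * l" using assms by (simp add: row_bounded_def)
  finally show "finite ((E O F) `` {x}) \<and> card ((E O F) `` {x}) \<le> k * l"
    using assms unfolding eq by (auto simp: row_bounded_def)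
qed

definition row_column_bounded :: "'x set \<Rightarrow> 'x rel set" where
  "row_column_bounded X =
     {E. E \<subseteq> X \<times> X \<and> (\<exists>k. row_bounded k E) \<and> (\<exists>k. row_bounded k (E\<inverse>))}"

lemma row_column_boundedI:
  "\<lbrakk>E \<subseteq> X \<times> X; row_bounded k E; row_bounded l (E\<inverse>)\<rbrakk> \<Longrightarrow> E \<in> row_column_bounded X"
  unfolding row_column_bounded_def by blast

lemma row_column_boundedE:
  assumes "E \<in> row_column_bounded X"
  obtains k l where "E \<subseteq> X \<times> X" "row_bounded k E" "row_bounded l (E\<inverse>)"
  using assms unfolding row_column_bounded_def by blast

lemma coarse_structure_row_column_bounded: "coarse_structure X (row_column_bounded X)"
  unfolding coarse_structure_def
proof (intro conjI ballI allI impI)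
  show "row_column_bounded X \<subseteq> Pow (X \<times> X)" unfolding row_column_bounded_def by blast
  have sub: "Id_on X `` {x} \<subseteq> {x}" for x by auto
  have "row_bounded 1 (Id_on X)"
    unfolding row_bounded_def
    using finite_subset[OF sub] card_mono[OF _ sub] by simp
  then show "Id_on X \<in> row_column_bounded X" by (intro row_column_boundedI[of _ _ 1 1]) auto
next
  fix E F assume E: "E \<in> row_column_bounded X" and FE: "F \<subseteq> E"
  from E obtain k l where k: "E \<subseteq> X \<times> X" "row_bounded k E" "row_bounded l (E\<inverse>)"
    by (rule row_column_boundedE)
  show "F \<in> row_column_bounded X"
  proof (rule row_column_boundedI)
    show "F \<subseteq> X \<times> X" using FE k(1) by blast
    show "row_bounded k F" by (rule row_bounded_subset[OF k(2) FE])
    show "row_bounded l (F\<inverse>)" by (rule row_bounded_subset[OF k(3)]) (use FE in blast)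
  qed
next
  fix E F assume E: "E \<in> row_column_bounded X" and F: "F \<in> row_column_bounded X"
  from E obtain k l where k: "E \<subseteq> X \<times> X" "row_bounded k E" "row_bounded l (E\<inverse>)"
    by (rule row_column_boundedE)
  from F obtain k' l' where k': "F \<subseteq> X \<times> X" "row_bounded k' F" "row_bounded l' (F\<inverse>)"
    by (rule row_column_boundedE)
  show "E \<union> F \<in> row_column_bounded X"
  proof (rule row_column_boundedI)
    show "E \<union> F \<subseteq> X \<times> X" using k(1) k'(1) by blast
    show "row_bounded (k + k') (E \<union> F)" by (rule row_bounded_Un[OF k(2) k'(2)])
    show "row_bounded (l + l') ((E \<union> F)\<inverse>)"
      unfolding converse_Un by (rule row_bounded_Un[OF k(3) k'(3)])
  qed
  show "E O F \<in> row_column_bounded X"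
  proof (rule row_column_boundedI)
    show "E O F \<subseteq> X \<times> X" using k(1) k'(1) by blast
    show "row_bounded (k * k') (E O F)" by (rule row_bounded_relcomp[OF k(2) k'(2)])
    show "row_bounded (l' * l) ((E O F)\<inverse>)"
      unfolding converse_relcomp by (rule row_bounded_relcomp[OF k'(3) k(3)])
  qed
next
  fix E assume "E \<in> row_column_bounded X"
  then obtain k l where k: "E \<subseteq> X \<times> X" "row_bounded k E" "row_bounded l (E\<inverse>)"
    by (rule row_column_boundedE)
  then show "E\<inverse> \<in> row_column_bounded X"
    by (intro row_column_boundedI[of _ _ l k]) (auto simp only: converse_converse)
qed

context quotient_data
begin

lemma box_edges_row_bounded:
  "row_bounded (card S) (box_edges G S N)" "row_bounded (card S) ((box_edges G S N)\<inverse>)"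
proof -
  have *: "finite {y. P y} \<and> card {y. P y} \<le> card S"
    if sub: "{y. P y} \<subseteq> h ` S" for P and h :: "'a \<Rightarrow> nat \<times> 'a set"
    using finite_subset[OF sub] card_mono[OF _ sub] card_image_le[OF finite_gens, of h] finite_gens
    by (metis finite_imageI order_trans)
  have grp: "group (G Mod N n)" for n using normal.factorgroup_is_group[OF N_normal] .
  show "row_bounded (card S) (box_edges G S N)"
    unfolding row_bounded_def Image_singleton
  proof (rule allI)
    fix p :: "nat \<times> 'a set"
    obtain n x where p: "p = (n, x)" by force
    interpret Q: group "G Mod N n" by (rule grp)
    have "{y. (p, y) \<in> box_edges G S N} \<subseteq> (\<lambda>s. (n, x \<otimes>\<^bsub>G Mod N n\<^esub> (N n #> s))) ` S"
    proof
      fix q assume "q \<in> {y. (p, y) \<in> box_edges G S N}"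
      then obtain y s where q: "q = (n, y)" "x \<in> carrier (G Mod N n)" "y \<in> carrier (G Mod N n)"
        and s: "s \<in> S" "inv\<^bsub>G Mod N n\<^esub> x \<otimes>\<^bsub>G Mod N n\<^esub> y = N n #> s"
        by (auto simp: box_edges_def quotient_edges_def p)
      have c: "N n #> s \<in> carrier (G Mod N n)"
        unfolding s(2)[symmetric] by (intro Q.m_closed Q.inv_closed q)
      have "y = x \<otimes>\<^bsub>G Mod N n\<^esub> (N n #> s)"
        by (rule Q.inv_solve_left'[THEN iffD1, OF c q(2,3) s(2)])
      then show "q \<in> (\<lambda>s. (n, x \<otimes>\<^bsub>G Mod N n\<^esub> (N n #> s))) ` S" using q s by auto
    qed
    then show "finite {y. (p, y) \<in> box_edges G S N} \<and>
        card {y. (p, y) \<in> box_edges G S N} \<le> card S"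
      by (rule *)
  qed
  show "row_bounded (card S) ((box_edges G S N)\<inverse>)"
    unfolding row_bounded_def Image_singleton
  proof (rule allI)
    fix p :: "nat \<times> 'a set"
    obtain n x where p: "p = (n, x)" by force
    interpret Q: group "G Mod N n" by (rule grp)
    have "{y. (p, y) \<in> (box_edges G S N)\<inverse>} \<subseteq>
        (\<lambda>s. (n, x \<otimes>\<^bsub>G Mod N n\<^esub> inv\<^bsub>G Mod N n\<^esub> (N n #> s))) ` S"
    proof
      fix q assume "q \<in> {y. (p, y) \<in> (box_edges G S N)\<inverse>}"
      then obtain y s where q: "q = (n, y)" "x \<in> carrier (G Mod N n)" "y \<in> carrier (G Mod N n)"
        and s: "s \<in> S" "inv\<^bsub>G Mod N n\<^esub> y \<otimes>\<^bsub>G Mod N n\<^esub> x = N n #> s"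
        by (auto simp: box_edges_def quotient_edges_def p)
      have c: "N n #> s \<in> carrier (G Mod N n)"
        unfolding s(2)[symmetric] by (intro Q.m_closed Q.inv_closed q)
      have "x = y \<otimes>\<^bsub>G Mod N n\<^esub> (N n #> s)"
        by (rule Q.inv_solve_left'[THEN iffD1, OF c q(3,2) s(2)])
      then have "y = x \<otimes>\<^bsub>G Mod N n\<^esub> inv\<^bsub>G Mod N n\<^esub> (N n #> s)"
        by (rule Q.inv_solve_right[THEN iffD2, OF q(3,2) c])
      then show "q \<in> (\<lambda>s. (n, x \<otimes>\<^bsub>G Mod N n\<^esub> inv\<^bsub>G Mod N n\<^esub> (N n #> s))) ` S"
        using q s by auto
    qed
    then show "finite {y. (p, y) \<in> (box_edges G S N)\<inverse>} \<and>
        card {y. (p, y) \<in> (box_edges G S N)\<inverse>} \<le> card S"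
      by (rule *)
  qed
qed

lemma box_edges_subset: "box_edges G S N \<subseteq> box_space G N \<times> box_space G N"
  by (auto simp: box_edges_def box_space_def quotient_edges_def)

lemma coarse_structure_box: "coarse_structure (box_space G N) (box_coarse_structure G S N)"
  unfolding box_coarse_structure_def
  by (rule coarse_structure_coarse_structure_generated[OF box_edges_subset])

lemma bounded_geometry_box: "bounded_geometry (box_coarse_structure G S N)"
proof -
  have "box_edges G S N \<in> row_column_bounded (box_space G N)"
    by (rule row_column_boundedI[OF box_edges_subset box_edges_row_bounded])
  then have *: "E \<in> row_column_bounded (box_space G N)" if "E \<in> box_coarse_structure G S N" for E
    using that coarse_structure_generatedD[OF _ coarse_structure_row_column_bounded]
    unfolding box_coarse_structure_def by metis
  show ?thesis
    unfolding bounded_geometry_def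
  proof
    fix E assume "E \<in> box_coarse_structure G S N"
    then obtain k l where "row_bounded k E" by (rule row_column_boundedE[OF *])
    then show "\<exists>k. \<forall>x. finite (E `` {x}) \<and> card (E `` {x}) \<le> k"
      unfolding row_bounded_def by (rule exI)
  qed
qed

lemmas geometric_property_T_box_any_type =
  geometric_property_T_any_type[OF coarse_structure_box bounded_geometry_box]

end

end

theory Submission
  imports Defs "HOL-Library.Function_Algebras" "HOL-Library.Numeral_Type"
begin

text \<open>A sequence of connected graphs of bounded degree without a common spectral gap carries almost
  invariant unit vectors orthogonal to the constants, and an ultraproduct of the spaces
  \<open>l\<^sup>2(X\<^sub>n)\<close> along such vectors is a representation that refutes geometric property (T).

  For the separating example let \<open>R\<close> be the group ring of the integral Heisenberg group over the
  field with five elements. It acts on functions on the fibre product of two Heisenberg groups over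
  their common abelianization, in which \<open>R\<close> is diagonal. Let \<open>\<Gamma>\<close> be generated by the elementary
  matrices \<open>EL\<^sub>3(R)\<close> and by the scalar matrix of the central element \<open>z\<close> of the second factor. The
  difference of the two central coordinates is a grading with \<open>R\<close> in degree zero and yields a
  homomorphism from \<open>\<Gamma>\<close> onto the integers. Characters of small angle along this homomorphism,
  realised as unitary twists on an ultraproduct of the \<open>l\<^sup>2(X\<^sub>n)\<close>, refute geometric property (T).
  On each finite level, however, \<open>z\<close> agrees with a power of the diagonal commutator, because the
  moduli in the two central coordinates are powers of 2 and of 3. Hence the finite quotients of
  \<open>\<Gamma>\<close> are quotients of \<open>EL\<^sub>3(R)\<close>. This group is generated by three finite subgroups \<open>A\<^sub>i\<close>, any two
  of which generate a group of Heisenberg type with a central subgroup \<open>C\<close>. Decomposing over \<open>C\<close>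
  shows that the angle between their fixed spaces has cosine at most \<open>\<epsilon> < 1/2\<close>, and for the sum
  \<open>\<Delta>\<close> of the three projections onto the complements of the fixed spaces this gives
  \<open>\<Delta>\<^sup>2 \<ge> (1 - 2\<epsilon>)\<Delta>\<close>, a spectral gap that does not depend on the level.\<close>

text \<open>Box spaces of groups with property (T) have geometric property (T), so the example must
  come from a group without property (T). A homomorphism onto the integers is a simple reason for
  (T) to fail, but it has to be invisible on the quotients, since cyclic quotients of growing order
  would destroy expansion. This is why the two central coordinates have coprime moduli: each level
  identifies the extra generator with an element of \<open>lam\<close>, but no element of
  \<open>lam\<close> serves for all levels, because \<open>lam\<close> consists of operators of
  degree 0. Coefficients in a finite field make the three generating subgroups finite, so that
  averaging over them replaces the decomposition of unitary representations. The angle bound is the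
  inverse square root of the field size, and it has to be below 1/2; this excludes fields with at
  most four elements and makes five the first choice. The ring generators enter through
  \<open>A3\<close> alone, with scalars in \<open>A1\<close> and \<open>A2\<close>. Thus every
  commutator has one scalar factor, and for a fixed nonzero scalar it is a bijection onto a group of
  the same size.\<close>

section \<open>Linear operators on finitely supported functions\<close>

text \<open>Dimension count, with the point masses on \<open>X\<close> as a basis. It serves twice:
  over the reals to write a mean-zero function as \<open>\<Delta> g\<close> in
  \<open>spectral_gap\<close>, and over the complex numbers to show that every spectral value of a
  Laplacian has an eigenvector.\<close>

lemma injective_operator_surjective:
  fixes T :: "('v \<Rightarrow> 'k::field) \<Rightarrow> 'v \<Rightarrow> 'k"
  assumes fin: "finite X"
    and supp: "\<And>f. (\<forall>x. x \<notin> X \<longrightarrow> f x = 0) \<Longrightarrow> (\<forall>x. x \<notin> X \<longrightarrow> T f x = 0)"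
    and add: "\<And>f g. T (\<lambda>x. f x + g x) = (\<lambda>x. T f x + T g x)"
    and scale: "\<And>c f. T (\<lambda>x. c * f x) = (\<lambda>x. c * T f x)"
    and inj: "\<And>f. \<lbrakk>\<forall>x. x \<notin> X \<longrightarrow> f x = 0; T f = (\<lambda>x. 0)\<rbrakk> \<Longrightarrow> f = (\<lambda>x. 0)"
    and g: "\<forall>x. x \<notin> X \<longrightarrow> g x = 0"
  shows "\<exists>f. (\<forall>x. x \<notin> X \<longrightarrow> f x = 0) \<and> T f = g"
proof -
  interpret V: vector_space "\<lambda>(c::'k) (f::'v \<Rightarrow> 'k) x. c * f x"
    by unfold_locales (auto simp: algebra_simps fun_eq_iff)
  interpret VV: vector_space_pair "\<lambda>(c::'k) (f::'v \<Rightarrow> 'k) x. c * f x" "\<lambda>(c::'k) (f::'v \<Rightarrow> 'k) x. c * f x"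
    by unfold_locales
  have lin: "Vector_Spaces.linear (\<lambda>(c::'k) (f::'v \<Rightarrow> 'k) x. c * f x) (\<lambda>(c::'k) (f::'v \<Rightarrow> 'k) x. c * f x) T"
    using add scale
    by (intro Vector_Spaces.linear.intro module_hom.intro module_hom_axioms.intro V.vector_space_axioms
        V.module_axioms) (auto simp: plus_fun_def)
  let ?F = "{f :: 'v \<Rightarrow> 'k. \<forall>x. x \<notin> X \<longrightarrow> f x = 0}"
  define \<delta> where "\<delta> y = (\<lambda>x. if x = y then 1 else 0 :: 'k)" for y :: 'v
  have sub: "V.subspace ?F"
    by (rule V.subspaceI) (auto simp: zero_fun_def plus_fun_def)
  have dF: "\<delta> ` X \<subseteq> ?F" by (auto simp: \<delta>_def)
  have expand: "f = (\<Sum>y\<in>X. (\<lambda>x. f y * \<delta> y x))" if "f \<in> ?F" for f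
  proof
    fix x
    have "(\<Sum>y\<in>X. (\<lambda>x. f y * \<delta> y x)) x = (\<Sum>y\<in>X. f y * \<delta> y x)"
      using fin by (induction X) (auto simp: zero_fun_def plus_fun_def)
    also have "\<dots> = f x"
      using that fin by (auto simp: \<delta>_def if_distrib[of "(*) _"] cong: if_cong)
    finally show "f x = (\<Sum>y\<in>X. (\<lambda>x. f y * \<delta> y x)) x" by simp
  qed
  have span: "V.span (\<delta> ` X) = ?F"
  proof
    show "V.span (\<delta> ` X) \<subseteq> ?F" by (rule V.span_minimal[OF dF sub])
    show "?F \<subseteq> V.span (\<delta> ` X)"
    proof
      fix f assume "f \<in> ?F"
      then have f: "f = (\<Sum>y\<in>X. (\<lambda>x. f y * \<delta> y x))" by (rule expand)
      show "f \<in> V.span (\<delta> ` X)"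
        by (subst f) (intro V.span_sum V.span_scale V.span_base imageI)
    qed
  qed
  have inj_d: "inj_on \<delta> X" by (rule inj_onI) (metis \<delta>_def zero_neq_one)
  have indep: "V.independent (\<delta> ` X)"
  proof (rule V.independent_if_scalars_zero)
    show "finite (\<delta> ` X)" using fin by simp
    fix c :: "('v \<Rightarrow> 'k) \<Rightarrow> 'k" and b
    assume sum: "(\<Sum>b\<in>\<delta> ` X. (\<lambda>x. c b * b x)) = 0" and b: "b \<in> \<delta> ` X"
    from b obtain y where y: "y \<in> X" "b = \<delta> y" by blast
    let ?f = "\<lambda>z. if z \<in> X then c (\<delta> z) else 0"
    have "(\<Sum>z\<in>X. (\<lambda>x. ?f z * \<delta> z x)) = 0"
      using sum inj_d by (simp add: sum.reindex cong: sum.cong)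
    then have "?f = 0" using expand[of ?f] by simp
    then show "c b = 0" using y by (metis (mono_tags, lifting) zero_fun_apply)
  qed
  have injF: "inj_on T ?F"
    unfolding VV.linear_inj_on_iff_eq_0[OF lin sub] using inj by (simp add: zero_fun_def)
  have indep': "V.independent (T ` \<delta> ` X)"
    using VV.linear_independent_injective_image[OF lin indep] injF by (simp add: span)
  have fin': "finite (\<delta> ` X)" using fin by simp
  have imF: "T ` \<delta> ` X \<subseteq> V.span (\<delta> ` X)" unfolding span using supp dF by blast
  have card: "card (T ` \<delta> ` X) = card (\<delta> ` X)"
    by (rule card_image) (rule inj_on_subset[OF injF dF])
  have "g \<in> V.span (T ` \<delta> ` X)"
  proof (rule ccontr)
    assume nin: "g \<notin> V.span (T ` \<delta> ` X)"
    then have "V.independent (insert g (T ` \<delta> ` X))" by (rule V.independent_insertI[OF _ indep'])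
    moreover have "insert g (T ` \<delta> ` X) \<subseteq> V.span (\<delta> ` X)" using imF g span by auto
    ultimately have "card (insert g (T ` \<delta> ` X)) \<le> card (\<delta> ` X)"
      using V.independent_span_bound[OF fin'] by blast
    moreover have "g \<notin> T ` \<delta> ` X" using nin V.span_base[of g "T ` \<delta> ` X"] by metis
    ultimately show False using card fin' by simp
  qed
  then have "g \<in> T ` V.span (\<delta> ` X)" using VV.linear_span_image[OF lin] by simp
  then show ?thesis unfolding span by auto
qed

section \<open>A spectral gap from three subgroups\<close>

text \<open>The action is on the right because the quotients consist of right cosets, which
  \<open>G\<close> permutes by right multiplication. On functions, \<open>a\<close> acts by
  \<open>\<lambda>x. f (act x a)\<close>, which preserves \<open>ip\<close>.\<close>

locale finite_right_action = group G for G (structure) +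
  fixes X :: "'x set" and act :: "'x \<Rightarrow> 'a \<Rightarrow> 'x"
  assumes finite_X: "finite X"
    and act_closed [simp]: "\<lbrakk>x \<in> X; a \<in> carrier G\<rbrakk> \<Longrightarrow> act x a \<in> X"
    and act_one [simp]: "x \<in> X \<Longrightarrow> act x \<one> = x"
    and act_mult: "\<lbrakk>x \<in> X; a \<in> carrier G; b \<in> carrier G\<rbrakk> \<Longrightarrow> act (act x a) b = act x (a \<otimes> b)"
begin

definition ip :: "('x \<Rightarrow> real) \<Rightarrow> ('x \<Rightarrow> real) \<Rightarrow> real" where
  "ip f g = (\<Sum>x\<in>X. f x * g x)"

text \<open>For a finite subgroup \<open>A\<close> this is the orthogonal projection onto the
  \<open>A\<close>-invariant functions, and \<open>dev A\<close> is the complementary projection. So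
  \<open>ip (dev A f) f\<close> is the squared distance of \<open>f\<close> from the invariant
  functions.\<close>

definition avg :: "'a set \<Rightarrow> ('x \<Rightarrow> real) \<Rightarrow> 'x \<Rightarrow> real" where
  "avg A f x = (\<Sum>a\<in>A. f (act x a)) / real (card A)"

definition dev :: "'a set \<Rightarrow> ('x \<Rightarrow> real) \<Rightarrow> 'x \<Rightarrow> real" where
  "dev A f x = f x - avg A f x"

lemma ip_cong: "\<lbrakk>\<And>x. x \<in> X \<Longrightarrow> f x = f' x; \<And>x. x \<in> X \<Longrightarrow> g x = g' x\<rbrakk> \<Longrightarrow> ip f g = ip f' g'"
  by (simp add: ip_def)

lemma ip_commute: "ip f g = ip g f"
  by (simp add: ip_def mult.commute)

lemma ip_add_left: "ip (\<lambda>x. f x + g x) h = ip f h + ip g h"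
  and ip_diff_left: "ip (\<lambda>x. f x - g x) h = ip f h - ip g h"
  by (simp_all add: ip_def algebra_simps sum.distrib sum_subtractf)

lemma ip_add_right: "ip h (\<lambda>x. f x + g x) = ip h f + ip h g"
  and ip_diff_right: "ip h (\<lambda>x. f x - g x) = ip h f - ip h g"
  by (simp_all add: ip_def algebra_simps sum.distrib sum_subtractf)

lemma ip_sum_left: "ip (\<lambda>x. \<Sum>a\<in>A. f a x) g = (\<Sum>a\<in>A. ip (f a) g)"
  unfolding ip_def by (subst sum.swap) (simp add: sum_distrib_right)

lemma ip_divide_left: "ip (\<lambda>x. f x / c) g = ip f g / c"
  by (simp add: ip_def sum_divide_distrib)

lemma ip_self_nonneg: "ip f f \<ge> 0"
  by (simp add: ip_def sum_nonneg)

lemma ip_self_eq_0: "ip f f = 0 \<Longrightarrow> x \<in> X \<Longrightarrow> f x = 0"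
  using finite_X unfolding ip_def by (subst (asm) sum_nonneg_eq_0_iff) auto

lemma ip_Cauchy_Schwarz: "(ip f g)\<^sup>2 \<le> ip f f * ip g g"
  unfolding ip_def power2_eq_square[symmetric] by (rule Cauchy_Schwarz_ineq_sum)

lemma act_bij:
  assumes "a \<in> carrier G"
  shows "bij_betw (\<lambda>x. act x a) X X"
  by (rule bij_betwI[where g = "\<lambda>x. act x (inv a)"]) (use assms in \<open>auto simp: act_mult\<close>)

lemma ip_act: "a \<in> carrier G \<Longrightarrow> ip (\<lambda>x. f (act x a)) (\<lambda>x. g (act x a)) = ip f g"
  unfolding ip_def using sum.reindex_bij_betw[OF act_bij, of a "\<lambda>x. f x * g x"] by simp

lemma ip_act_left:
  assumes a: "a \<in> carrier G"
  shows "ip (\<lambda>x. f (act x a)) g = ip f (\<lambda>x. g (act x (inv a)))"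
proof -
  have "ip (\<lambda>x. f (act x a)) g = ip (\<lambda>x. f (act x a)) (\<lambda>x. g (act (act x a) (inv a)))"
    using a by (intro ip_cong) (auto simp: act_mult)
  also have "\<dots> = ip f (\<lambda>x. g (act x (inv a)))" by (rule ip_act[OF a])
  finally show ?thesis .
qed

lemma avg_diff: "avg A (\<lambda>x. f x - g x) x = avg A f x - avg A g x"
  by (simp add: avg_def sum_subtractf diff_divide_distrib)

lemma avg_dev: "avg A (dev B f) x = avg A f x - avg A (avg B f) x"
  unfolding dev_def[abs_def] by (rule avg_diff)

lemma dev_add: "dev A (\<lambda>x. f x + g x) = (\<lambda>x. dev A f x + dev A g x)"
  by (simp add: dev_def avg_def fun_eq_iff sum.distrib add_divide_distrib)

lemma dev_scale: "dev A (\<lambda>x. t * f x) = (\<lambda>x. t * dev A f x)"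
  by (simp add: dev_def avg_def fun_eq_iff sum_distrib_left[symmetric] right_diff_distrib)

section \<open>Averaging over one finite subgroup\<close>

context
  fixes A :: "'a set"
  assumes A: "subgroup A G" and finA: "finite A"
begin

lemma subgroup_card_pos: "card A > 0"
  using finA subgroup.one_closed[OF A] by (auto simp: card_gt_0_iff)

lemma subgroup_carrier: "a \<in> A \<Longrightarrow> a \<in> carrier G"
  using subgroup.mem_carrier[OF A] .

lemma avg_act:
  assumes "x \<in> X" "a \<in> A"
  shows "avg A f (act x a) = avg A f x"
proof -
  have "bij_betw (\<lambda>b. a \<otimes> b) A A"
    by (rule bij_betwI[where g = "\<lambda>b. inv a \<otimes> b"])
      (use assms subgroup_carrier subgroup.m_closed[OF A] subgroup.m_inv_closed[OF A]
        in \<open>auto simp: m_assoc[symmetric]\<close>)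
  from sum.reindex_bij_betw[OF this, of "\<lambda>b. f (act x b)"] show ?thesis
    using assms subgroup_carrier by (simp add: avg_def act_mult)
qed

lemma avg_fixed:
  assumes "x \<in> X" "\<And>a. a \<in> A \<Longrightarrow> f (act x a) = f x"
  shows "avg A f x = f x"
  using assms subgroup_card_pos by (simp add: avg_def)

lemma avg_avg: "x \<in> X \<Longrightarrow> avg A (avg A f) x = avg A f x"
  by (rule avg_fixed) (auto simp: avg_act)

lemma avg_self_adjoint: "ip (avg A f) g = ip f (avg A g)"
proof -
  have b: "bij_betw (\<lambda>a. inv a) A A"
    by (rule bij_betwI[where g = "\<lambda>a. inv a"])
      (use subgroup_carrier subgroup.m_inv_closed[OF A] in auto)
  have "ip (avg A f) g = (\<Sum>a\<in>A. ip (\<lambda>x. f (act x a)) g) / real (card A)"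
    unfolding avg_def by (simp add: ip_divide_left ip_sum_left)
  also have "(\<Sum>a\<in>A. ip (\<lambda>x. f (act x a)) g) = (\<Sum>a\<in>A. ip (\<lambda>x. g (act x (inv a))) f)"
    by (intro sum.cong) (simp_all add: ip_act_left[OF subgroup_carrier] ip_commute[of f])
  also have "\<dots> = (\<Sum>a\<in>A. ip (\<lambda>x. g (act x a)) f)"
    using sum.reindex_bij_betw[OF b, of "\<lambda>a. ip (\<lambda>x. g (act x a)) f"] by simp
  also have "\<dots> / real (card A) = ip (avg A g) f"
    unfolding avg_def by (simp add: ip_divide_left ip_sum_left)
  finally show ?thesis by (simp add: ip_commute)
qed

lemma ip_avg_avg: "ip (avg A f) (avg A g) = ip (avg A f) g"
  using avg_self_adjoint[of "avg A f" g] by (simp add: avg_avg cong: ip_cong)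

lemma avg_cong: "\<lbrakk>\<And>y. y \<in> X \<Longrightarrow> f y = g y; x \<in> X\<rbrakk> \<Longrightarrow> avg A f x = avg A g x"
  unfolding avg_def using subgroup_carrier by (auto intro!: sum.cong)

lemma ip_dev_left: "ip (dev A f) g = ip f g - ip (avg A f) g"
  unfolding dev_def by (rule ip_diff_left)

lemma dev_self_adjoint: "ip (dev A f) g = ip f (dev A g)"
  unfolding dev_def by (simp add: ip_diff_left ip_diff_right avg_self_adjoint)

lemma dev_dev: "x \<in> X \<Longrightarrow> dev A (dev A f) x = dev A f x"
  by (simp add: dev_def[of A "dev A f"] avg_dev avg_avg)

lemma ip_dev_dev: "ip (dev A f) (dev A g) = ip (dev A f) g"
  using dev_self_adjoint[of "dev A f" g] by (simp add: dev_dev cong: ip_cong)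

lemma ip_dev_self_nonneg: "ip (dev A f) f \<ge> 0"
  using ip_dev_dev[of f f] ip_self_nonneg by metis

lemma dev_eq_0_imp_fixed:
  assumes "ip (dev A f) f = 0" "x \<in> X" "a \<in> A"
  shows "f (act x a) = f x"
proof -
  have "dev A f y = 0" if "y \<in> X" for y
    using ip_self_eq_0[OF _ that, of "dev A f"] ip_dev_dev[of f f] assms(1) by simp
  then have "f y = avg A f y" if "y \<in> X" for y using that by (simp add: dev_def)
  then show ?thesis using assms subgroup_carrier avg_act by simp
qed

text \<open>Each \<open>a\<close> acts isometrically, so
  \<open>ip f f - ip (\<lambda>x. f (act x a)) f\<close> is half the squared displacement of
  \<open>f\<close> by \<open>a\<close>; average this over \<open>A\<close>. The lemma later turns
  projections into differences along edges of the quotient graph.\<close>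

lemma ip_dev_self_le:
  assumes "\<And>a. a \<in> A \<Longrightarrow> (\<Sum>x\<in>X. (f (act x a) - f x)\<^sup>2) \<le> D"
  shows "ip (dev A f) f \<le> D / 2"
proof -
  have "ip f f - ip (\<lambda>x. f (act x a)) f \<le> D / 2" if "a \<in> A" for a
  proof -
    have "(\<Sum>x\<in>X. (f (act x a) - f x)\<^sup>2) =
        ip (\<lambda>x. f (act x a)) (\<lambda>x. f (act x a)) + ip f f - 2 * ip (\<lambda>x. f (act x a)) f"
      by (simp add: ip_def power2_eq_square algebra_simps sum.distrib sum_subtractf sum_distrib_left)
    then show ?thesis using assms[OF that] ip_act[OF subgroup_carrier[OF that], of f f] by simp
  qed
  then have "(\<Sum>a\<in>A. ip f f - ip (\<lambda>x. f (act x a)) f) \<le> (\<Sum>a\<in>A. D / 2)" by (rule sum_mono)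
  then have "real (card A) * ip f f - (\<Sum>a\<in>A. ip (\<lambda>x. f (act x a)) f) \<le> real (card A) * (D / 2)"
    by (simp add: sum_subtractf)
  moreover have "ip (avg A f) f = (\<Sum>a\<in>A. ip (\<lambda>x. f (act x a)) f) / real (card A)"
    unfolding avg_def by (simp add: ip_divide_left ip_sum_left)
  ultimately have "real (card A) * (ip f f) \<le> real (card A) * (ip (avg A f) f + D / 2)"
    using subgroup_card_pos by (simp add: field_simps)
  then show ?thesis
    using subgroup_card_pos by (simp add: ip_dev_left)
qed

end

text \<open>Commutation is demanded only of the values of \<open>f\<close>, because in
  \<open>dev_pair_fixed\<close> the subgroups commute only modulo a subgroup under which
  \<open>f\<close> is invariant.\<close>

lemma avg_commute:
  assumes A: "subgroup A G" "finite A" and B: "subgroup B G" "finite B"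
    and comm: "\<And>a b x. \<lbrakk>a \<in> A; b \<in> B; x \<in> X\<rbrakk> \<Longrightarrow> f (act x (a \<otimes> b)) = f (act x (b \<otimes> a))"
    and x: "x \<in> X"
  shows "avg A (avg B f) x = avg B (avg A f) x"
proof -
  have "(\<Sum>a\<in>A. \<Sum>b\<in>B. f (act (act x a) b)) = (\<Sum>b\<in>B. \<Sum>a\<in>A. f (act (act x b) a))"
    using A B x comm
    by (subst sum.swap) (auto simp: act_mult subgroup_carrier intro!: sum.cong)
  then show ?thesis
    by (simp add: avg_def sum_divide_distrib[symmetric] mult.commute)
qed

text \<open>The Heisenberg situation: \<open>C\<close> is centralized by \<open>A\<close> and
  \<open>B\<close>, and \<open>bij\<close> says that the commutator pairing is nondegenerate. For
  fixed \<open>b\<close> other than the identity, the commutators with \<open>a\<close> in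
  \<open>A\<close> run through each element of \<open>C\<close> exactly once, so an average over
  \<open>A\<close> becomes an average over \<open>C\<close>. The number \<open>\<epsilon>\<close>
  bounds the cosine of the angle between the two fixed spaces off the \<open>C\<close>-invariant
  functions.\<close>

context
  fixes A B C :: "'a set" and \<epsilon> :: real
  assumes A: "subgroup A G" "finite A" and B: "subgroup B G" "finite B"
    and C: "subgroup C G" "finite C"
    and AC: "\<And>a c. \<lbrakk>a \<in> A; c \<in> C\<rbrakk> \<Longrightarrow> a \<otimes> c = c \<otimes> a"
    and BC: "\<And>b c. \<lbrakk>b \<in> B; c \<in> C\<rbrakk> \<Longrightarrow> b \<otimes> c = c \<otimes> b"
    and bij: "\<And>b. \<lbrakk>b \<in> B; b \<noteq> \<one>\<rbrakk> \<Longrightarrow> bij_betw (\<lambda>a. inv b \<otimes> inv a \<otimes> b \<otimes> a) A C"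
    and eps: "1 / real (card B) \<le> \<epsilon>\<^sup>2" "0 \<le> \<epsilon>" "\<epsilon> \<le> 1"
begin

lemmas sub_carrier = subgroup_carrier[OF A] subgroup_carrier[OF B] subgroup_carrier[OF C]

lemma swap_AB:
  assumes "a \<in> A" "b \<in> B"
  obtains c where "c \<in> C" "b \<otimes> a = a \<otimes> b \<otimes> c"
proof (cases "b = \<one>")
  case True
  then show ?thesis using assms sub_carrier that[of \<one>] subgroup.one_closed[OF C(1)] by simp
next
  case False
  have "inv b \<otimes> inv a \<otimes> b \<otimes> a \<in> C" using bij[OF assms(2) False] assms by (auto simp: bij_betw_def)
  moreover have "a \<otimes> b \<otimes> (inv b \<otimes> inv a \<otimes> b \<otimes> a) = b \<otimes> a"
  proof -
    have "a \<otimes> b \<otimes> (inv b \<otimes> inv a \<otimes> b \<otimes> a) = (a \<otimes> b \<otimes> inv (a \<otimes> b)) \<otimes> b \<otimes> a"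
      using assms sub_carrier by (simp add: inv_mult_group m_assoc)
    then show ?thesis using assms sub_carrier by simp
  qed
  ultimately show ?thesis using that by metis
qed

text \<open>On \<open>C\<close>-invariant functions the actions of \<open>A\<close> and
  \<open>B\<close> commute, hence so do the two projections. Their product is again a projection,
  and the inner product is a squared norm.\<close>

lemma dev_pair_fixed:
  assumes f: "\<And>x c. \<lbrakk>x \<in> X; c \<in> C\<rbrakk> \<Longrightarrow> f (act x c) = f x"
  shows "ip (dev A f) (dev B f) \<ge> 0"
proof -
  have comm: "f (act x (a \<otimes> b)) = f (act x (b \<otimes> a))" if "a \<in> A" "b \<in> B" "x \<in> X" for a b x
  proof -
    obtain c where c: "c \<in> C" "b \<otimes> a = a \<otimes> b \<otimes> c" using swap_AB \<open>a \<in> A\<close> \<open>b \<in> B\<close> by blast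
    then have "f (act x (b \<otimes> a)) = f (act (act x (a \<otimes> b)) c)"
      using that sub_carrier by (simp add: act_mult)
    also have "\<dots> = f (act x (a \<otimes> b))" using that sub_carrier c by (intro f) auto
    finally show ?thesis by simp
  qed
  have avg: "avg A (avg B f) x = avg B (avg A f) x" if "x \<in> X" for x
    by (rule avg_commute[of A B f, OF A B comm that])
  have QQ: "dev A (dev B f) x = dev B (dev A f) x" if "x \<in> X" for x
    using that by (simp add: dev_def[of _ "dev _ f"] avg_dev avg) (simp add: dev_def)
  have "ip (dev A f) (dev B f) = ip (dev A (dev A f)) (dev B f)"
    using dev_dev[OF A] by (intro ip_cong) auto
  also have "\<dots> = ip (dev A f) (dev A (dev B f))" by (rule dev_self_adjoint[OF A])
  also have "\<dots> = ip (dev A f) (dev B (dev A f))" using QQ by (intro ip_cong) auto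
  also have "\<dots> = ip (dev B (dev A f)) (dev B (dev A f))"
    using ip_dev_dev[OF B, of "dev A f" "dev A f"] by (simp add: ip_commute)
  finally show ?thesis using ip_self_nonneg by simp
qed

text \<open>The translates of \<open>h\<close> by distinct elements of \<open>B\<close> are
  orthogonal. Indeed, since \<open>h\<close> is \<open>A\<close>-fixed, \<open>b\<close> may be
  replaced by its conjugates under \<open>A\<close>, which are \<open>b\<close> times the
  commutators; averaging over \<open>A\<close> then applies \<open>avg C\<close> to
  \<open>h\<close>, which gives 0. The average of \<open>card B\<close> orthogonal vectors of equal
  length has the stated norm.\<close>

lemma avg_B_small:
  assumes fixed: "\<And>x a. \<lbrakk>x \<in> X; a \<in> A\<rbrakk> \<Longrightarrow> h (act x a) = h x"
    and zero: "\<And>x. x \<in> X \<Longrightarrow> avg C h x = 0"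
  shows "ip (avg B h) (avg B h) = ip h h / real (card B)"
proof -
  have orth: "ip (\<lambda>x. h (act x b)) h = 0" if b: "b \<in> B" "b \<noteq> \<one>" for b
  proof -
    have *: "ip (\<lambda>x. h (act x b)) h = ip (\<lambda>x. h (act x (b \<otimes> (inv b \<otimes> inv a \<otimes> b \<otimes> a)))) h"
      if a: "a \<in> A" for a
    proof -
      have ia: "inv a \<in> A" using subgroup.m_inv_closed[OF A(1) a] .
      have c: "a \<in> carrier G" "b \<in> carrier G" using a b sub_carrier by auto
      have "ip (\<lambda>x. h (act x b)) h = ip (\<lambda>x. h (act (act x (inv a)) b)) (\<lambda>x. h (act x (inv a)))"
        using c by (subst ip_act) auto
      also have "\<dots> = ip (\<lambda>x. h (act (act x (inv a)) b)) h"
        using fixed ia by (intro ip_cong) auto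
      also have "\<dots> = ip (\<lambda>x. h (act (act (act x (inv a)) b) a)) h"
        using fixed a c by (intro ip_cong) auto
      also have "\<dots> = ip (\<lambda>x. h (act x (b \<otimes> (inv b \<otimes> inv a \<otimes> b \<otimes> a)))) h"
      proof -
        have "b \<otimes> (inv b \<otimes> inv a \<otimes> b \<otimes> a) = inv a \<otimes> b \<otimes> a"
          using c by (simp add: m_assoc[symmetric])
        then show ?thesis using c by (intro ip_cong) (auto simp: act_mult m_assoc)
      qed
      finally show ?thesis .
    qed
    have "real (card A) * ip (\<lambda>x. h (act x b)) h = (\<Sum>a\<in>A. ip (\<lambda>x. h (act x b)) h)"
      by simp
    also have "\<dots> = (\<Sum>a\<in>A. ip (\<lambda>x. h (act x (b \<otimes> (inv b \<otimes> inv a \<otimes> b \<otimes> a)))) h)"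
      by (rule sum.cong[OF refl *])
    also have "\<dots> = (\<Sum>c\<in>C. ip (\<lambda>x. h (act x (b \<otimes> c))) h)"
      using sum.reindex_bij_betw[OF bij[OF b], of "\<lambda>c. ip (\<lambda>x. h (act x (b \<otimes> c))) h"] by simp
    also have "\<dots> = ip (\<lambda>x. \<Sum>c\<in>C. h (act (act x b) c)) h"
      unfolding ip_sum_left using b sub_carrier by (intro sum.cong ip_cong) (auto simp: act_mult)
    also have "\<dots> = ip (\<lambda>x. 0) h"
    proof (rule ip_cong)
      fix x assume "x \<in> X"
      then have "avg C h (act x b) = 0" using zero b sub_carrier by simp
      then show "(\<Sum>c\<in>C. h (act (act x b) c)) = 0"
        using subgroup_card_pos[OF C] by (simp add: avg_def)
    qed simp
    finally show ?thesis using subgroup_card_pos[OF A] by (simp add: ip_def)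
  qed
  have "ip (avg B h) h = (\<Sum>b\<in>B. ip (\<lambda>x. h (act x b)) h) / real (card B)"
    unfolding avg_def by (simp add: ip_divide_left ip_sum_left)
  also have "(\<Sum>b\<in>B. ip (\<lambda>x. h (act x b)) h) = (\<Sum>b\<in>B. if b = \<one> then ip h h else 0)"
    using orth by (intro sum.cong) (auto intro!: ip_cong)
  also have "\<dots> = ip h h" using B subgroup.one_closed[OF B(1)] by simp
  finally show ?thesis by (simp add: ip_avg_avg[OF B])
qed

text \<open>By \<open>avg_B_small\<close> the two fixed spaces are nearly orthogonal here. The
  estimate transfers this angle bound from the projections onto the fixed spaces to the projections
  onto their complements.\<close>

lemma dev_pair_zero:
  assumes zero: "\<And>x. x \<in> X \<Longrightarrow> avg C f x = 0"
  shows "2 * ip (dev A f) (dev B f) \<ge> - \<epsilon> * (ip (dev A f) f + ip (dev B f) f)"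
proof -
  define h where "h = avg A f"
  have "avg C h x = 0" if x: "x \<in> X" for x
  proof -
    have "avg C h x = avg A (avg C f) x"
      unfolding h_def by (rule avg_commute[OF C A _ x]) (simp add: AC)
    also have "\<dots> = avg A (\<lambda>x. 0) x" using zero by (intro avg_cong[OF A _ x]) auto
    finally show ?thesis by (simp add: avg_def)
  qed
  then have Bh: "ip (avg B h) (avg B h) = ip h h / real (card B)"
    using avg_act[OF A] by (intro avg_B_small) (auto simp: h_def)
  define N \<alpha> \<beta> y where "N = ip f f" and "\<alpha> = ip h f" and "\<beta> = ip (avg B f) f" and "y = 2 * ip h (avg B f)"
  have hh: "ip h h = \<alpha>" unfolding h_def \<alpha>_def by (rule ip_avg_avg[OF A])
  have bb: "ip (avg B f) (avg B f) = \<beta>" unfolding \<beta>_def by (rule ip_avg_avg[OF B])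
  have nonneg: "0 \<le> \<alpha>" "0 \<le> \<beta>" "0 \<le> N"
    unfolding hh[symmetric] bb[symmetric] N_def by (rule ip_self_nonneg)+
  have "ip h (avg B f) = ip (avg B h) (avg B f)"
    by (rule trans[OF avg_self_adjoint[OF B, symmetric] ip_avg_avg[OF B, symmetric]])
  then have "(ip h (avg B f))\<^sup>2 \<le> ip h h / real (card B) * \<beta>"
    using ip_Cauchy_Schwarz[of "avg B h" "avg B f"] Bh bb by simp
  also have "\<dots> = 1 / real (card B) * (\<alpha> * \<beta>)" using hh by simp
  also have "\<dots> \<le> \<epsilon>\<^sup>2 * (\<alpha> * \<beta>)" using eps nonneg by (intro mult_right_mono) auto
  also have "\<dots> \<le> \<epsilon>\<^sup>2 * ((\<alpha> + \<beta>) / 2)\<^sup>2"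
    by (intro mult_left_mono) (use zero_le_power2[of "\<alpha> - \<beta>"] in \<open>auto simp: power2_eq_square field_simps\<close>)
  finally have "(ip h (avg B f))\<^sup>2 \<le> (\<epsilon> * ((\<alpha> + \<beta>) / 2))\<^sup>2" by (simp only: power_mult_distrib)
  then have "ip h (avg B f) \<le> \<epsilon> * ((\<alpha> + \<beta>) / 2)"
    by (rule power2_le_imp_le) (use eps nonneg in simp)
  then have y: "y \<le> \<epsilon> * (\<alpha> + \<beta>)" unfolding y_def by simp
  \<comment> \<open>This second Cauchy-Schwarz inequality bounds \<open>\<alpha> + \<beta>\<close>
    in terms of \<open>N\<close>: a function cannot be close to two nearly orthogonal subspaces at
    once.\<close>
  have "(ip f (\<lambda>x. h x + avg B f x))\<^sup>2 \<le> N * ip (\<lambda>x. h x + avg B f x) (\<lambda>x. h x + avg B f x)"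
    unfolding N_def by (rule ip_Cauchy_Schwarz)
  moreover have "ip f (\<lambda>x. h x + avg B f x) = \<alpha> + \<beta>"
    unfolding \<alpha>_def \<beta>_def by (simp add: ip_add_right ip_commute)
  moreover have sq: "ip (\<lambda>x. h x + avg B f x) (\<lambda>x. h x + avg B f x) = \<alpha> + \<beta> + y"
    unfolding y_def by (simp add: ip_add_right ip_add_left hh bb ip_commute[of "avg B f" h])
  ultimately have CS: "(\<alpha> + \<beta>)\<^sup>2 \<le> N * (\<alpha> + \<beta> + y)" by simp
  \<comment> \<open>This is the claim written in \<open>N\<close>, \<open>\<alpha>\<close>,
    \<open>\<beta>\<close> and \<open>y\<close>. Multiply it by \<open>s + y\<close>, which is a
    squared norm and so nonnegative, and replace \<open>N * (s + y)\<close> by the smaller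
    \<open>s\<^sup>2\<close>; what remains factors as
    \<open>(\<epsilon> * s - y) * (s - y)\<close>.\<close>
  have key: "(2 + 2 * \<epsilon>) * N - (2 + \<epsilon>) * (\<alpha> + \<beta>) + y \<ge> 0"
  proof -
    define s where "s = \<alpha> + \<beta>"
    have s: "0 \<le> s" "y \<le> \<epsilon> * s" "s\<^sup>2 \<le> N * (s + y)" using nonneg y CS by (auto simp: s_def)
    have ys: "y \<le> s" using s(2) mult_right_mono[OF eps(3) s(1)] by simp
    have t: "0 \<le> s + y" unfolding s_def sq[symmetric] by (rule ip_self_nonneg)
    show ?thesis
    proof (cases "s + y = 0")
      case True
      then have "s\<^sup>2 \<le> 0" using s(3) by simp
      then have "s = 0" by simp
      then show ?thesis using True nonneg eps unfolding s_def[symmetric] by simp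
    next
      case False
      have "(\<epsilon> * s - y) * (s - y) \<ge> 0" using s(2) ys by simp
      then have "(2 + 2 * \<epsilon>) * s\<^sup>2 - (2 + \<epsilon>) * s * (s + y) + y * (s + y) \<ge> 0"
        by (simp add: power2_eq_square algebra_simps)
      moreover have "(2 + 2 * \<epsilon>) * s\<^sup>2 \<le> (2 + 2 * \<epsilon>) * (N * (s + y))"
        using s(3) eps by (intro mult_left_mono) auto
      ultimately have "0 \<le> ((2 + 2 * \<epsilon>) * N - (2 + \<epsilon>) * s + y) * (s + y)"
        by (simp add: algebra_simps)
      then show ?thesis using t False unfolding s_def[symmetric]
        by (simp add: zero_le_mult_iff)
    qed
  qed
  have dA: "ip (dev A f) f = N - \<alpha>" unfolding ip_dev_left[OF A] N_def \<alpha>_def h_def by simp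
  have dB: "ip (dev B f) f = N - \<beta>" unfolding ip_dev_left[OF B] N_def \<beta>_def by simp
  have dAB: "ip (dev A f) (dev B f) = N - \<alpha> - \<beta> + y / 2"
    unfolding dev_def N_def \<alpha>_def \<beta>_def y_def h_def
    by (simp add: ip_diff_left ip_diff_right ip_commute)
  show ?thesis unfolding dA dB dAB using key by (simp add: algebra_simps)
qed

text \<open>Split \<open>f\<close> into its \<open>C\<close>-invariant part and the rest. Both
  projections commute with \<open>avg C\<close>, so all mixed terms vanish; the invariant part
  contributes a nonnegative amount and the rest is covered by \<open>dev_pair_zero\<close>.\<close>

lemma dev_pair:
  "2 * ip (dev A f) (dev B f) \<ge> - \<epsilon> * (ip (dev A f) f + ip (dev B f) f)"
proof -
  define f0 where "f0 = avg C f"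
  define f1 where "f1 = (\<lambda>x. f x - f0 x)"
  have f: "f = (\<lambda>x. f0 x + f1 x)" by (simp add: f1_def)
  have avg1: "avg C f1 x = 0" if "x \<in> X" for x
    using that by (simp add: f1_def f0_def avg_diff avg_avg[OF C])
  have fixed0: "f0 (act x c) = f0 x" if "x \<in> X" "c \<in> C" for x c
    using avg_act[OF C that] by (simp add: f0_def)
  have cross: "ip u v = 0" if "\<And>x. x \<in> X \<Longrightarrow> avg C u x = u x" "\<And>x. x \<in> X \<Longrightarrow> avg C v x = 0" for u v
  proof -
    have "ip u v = ip (avg C u) v" using that by (intro ip_cong) auto
    also have "\<dots> = ip u (\<lambda>x. 0)" unfolding avg_self_adjoint[OF C] using that by (intro ip_cong) auto
    finally show ?thesis by (simp add: ip_def)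
  qed
  have comm: "avg C (dev D g) x = avg C g x - avg D (avg C g) x"
    if "subgroup D G" "finite D" "\<And>d c. \<lbrakk>d \<in> D; c \<in> C\<rbrakk> \<Longrightarrow> d \<otimes> c = c \<otimes> d" "x \<in> X" for D g x
  proof -
    have "avg C (dev D g) x = avg C g x - avg C (avg D g) x"
      by (rule avg_dev)
    moreover have "avg C (avg D g) x = avg D (avg C g) x"
      by (rule avg_commute[OF C that(1,2) _ that(4)]) (use that(3) in simp)
    ultimately show ?thesis by simp
  qed
  have c0: "avg C (dev D f0) x = dev D f0 x"
    if "subgroup D G" "finite D" "\<And>d c. \<lbrakk>d \<in> D; c \<in> C\<rbrakk> \<Longrightarrow> d \<otimes> c = c \<otimes> d" "x \<in> X" for D x
  proof -
    have "avg D (avg C f0) x = avg D f0 x"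
      by (rule avg_cong[OF that(1,2) _ that(4)]) (simp add: f0_def avg_avg[OF C])
    then show ?thesis using comm[OF that, of f0] avg_avg[OF C that(4), of f] that(4)
      by (simp add: f0_def dev_def)
  qed
  have c1: "avg C (dev D f1) x = 0"
    if "subgroup D G" "finite D" "\<And>d c. \<lbrakk>d \<in> D; c \<in> C\<rbrakk> \<Longrightarrow> d \<otimes> c = c \<otimes> d" "x \<in> X" for D x
  proof -
    have "avg D (avg C f1) x = avg D (\<lambda>x. 0) x"
      by (rule avg_cong[OF that(1,2) _ that(4)]) (simp add: avg1)
    moreover have "avg D (\<lambda>x. 0) x = 0" by (simp add: avg_def)
    ultimately show ?thesis using comm[OF that, of f1] avg1[OF that(4)] by simp
  qed
  note A' = A AC and B' = B BC
  have cf0: "avg C f0 x = f0 x" if "x \<in> X" for x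
    using avg_avg[OF C that] by (simp add: f0_def)
  have "ip f0 (dev A f1) = 0" "ip f0 (dev B f1) = 0"
    by (rule cross[OF cf0 c1[OF A']] cross[OF cf0 c1[OF B']]; assumption)+
  moreover have "ip (dev A f0) f1 = 0" "ip (dev B f0) f1 = 0"
    by (rule cross[OF c0[OF A'] avg1] cross[OF c0[OF B'] avg1]; assumption)+
  ultimately have xA: "ip (dev A f0) f1 = 0" "ip (dev A f1) f0 = 0"
    and xB: "ip (dev B f0) f1 = 0" "ip (dev B f1) f0 = 0"
    by (simp_all only: ip_commute[of _ f0])
  have "ip (dev B f0) (dev A f1) = 0" by (rule cross[OF c0[OF B'] c1[OF A']])
  moreover have "ip (dev A f0) (dev B f1) = 0" by (rule cross[OF c0[OF A'] c1[OF B']])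
  ultimately have xAB: "ip (dev A f0) (dev B f1) = 0" "ip (dev A f1) (dev B f0) = 0"
    by (simp_all only: ip_commute[of "dev A f1"])
  have dA: "dev A f = (\<lambda>x. dev A f0 x + dev A f1 x)"
    by (rule trans[OF arg_cong[OF f, of "dev A"] dev_add])
  have dB: "dev B f = (\<lambda>x. dev B f0 x + dev B f1 x)"
    by (rule trans[OF arg_cong[OF f, of "dev B"] dev_add])
  have AB0: "0 \<le> ip (dev A f0) (dev B f0)" by (rule dev_pair_fixed[OF fixed0])
  have e0: "0 \<le> \<epsilon> * (ip (dev A f0) f0 + ip (dev B f0) f0)"
    using ip_dev_self_nonneg[OF A] ip_dev_self_nonneg[OF B] eps by simp
  have AB1: "- \<epsilon> * (ip (dev A f1) f1 + ip (dev B f1) f1) \<le> 2 * ip (dev A f1) (dev B f1)"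
    by (rule dev_pair_zero[OF avg1])
  have eA: "ip (dev A f) f = ip (dev A f0) f0 + ip (dev A f1) f1"
    by (rule trans[OF arg_cong2[OF dA f, of ip]]) (simp only: ip_add_left ip_add_right xA add_0_left add_0_right)
  have eB: "ip (dev B f) f = ip (dev B f0) f0 + ip (dev B f1) f1"
    by (rule trans[OF arg_cong2[OF dB f, of ip]]) (simp only: ip_add_left ip_add_right xB add_0_left add_0_right)
  have eAB: "ip (dev A f) (dev B f) = ip (dev A f0) (dev B f0) + ip (dev A f1) (dev B f1)"
    by (rule trans[OF arg_cong2[OF dA dB, of ip]]) (simp only: ip_add_left ip_add_right xAB add_0_left add_0_right)
  have sum: "- \<epsilon> * ((y0 + y1) + (z0 + z1)) \<le> 2 * (x0 + x1)"
    if "0 \<le> x0" "0 \<le> \<epsilon> * (y0 + z0)" "- \<epsilon> * (y1 + z1) \<le> 2 * x1" for x0 x1 y0 y1 z0 z1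
  proof -
    have "- \<epsilon> * ((y0 + y1) + (z0 + z1)) = - (\<epsilon> * (y0 + z0)) + - \<epsilon> * (y1 + z1)"
      by (simp add: algebra_simps)
    also have "\<dots> \<le> 0 + 2 * x1" by (intro add_mono) (use that in auto)
    also have "\<dots> \<le> 2 * (x0 + x1)" using that(1) by simp
    finally show ?thesis .
  qed
  have "- \<epsilon> * (ip (dev A f) f + ip (dev B f) f) \<le> 2 * ip (dev A f) (dev B f)"
    unfolding eA eB eAB by (rule sum[OF AB0 e0 AB1])
  then show ?thesis by assumption
qed

end

end

context finite_right_action
begin

text \<open>The inequality between the square of \<open>\<Delta>\<close> and \<open>\<Delta>\<close>
  yields the gap without diagonalization: write \<open>f = \<Delta> g\<close> and apply
  Cauchy-Schwarz to the semidefinite form \<open>ip (\<Delta> g) f\<close>. Then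
  \<open>(ip f f)\<^sup>2\<close> is at most \<open>ip (\<Delta> g) g * ip (\<Delta> f) f\<close>,
  and \<open>square\<close> bounds the first factor by a multiple of \<open>ip f f\<close>. The
  hypothesis \<open>const\<close> identifies the kernel of \<open>\<Delta>\<close> with the
  constants.\<close>

theorem spectral_gap:
  fixes A1 A2 A3 :: "'a set" and f :: "'x \<Rightarrow> real"
  assumes A1: "subgroup A1 G" "finite A1" and A2: "subgroup A2 G" "finite A2"
    and A3: "subgroup A3 G" "finite A3"
    and pair12: "\<And>f. 2 * ip (dev A1 f) (dev A2 f) \<ge> - \<epsilon> * (ip (dev A1 f) f + ip (dev A2 f) f)"
    and pair32: "\<And>f. 2 * ip (dev A3 f) (dev A2 f) \<ge> - \<epsilon> * (ip (dev A3 f) f + ip (dev A2 f) f)"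
    and pair31: "\<And>f. 2 * ip (dev A3 f) (dev A1 f) \<ge> - \<epsilon> * (ip (dev A3 f) f + ip (dev A1 f) f)"
    and \<epsilon>: "\<epsilon> < 1 / 2"
    and const: "\<And>f x y. \<lbrakk>\<forall>x\<in>X. \<forall>a\<in>A1 \<union> A2 \<union> A3. f (act x a) = f x; x \<in> X; y \<in> X\<rbrakk> \<Longrightarrow> f x = (f y :: real)"
    and mean: "(\<Sum>x\<in>X. f x) = 0"
  shows "(1 - 2 * \<epsilon>) * ip f f \<le> ip (dev A1 f) f + ip (dev A2 f) f + ip (dev A3 f) f"
proof -
  define \<Delta> where "\<Delta> f x = dev A1 f x + dev A2 f x + dev A3 f x" for f x
  have ip_\<Delta>: "ip (\<Delta> f) g = ip (dev A1 f) g + ip (dev A2 f) g + ip (dev A3 f) g" for f g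
    unfolding \<Delta>_def[abs_def] by (simp add: ip_add_left)
  have ip_\<Delta>': "ip g (\<Delta> f) = ip g (dev A1 f) + ip g (dev A2 f) + ip g (dev A3 f)" for f g
    unfolding \<Delta>_def[abs_def] by (simp add: ip_add_right)
  have sa: "ip (\<Delta> f) g = ip f (\<Delta> g)" for f g
    by (simp only: ip_\<Delta> ip_\<Delta>' dev_self_adjoint[OF A1] dev_self_adjoint[OF A2] dev_self_adjoint[OF A3])
  have nonneg: "0 \<le> ip (\<Delta> f) f" for f
    unfolding ip_\<Delta> using ip_dev_self_nonneg[OF A1] ip_dev_self_nonneg[OF A2] ip_dev_self_nonneg[OF A3] by simp
  \<comment> \<open>Each of the three projections occurs in two of the three pairs, which is why the
    loss is twice \<open>\<epsilon>\<close>.\<close>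
  have square: "(1 - 2 * \<epsilon>) * ip (\<Delta> f) f \<le> ip (\<Delta> f) (\<Delta> f)" for f
  proof -
    have "ip (\<Delta> f) (\<Delta> f) = ip (dev A1 f) f + ip (dev A2 f) f + ip (dev A3 f) f
        + 2 * ip (dev A1 f) (dev A2 f) + 2 * ip (dev A3 f) (dev A2 f) + 2 * ip (dev A3 f) (dev A1 f)"
      unfolding ip_\<Delta> ip_\<Delta>'
      using ip_dev_dev[OF A1, of f f] ip_dev_dev[OF A2, of f f] ip_dev_dev[OF A3, of f f]
        ip_commute[of "dev A2 f" "dev A3 f"] ip_commute[of "dev A1 f" "dev A3 f"]
        ip_commute[of "dev A2 f" "dev A1 f"] by linarith
    moreover have "(1 - 2 * \<epsilon>) * ip (\<Delta> f) f = ip (dev A1 f) f + ip (dev A2 f) f + ip (dev A3 f) f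
        + - \<epsilon> * (ip (dev A1 f) f + ip (dev A2 f) f) + - \<epsilon> * (ip (dev A3 f) f + ip (dev A2 f) f)
        + - \<epsilon> * (ip (dev A3 f) f + ip (dev A1 f) f)"
      unfolding ip_\<Delta> by (simp add: algebra_simps)
    ultimately show ?thesis using pair12[of f] pair32[of f] pair31[of f] by linarith
  qed
  have CS: "(ip (\<Delta> g) f)\<^sup>2 \<le> ip (\<Delta> g) g * ip (\<Delta> f) f" for f g
  proof -
    have *: "0 \<le> ip (\<Delta> g) g + 2 * t * ip (\<Delta> g) f + t\<^sup>2 * ip (\<Delta> f) f" for t
    proof -
      let ?h = "\<lambda>x. g x + t * f x"
      have scale: "ip (\<lambda>x. t * u x) v = t * ip u v" "ip u (\<lambda>x. t * v x) = t * ip u v" for u v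
        by (simp_all add: ip_def sum_distrib_left mult.assoc mult.left_commute)
      have "\<Delta> ?h = (\<lambda>x. \<Delta> g x + t * \<Delta> f x)"
        by (simp add: \<Delta>_def[abs_def] dev_add dev_scale algebra_simps)
      then have "ip (\<Delta> ?h) ?h = ip (\<Delta> g) g + t * ip (\<Delta> g) f + t * ip (\<Delta> f) g + t * (t * ip (\<Delta> f) f)"
        by (simp add: ip_add_left ip_add_right scale algebra_simps)
      moreover have "ip (\<Delta> f) g = ip (\<Delta> g) f" by (simp add: sa ip_commute[of f])
      ultimately show ?thesis using nonneg[of ?h] by (simp add: power2_eq_square algebra_simps)
    qed
    let ?a = "ip (\<Delta> f) f" and ?b = "ip (\<Delta> g) f" and ?c = "ip (\<Delta> g) g"
    show ?thesis
    proof (cases "?a = 0")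
      case True
      have "?b = 0"
      proof (rule ccontr)
        assume b: "?b \<noteq> 0"
        have "0 \<le> ?c + 2 * (- (?c + 1) / (2 * ?b)) * ?b" using *[of "- (?c + 1) / (2 * ?b)"] True by simp
        also have "\<dots> = - 1" using b by (simp add: field_simps)
        finally show False by simp
      qed
      then show ?thesis using True by simp
    next
      case False
      then have a: "?a > 0" using nonneg[of f] by simp
      have "0 \<le> ?c + 2 * (- ?b / ?a) * ?b + (- ?b / ?a)\<^sup>2 * ?a" by (rule *)
      also have "\<dots> = ?c - ?b\<^sup>2 / ?a" using a by (simp add: field_simps power2_eq_square)
      finally show ?thesis using a by (simp add: pos_divide_le_eq)
    qed
  qed
  \<comment> \<open>Adding the sum of \<open>g\<close> removes the constants from the kernel of
    \<open>\<Delta>\<close>, so \<open>T\<close> is injective and hence onto. Since \<open>f\<close>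
    has mean zero and \<open>\<Delta> g\<close> always sums to zero, a solution of
    \<open>T g = f'\<close> has vanishing sum and satisfies \<open>\<Delta> g = f\<close> on
    \<open>X\<close>.\<close>
  define T where "T g x = (if x \<in> X then \<Delta> g x + (\<Sum>y\<in>X. g y) else 0)" for g x
  define f' where "f' x = (if x \<in> X then f x else 0)" for x
  have dev1: "dev A (\<lambda>x. 1) = (\<lambda>x. 0)" if "subgroup A G" "finite A" for A
    using subgroup_card_pos[OF that] by (simp add: dev_def avg_def fun_eq_iff)
  have sum_\<Delta>: "(\<Sum>x\<in>X. \<Delta> g x) = 0" for g
  proof -
    have "\<Delta> (\<lambda>x. 1) = (\<lambda>x. 0)"
      by (simp add: \<Delta>_def[abs_def] dev1[OF A1] dev1[OF A2] dev1[OF A3])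
    then show ?thesis using sa[of g "\<lambda>x. 1"] by (simp add: ip_def)
  qed
  have "\<exists>g. (\<forall>x. x \<notin> X \<longrightarrow> g x = 0) \<and> T g = f'"
  proof (rule injective_operator_surjective[OF finite_X])
    show "T (\<lambda>x. g x + h x) = (\<lambda>x. T g x + T h x)" for g h
      by (simp add: fun_eq_iff T_def \<Delta>_def dev_add sum.distrib)
    show "T (\<lambda>x. c * g x) = (\<lambda>x. c * T g x)" for c g
      by (simp add: fun_eq_iff T_def \<Delta>_def dev_scale sum_distrib_left[symmetric] distrib_left)
    fix g assume supp: "\<forall>x. x \<notin> X \<longrightarrow> g x = 0" and "T g = (\<lambda>x. 0)"
    then have T0: "\<Delta> g x + (\<Sum>y\<in>X. g y) = 0" if "x \<in> X" for x
      using that by (metis T_def)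
    have ip_const: "ip (\<lambda>x. t) g = t * (\<Sum>x\<in>X. g x)" for t
      by (simp add: ip_def sum_distrib_left)
    have "0 = ip (\<lambda>x. \<Delta> g x + (\<Sum>y\<in>X. g y)) g" using T0 by (simp add: ip_def)
    also have "\<dots> = ip (\<Delta> g) g + (\<Sum>y\<in>X. g y)\<^sup>2"
      by (simp only: ip_add_left ip_const power2_eq_square)
    finally have "ip (\<Delta> g) g = 0 \<and> (\<Sum>y\<in>X. g y)\<^sup>2 = 0"
      using nonneg[of g] zero_le_power2[of "\<Sum>y\<in>X. g y"] by linarith
    then have \<Delta>0: "ip (\<Delta> g) g = 0" and mean0: "(\<Sum>y\<in>X. g y) = 0" by simp_all
    from \<Delta>0 have "ip (dev A1 g) g = 0" "ip (dev A2 g) g = 0" "ip (dev A3 g) g = 0"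
      using ip_dev_self_nonneg[OF A1, of g] ip_dev_self_nonneg[OF A2, of g] ip_dev_self_nonneg[OF A3, of g]
      unfolding ip_\<Delta> by linarith+
    note fixed = dev_eq_0_imp_fixed[OF A1 this(1)] dev_eq_0_imp_fixed[OF A2 this(2)] dev_eq_0_imp_fixed[OF A3 this(3)]
    have inv: "\<forall>x\<in>X. \<forall>a\<in>A1 \<union> A2 \<union> A3. g (act x a) = g x" by (auto simp: fixed)
    have c: "g x = g y" if "x \<in> X" "y \<in> X" for x y
      using const[of g x y] inv that by metis
    show "g = (\<lambda>x. 0)"
    proof
      fix x show "g x = 0"
      proof (cases "x \<in> X")
        case True
        have "(\<Sum>y\<in>X. g y) = (\<Sum>y\<in>X. g x)" by (rule sum.cong[OF refl c[OF _ True]])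
        then show ?thesis using mean0 True finite_X by auto
      qed (use supp in simp)
    qed
  qed (auto simp: T_def f'_def)
  then obtain g where g: "T g = f'" by blast
  have "0 = (\<Sum>x\<in>X. f' x)" using mean by (simp add: f'_def)
  also have "\<dots> = (\<Sum>x\<in>X. \<Delta> g x + (\<Sum>y\<in>X. g y))" unfolding g[symmetric] by (simp add: T_def)
  also have "\<dots> = real (card X) * (\<Sum>y\<in>X. g y)" by (simp add: sum.distrib sum_\<Delta>)
  finally have "card X = 0 \<or> (\<Sum>y\<in>X. g y) = 0" by simp
  then have f_eq: "f x = \<Delta> g x" if "x \<in> X" for x
    using fun_cong[OF g, of x] that finite_X by (auto simp: T_def f'_def)
  have ff: "ip f f = ip (\<Delta> g) f" using f_eq by (intro ip_cong) auto
  have ff': "ip f f = ip (\<Delta> g) (\<Delta> g)" using f_eq by (intro ip_cong) auto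
  show ?thesis
  proof (cases "ip f f = 0")
    case True
    then show ?thesis using nonneg[of f] by (simp add: ip_\<Delta>)
  next
    case False
    then have pos: "ip f f > 0" using ip_self_nonneg[of f] by simp
    have "(1 - 2 * \<epsilon>) * (ip f f)\<^sup>2 \<le> (1 - 2 * \<epsilon>) * (ip (\<Delta> g) g * ip (\<Delta> f) f)"
      using CS[of g f] \<epsilon> unfolding ff by (intro mult_left_mono) auto
    also have "\<dots> = ((1 - 2 * \<epsilon>) * ip (\<Delta> g) g) * ip (\<Delta> f) f" by simp
    also have "\<dots> \<le> ip f f * ip (\<Delta> f) f"
      using square[of g] nonneg[of f] unfolding ff' by (intro mult_right_mono) auto
    finally have "ip f f * ((1 - 2 * \<epsilon>) * ip f f) \<le> ip f f * ip (\<Delta> f) f"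
      by (simp add: power2_eq_square algebra_simps)
    then show ?thesis using pos unfolding ip_\<Delta>[symmetric] by simp
  qed
qed

end

section \<open>Quotient graphs\<close>

context quotient_data
begin

lemma N_subgroup: "subgroup (N n) G"
  using N_normal normal_imp_subgroup by blast

lemma N_subset: "N n \<subseteq> carrier G"
  using subgroup.subset[OF N_subgroup] .

lemma quotient_carrier: "carrier (G Mod N n) = rcosets (N n)"
  by (simp add: FactGroup_def)

lemma quotient_carrierE:
  assumes "x \<in> carrier (G Mod N n)"
  obtains g where "g \<in> carrier G" "x = N n #> g"
  using assms by (auto simp: quotient_carrier RCOSETS_def)

lemma quotient_carrierI: "g \<in> carrier G \<Longrightarrow> N n #> g \<in> carrier (G Mod N n)"
  by (auto simp: quotient_carrier RCOSETS_def)

lemma N_in_quotient: "N n \<in> carrier (G Mod N n)"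
  using quotient_carrierI[OF one_closed, of n] N_subset by simp

lemma finite_quotient: "finite (carrier (G Mod N n))"
  by (simp add: quotient_carrier N_finite_index)

lemma quotient_subset: "x \<in> carrier (G Mod N n) \<Longrightarrow> x \<subseteq> carrier G"
  using r_coset_subset_G[OF N_subset] by (auto elim!: quotient_carrierE)

lemma quotient_right_action:
  "finite_right_action G (carrier (G Mod N n)) (\<lambda>x g. x #> g)"
proof (unfold_locales)
  show "x #> a \<in> carrier (G Mod N n)" if "x \<in> carrier (G Mod N n)" "a \<in> carrier G" for x a
    using that by (auto elim!: quotient_carrierE simp: coset_mult_assoc[OF N_subset] intro!: quotient_carrierI m_closed)
  show "(x #> a) #> b = x #> (a \<otimes> b)"
    if "x \<in> carrier (G Mod N n)" "a \<in> carrier G" "b \<in> carrier G" for x a b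
    using coset_mult_assoc[OF quotient_subset] that by simp
qed (use finite_quotient quotient_subset in auto)

text \<open>Normality of \<open>N n\<close> turns the condition on the product in the quotient group
  into a translation by an element of \<open>S\<close>. From here on the quotients are used only
  through the right action of \<open>G\<close> on cosets.\<close>

lemma quotient_edges_iff:
  "(x, y) \<in> quotient_edges G S (N n) \<longleftrightarrow> x \<in> carrier (G Mod N n) \<and> (\<exists>s\<in>S. y = x #> s)"
proof -
  interpret normal "N n" G by (rule N_normal)
  interpret finite_right_action G "carrier (G Mod N n)" "\<lambda>x g. x #> g" by (rule quotient_right_action)
  have eq: "inv\<^bsub>G Mod N n\<^esub> x \<otimes>\<^bsub>G Mod N n\<^esub> y = N n #> s \<longleftrightarrow> y = x #> s"
    if x: "x \<in> carrier (G Mod N n)" and y: "y \<in> carrier (G Mod N n)" and s: "s \<in> carrier G" for s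
  proof -
    from x obtain g where g: "g \<in> carrier G" "x = N n #> g" by (rule quotient_carrierE)
    from y obtain h where h: "h \<in> carrier G" "y = N n #> h" by (rule quotient_carrierE)
    have "inv\<^bsub>G Mod N n\<^esub> x = N n #> inv g"
      using inv_FactGroup[OF x] g rcos_inv[OF g(1)] by simp
    then have "inv\<^bsub>G Mod N n\<^esub> x \<otimes>\<^bsub>G Mod N n\<^esub> y = N n #> (inv g \<otimes> h)"
      using g h by (simp add: FactGroup_def rcos_sum)
    moreover have "N n #> (inv g \<otimes> h) = N n #> s \<longleftrightarrow> N n #> h = N n #> (g \<otimes> s)"
    proof
      assume "N n #> (inv g \<otimes> h) = N n #> s"
      then have "(N n #> g) <#> (N n #> (inv g \<otimes> h)) = (N n #> g) <#> (N n #> s)" by simp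
      then show "N n #> h = N n #> (g \<otimes> s)" using g h s by (simp add: rcos_sum m_assoc[symmetric])
    next
      assume "N n #> h = N n #> (g \<otimes> s)"
      then have "(N n #> inv g) <#> (N n #> h) = (N n #> inv g) <#> (N n #> (g \<otimes> s))" by simp
      then show "N n #> (inv g \<otimes> h) = N n #> s" using g h s by (simp add: rcos_sum m_assoc[symmetric])
    qed
    ultimately show ?thesis using g h s by (simp add: coset_mult_assoc[OF N_subset])
  qed
  show ?thesis
  proof
    assume "(x, y) \<in> quotient_edges G S (N n)"
    then show "x \<in> carrier (G Mod N n) \<and> (\<exists>s\<in>S. y = x #> s)"
      using eq gens_closed by (auto simp: quotient_edges_def)
  next
    assume "x \<in> carrier (G Mod N n) \<and> (\<exists>s\<in>S. y = x #> s)"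
    then obtain s where s: "x \<in> carrier (G Mod N n)" "s \<in> S" "y = x #> s" by blast
    then have "y \<in> carrier (G Mod N n)" using gens_closed by auto
    then show "(x, y) \<in> quotient_edges G S (N n)"
      using s eq[of s] gens_closed by (auto simp: quotient_edges_def)
  qed
qed

lemma quotient_edges_subset:
  "quotient_edges G S (N n) \<subseteq> carrier (G Mod N n) \<times> carrier (G Mod N n)"
  by (auto simp: quotient_edges_def)

lemma gens_inv: "s \<in> S \<Longrightarrow> inv s \<in> S"
  using gens_sym by blast

lemma sym_quotient_edges: "sym (quotient_edges G S (N n))"
proof (rule symI)
  interpret finite_right_action G "carrier (G Mod N n)" "\<lambda>x g. x #> g" by (rule quotient_right_action)
  fix x y assume "(x, y) \<in> quotient_edges G S (N n)"
  then obtain s where s: "x \<in> carrier (G Mod N n)" "s \<in> S" "y = x #> s"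
    by (auto simp: quotient_edges_iff)
  then have "s \<in> carrier G" using gens_closed by blast
  then have "x = y #> inv s" using s by (simp add: act_mult)
  then show "(y, x) \<in> quotient_edges G S (N n)"
    using s gens_inv \<open>s \<in> carrier G\<close> by (auto simp: quotient_edges_iff)
qed

lemma N_antimono: "m \<le> n \<Longrightarrow> N n \<subseteq> N m"
  by (rule lift_Suc_antimono_le[of N, OF N_decreasing])

text \<open>An element other than the identity leaves the decreasing sequence at some stage for
  good; take the maximum over \<open>F\<close>. This is the only way in which the trivial
  intersection of the sequence is used.\<close>

lemma eventually_N_separates:
  assumes "finite F"
  shows "\<exists>n0. \<forall>n\<ge>n0. F \<inter> N n \<subseteq> {\<one>}"
  using assms
proof (induction F)
  case (insert g F)
  then obtain n0 where n0: "\<forall>n\<ge>n0. F \<inter> N n \<subseteq> {\<one>}" by blast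
  show ?case
  proof (cases "g = \<one>")
    case True
    then show ?thesis using n0 by blast
  next
    case False
    then obtain m where "g \<notin> N m" using N_Inter by blast
    then have "g \<notin> N n" if "n \<ge> m" for n using N_antimono[OF that] by blast
    then show ?thesis using n0 by (intro exI[of _ "max m n0"]) auto
  qed
qed auto

lemma card_quotient_at_top: "filterlim (\<lambda>n. card (carrier (G Mod N n))) at_top sequentially"
  unfolding filterlim_at_top
proof
  fix k :: nat
  obtain F where F: "F \<subseteq> carrier G" "finite F" "card F = k"
    using infinite_arbitrarily_large[OF infinite_carrier] by blast
  let ?D = "(\<lambda>(g, h). g \<otimes> inv h) ` (F \<times> F)"
  obtain n0 where n0: "\<And>n. n \<ge> n0 \<Longrightarrow> ?D \<inter> N n \<subseteq> {\<one>}"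
    using eventually_N_separates[of ?D] F by auto
  have "k \<le> card (carrier (G Mod N n))" if n: "n \<ge> n0" for n
  proof -
    have "inj_on (\<lambda>g. N n #> g) F"
    proof (rule inj_onI)
      fix g h assume gh: "g \<in> F" "h \<in> F" "N n #> g = N n #> h"
      then have c: "g \<in> carrier G" "h \<in> carrier G" using F by auto
      have "N n #> (g \<otimes> inv h) = N n" by (rule coset_mult_inv2[OF gh(3) c N_subset])
      then have "g \<otimes> inv h \<in> N n" by (rule coset_join1) (use c N_subgroup in auto)
      then have "g \<otimes> inv h = \<one>" using n0[OF n] gh by auto
      then show "g = h" using c by (metis inv_equality inv_inv inv_closed)
    qed
    then have "card F = card ((\<lambda>g. N n #> g) ` F)" by (simp add: card_image)
    also have "\<dots> \<le> card (carrier (G Mod N n))"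
      using F by (intro card_mono finite_quotient) (auto intro!: quotient_carrierI)
    finally show ?thesis using F by simp
  qed
  then show "\<forall>\<^sub>F n in sequentially. k \<le> card (carrier (G Mod N n))"
    unfolding eventually_sequentially by blast
qed

lemma quotient_graph_simps:
  "pverts (quotient_graph G S (N n)) = carrier (G Mod N n)"
  "parcs (quotient_graph G S (N n)) = quotient_edges G S (N n) - Id"
  by (auto simp: quotient_graph_def)

lemma pair_graph_quotient_graph: "pair_graph (quotient_graph G S (N n))"
proof -
  let ?\<G> = "quotient_graph G S (N n)"
  have fin: "finite (quotient_edges G S (N n))"
    by (rule finite_subset[OF quotient_edges_subset]) (simp add: finite_quotient)
  show ?thesis
  proof unfold_locales
    show "symmetric (with_proj ?\<G>)"
      using sym_quotient_edges[of n]
      by (auto simp: symmetric_def arcs_ends_def arc_to_ends_def with_proj_def quotient_graph_simps sym_def image_iff)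
  qed (use quotient_edges_subset[of n] fin finite_quotient in \<open>auto simp: quotient_graph_simps\<close>)
qed

lemma connected_quotient_graph: "Digraph_Component.connected (quotient_graph G S (N n))"
proof -
  interpret finite_right_action G "carrier (G Mod N n)" "\<lambda>x g. x #> g" by (rule quotient_right_action)
  let ?\<G> = "quotient_graph G S (N n)"
  let ?R = "rtrancl_on (carrier (G Mod N n)) (arcs_ends (mk_symmetric ?\<G>))"
  have arcs: "(x, y) \<in> arcs_ends (mk_symmetric ?\<G>)" if "(x, y) \<in> quotient_edges G S (N n)" "x \<noteq> y" for x y
    using that by (auto simp: mk_symmetric_def arcs_ends_def arc_to_ends_def with_proj_def quotient_graph_simps image_iff)
  have step: "(x, x #> s) \<in> ?R" if "x \<in> carrier (G Mod N n)" "s \<in> S" for x s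
  proof (cases "x = x #> s")
    case True
    then show ?thesis using that(1) by (simp add: True[symmetric])
  next
    case False
    have e: "(x, x #> s) \<in> quotient_edges G S (N n)" using that by (auto simp: quotient_edges_iff)
    show ?thesis
      by (rule rtrancl_on_into_rtrancl_on[OF rtrancl_on_refl[OF that(1)] arcs[OF e False]])
        (use that gens_closed in auto)
  qed
  have gen: "(x, x #> g) \<in> ?R" if "g \<in> generate G S" "x \<in> carrier (G Mod N n)" for g x
    using that
  proof (induction arbitrary: x)
    case one
    then show ?case by simp
  next
    case (eng g h)
    have "g \<in> carrier G" "h \<in> carrier G" using eng gens_generate by auto
    then have "x #> (g \<otimes> h) = (x #> g) #> h" "x #> g \<in> carrier (G Mod N n)"
      using eng(5) by (auto simp: act_mult)
    then show ?case using eng.IH(1)[OF eng.prems] eng.IH(2) rtrancl_on_trans by metis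
  qed (use step gens_inv in auto)
  have "(x, y) \<in> ?R" if "x \<in> carrier (G Mod N n)" "y \<in> carrier (G Mod N n)" for x y
  proof -
    obtain g h where "g \<in> carrier G" "x = N n #> g" "h \<in> carrier G" "y = N n #> h"
      using \<open>x \<in> _\<close> \<open>y \<in> _\<close> by (metis quotient_carrierE)
    then have "y = x #> (inv g \<otimes> h)"
      by (simp add: coset_mult_assoc[OF N_subset] m_assoc[symmetric])
    then show ?thesis using gen[of "inv g \<otimes> h" x] that \<open>g \<in> _\<close> \<open>h \<in> _\<close> gens_generate by auto
  qed
  moreover have "verts (with_proj (mk_symmetric ?\<G>)) = carrier (G Mod N n)"
    by (simp add: mk_symmetric_def with_proj_def quotient_graph_simps)
  ultimately show ?thesis
    using N_in_quotient[of n] unfolding connected_def strongly_connected_def reachable_def by auto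
qed

lemma out_degree_quotient_graph:
  "out_degree (quotient_graph G S (N n)) x = card {y. (x, y) \<in> parcs (quotient_graph G S (N n))}"
proof -
  have "out_arcs (quotient_graph G S (N n)) x = Pair x ` {y. (x, y) \<in> parcs (quotient_graph G S (N n))}"
    by (auto simp: out_arcs_def with_proj_def)
  then show ?thesis by (simp add: out_degree_def card_image inj_on_def)
qed

lemma out_degree_le: "out_degree (quotient_graph G S (N n)) x \<le> card S"
proof -
  have "{y. (x, y) \<in> parcs (quotient_graph G S (N n))} \<subseteq> (\<lambda>s. x #> s) ` S"
    by (auto simp: quotient_graph_simps quotient_edges_iff)
  then have "card {y. (x, y) \<in> parcs (quotient_graph G S (N n))} \<le> card ((\<lambda>s. x #> s) ` S)"
    using finite_gens by (intro card_mono) auto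
  also have "\<dots> \<le> card S" using finite_gens by (rule card_image_le)
  finally show ?thesis by (simp add: out_degree_quotient_graph)
qed

end

section \<open>The quadratic form of the Laplacian and its spectrum\<close>

lemma sum_pairs_antisym:
  fixes h :: "'v \<Rightarrow> 'v \<Rightarrow> complex"
  assumes "sym E"
  shows "(\<Sum>(x, y)\<in>E. h y x) = (\<Sum>(x, y)\<in>E. h x y)"
proof -
  have "bij_betw prod.swap E E"
    by (rule bij_betwI[where g = prod.swap]) (use assms in \<open>auto simp: sym_def\<close>)
  from sum.reindex_bij_betw[OF this, of "\<lambda>(x, y). h x y"] show ?thesis
    by (simp add: case_prod_unfold)
qed

text \<open>The factor 1/2 arises because \<open>E\<close> contains both orientations of every
  edge.\<close>

lemma Laplacian_sum:
  fixes f :: "'v \<Rightarrow> complex"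
  assumes V: "finite V" and E: "E \<subseteq> V \<times> V" "sym E"
  shows "(\<Sum>x\<in>V. \<Sum>y | (x, y) \<in> E. f x - f y) = 0"
    and "(\<Sum>x\<in>V. (\<Sum>y | (x, y) \<in> E. f x - f y) * cnj (f x))
      = of_real (\<Sum>(x, y)\<in>E. (cmod (f x - f y))\<^sup>2) / 2"
proof -
  have eq: "(\<Sum>x\<in>V. \<Sum>y | (x, y) \<in> E. h x y) = (\<Sum>(x, y)\<in>E. h x y)" for h :: "'v \<Rightarrow> 'v \<Rightarrow> complex"
  proof -
    have "E = Sigma V (\<lambda>x. {y. (x, y) \<in> E})" using E by auto
    moreover have "finite {y. (x, y) \<in> E}" for x
      by (rule finite_subset[OF _ V]) (use E in auto)
    ultimately show ?thesis using V by (subst sum.Sigma) auto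
  qed
  have "(\<Sum>(x, y)\<in>E. f x - f y) = (\<Sum>(x, y)\<in>E. f x) - (\<Sum>(x, y)\<in>E. f y)"
    by (simp add: case_prod_unfold sum_subtractf)
  also have "\<dots> = 0" using sum_pairs_antisym[OF E(2), of "\<lambda>x y. f x"] by simp
  finally show "(\<Sum>x\<in>V. \<Sum>y | (x, y) \<in> E. f x - f y) = 0" by (simp add: eq)
  let ?h = "\<lambda>x y. (f x - f y) * cnj (f x)"
  have "2 * (\<Sum>(x, y)\<in>E. ?h x y) = (\<Sum>(x, y)\<in>E. ?h x y) + (\<Sum>(x, y)\<in>E. ?h y x)"
    using sum_pairs_antisym[OF E(2), of ?h] by simp
  also have "\<dots> = (\<Sum>(x, y)\<in>E. of_real ((cmod (f x - f y))\<^sup>2))"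
    by (simp only: case_prod_unfold sum.distrib[symmetric] complex_norm_square)
      (simp add: algebra_simps)
  finally have two: "2 * (\<Sum>(x, y)\<in>E. ?h x y) = of_real (\<Sum>(x, y)\<in>E. (cmod (f x - f y))\<^sup>2)"
    by (simp add: case_prod_unfold)
  have "(\<Sum>x\<in>V. (\<Sum>y | (x, y) \<in> E. f x - f y) * cnj (f x)) = (\<Sum>(x, y)\<in>E. ?h x y)"
    by (simp add: sum_distrib_right eq[symmetric])
  also have "\<dots> = of_real (\<Sum>(x, y)\<in>E. (cmod (f x - f y))\<^sup>2) / 2"
    unfolding two[symmetric] by simp
  finally show "(\<Sum>x\<in>V. (\<Sum>y | (x, y) \<in> E. f x - f y) * cnj (f x))
      = of_real (\<Sum>(x, y)\<in>E. (cmod (f x - f y))\<^sup>2) / 2" .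
qed

context quotient_data
begin

lemma graph_laplacian_quotient:
  assumes f: "f \<in> ell2 (quotient_graph G S (N n))"
  shows "graph_laplacian (quotient_graph G S (N n)) f x
    = (\<Sum>y | (x, y) \<in> parcs (quotient_graph G S (N n)). f x - f y)"
  by (simp add: graph_laplacian_def out_degree_quotient_graph sum_subtractf)

text \<open>A spectral value has an eigenvector, by finite dimension. Summing the eigenvalue
  equation shows that the eigenvector has mean zero when the value is not 0; pairing the equation
  with the eigenvector then forces the value to be real and at least half of \<open>c\<close>. The
  assumption on real functions is applied to real and imaginary parts.\<close>

lemma laplacian_spectrum_quotient:
  assumes c: "c > 0"
    and gap: "\<And>f :: 'a set \<Rightarrow> real. (\<Sum>x\<in>carrier (G Mod N n). f x) = 0 \<Longrightarrow>
      c * (\<Sum>x\<in>carrier (G Mod N n). (f x)\<^sup>2) \<le> (\<Sum>(x, y)\<in>quotient_edges G S (N n). (f x - f y)\<^sup>2)"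
  shows "laplacian_spectrum (quotient_graph G S (N n)) \<subseteq> {0} \<union> complex_of_real ` {c / 2..}"
proof
  let ?\<G> = "quotient_graph G S (N n)"
  let ?V = "carrier (G Mod N n)" and ?E = "parcs ?\<G>"
  have E: "?E \<subseteq> ?V \<times> ?V" "sym ?E" "?E \<subseteq> quotient_edges G S (N n)"
    using quotient_edges_subset sym_quotient_edges[of n] by (auto simp: quotient_graph_simps sym_def)
  have finE: "finite (quotient_edges G S (N n))"
    by (rule finite_subset[OF quotient_edges_subset]) (simp add: finite_quotient)
  have ell2: "ell2 ?\<G> = {f. \<forall>x. x \<notin> ?V \<longrightarrow> f x = 0}" by (simp add: ell2_def quotient_graph_simps)
  have gap': "c * (\<Sum>x\<in>?V. (cmod (f x))\<^sup>2) \<le> (\<Sum>(x, y)\<in>?E. (cmod (f x - f y))\<^sup>2)"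
    if "(\<Sum>x\<in>?V. f x) = 0" for f :: "'a set \<Rightarrow> complex"
  proof -
    have "(\<Sum>x\<in>?V. Re (f x)) = 0" "(\<Sum>x\<in>?V. Im (f x)) = 0"
      using that by (simp_all only: Re_sum[symmetric] Im_sum[symmetric]) simp_all
    note g = gap[OF this(1)] gap[OF this(2)]
    have "c * (\<Sum>x\<in>?V. (cmod (f x))\<^sup>2) = c * (\<Sum>x\<in>?V. (Re (f x))\<^sup>2) + c * (\<Sum>x\<in>?V. (Im (f x))\<^sup>2)"
      by (simp add: cmod_power2 sum.distrib distrib_left)
    also have "\<dots> \<le> (\<Sum>(x, y)\<in>quotient_edges G S (N n). (Re (f x) - Re (f y))\<^sup>2)
        + (\<Sum>(x, y)\<in>quotient_edges G S (N n). (Im (f x) - Im (f y))\<^sup>2)"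
      using g by (rule add_mono)
    also have "\<dots> = (\<Sum>(x, y)\<in>quotient_edges G S (N n). (cmod (f x - f y))\<^sup>2)"
      by (simp add: case_prod_unfold cmod_power2 sum.distrib)
    \<comment> \<open>A generator lying in \<open>N n\<close> gives loops in
      \<open>quotient_edges\<close>, which the graph omits; their terms are zero.\<close>
    also have "\<dots> = (\<Sum>(x, y)\<in>?E. (cmod (f x - f y))\<^sup>2)"
      using finE by (intro sum.mono_neutral_right) (auto simp: quotient_graph_simps)
    finally show ?thesis .
  qed
  fix l assume l: "l \<in> laplacian_spectrum ?\<G>"
  let ?T = "\<lambda>f x. graph_laplacian ?\<G> f x - l * f x"
  show "l \<in> {0} \<union> complex_of_real ` {c / 2..}"
  proof (rule ccontr)
    assume nin: "l \<notin> {0} \<union> complex_of_real ` {c / 2..}"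
    have kernel: "f = (\<lambda>x. 0)" if f: "\<forall>x. x \<notin> ?V \<longrightarrow> f x = 0" and T: "?T f = (\<lambda>x. 0)" for f
    proof -
      have Lf: "(\<Sum>y | (x, y) \<in> ?E. f x - f y) = l * f x" for x
        using fun_cong[OF T, of x] graph_laplacian_quotient[of f n x] f by (simp add: ell2)
      have "l * (\<Sum>x\<in>?V. f x) = 0"
        using Laplacian_sum(1)[OF finite_quotient E(1,2), of f] by (simp add: Lf sum_distrib_left)
      then have "(\<Sum>x\<in>?V. f x) = 0" using nin by simp
      note gap'[OF this]
      moreover have "l * of_real (\<Sum>x\<in>?V. (cmod (f x))\<^sup>2) = of_real (\<Sum>(x, y)\<in>?E. (cmod (f x - f y))\<^sup>2) / 2"
      proof -
        have "l * of_real (\<Sum>x\<in>?V. (cmod (f x))\<^sup>2) = (\<Sum>x\<in>?V. l * f x * cnj (f x))"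
          by (simp only: of_real_sum complex_norm_square sum_distrib_left mult.assoc)
        then show ?thesis
          using Laplacian_sum(2)[OF finite_quotient E(1,2), of f] by (simp only: Lf)
      qed
      moreover define A where "A = (\<Sum>x\<in>?V. (cmod (f x))\<^sup>2)"
      moreover define B where "B = (\<Sum>(x, y)\<in>?E. (cmod (f x - f y))\<^sup>2)"
      ultimately have AB: "c * A \<le> B" "l * of_real A = of_real B / 2" by simp_all
      have A0: "0 \<le> A" unfolding A_def by (rule sum_nonneg) simp
      have "A = 0"
      proof (rule ccontr)
        assume "A \<noteq> 0"
        then have "A > 0" using A0 by simp
        then have "l = of_real (B / 2 / A)" using AB(2) by (simp add: field_simps)
        moreover have "B / 2 / A \<in> {c / 2..}" using AB(1) \<open>A > 0\<close> by (simp add: field_simps)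
        ultimately have "l \<in> complex_of_real ` {c / 2..}" by (rule image_eqI)
        then show False using nin by simp
      qed
      then have "\<forall>x\<in>?V. (cmod (f x))\<^sup>2 = 0"
        unfolding A_def by (subst (asm) sum_nonneg_eq_0_iff) (auto simp: finite_quotient)
      then show ?thesis using f by (auto simp: fun_eq_iff)
    qed
    have supp: "\<forall>x. x \<notin> ?V \<longrightarrow> ?T f x = 0" if "\<forall>x. x \<notin> ?V \<longrightarrow> f x = 0" for f
    proof (intro allI impI)
      fix x assume x: "x \<notin> ?V"
      then have "{y. (x, y) \<in> ?E} = {}" using E(1) by auto
      then show "?T f x = 0" using graph_laplacian_quotient[of f n x] that x by (simp add: ell2)
    qed
    have add: "?T (\<lambda>x. f x + g x) = (\<lambda>x. ?T f x + ?T g x)" for f g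
      by (simp add: fun_eq_iff graph_laplacian_def algebra_simps sum.distrib)
    have scale: "?T (\<lambda>x. a * f x) = (\<lambda>x. a * ?T f x)" for a f
      by (simp add: fun_eq_iff graph_laplacian_def algebra_simps sum_distrib_left)
    have "bij_betw ?T (ell2 ?\<G>) (ell2 ?\<G>)"
      unfolding bij_betw_def
    proof
      show "inj_on ?T (ell2 ?\<G>)"
      proof (rule inj_onI)
        fix f g assume fg: "f \<in> ell2 ?\<G>" "g \<in> ell2 ?\<G>" "?T f = ?T g"
        have "?T (\<lambda>x. f x + (- 1) * g x) = (\<lambda>x. ?T f x + ?T (\<lambda>x. (- 1) * g x) x)" by (rule add)
        also have "\<dots> = (\<lambda>x. ?T f x + (- 1) * ?T g x)"
          by (intro ext) (simp only: fun_cong[OF scale[of "- 1" g]])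
        also have "\<dots> = (\<lambda>x. 0)" 
        proof
          fix x show "?T f x + (- 1) * ?T g x = 0" using fun_cong[OF fg(3), of x] by simp
        qed
        finally have z: "?T (\<lambda>x. f x + (- 1) * g x) = (\<lambda>x. 0)" .
        have "(\<lambda>x. f x + (- 1) * g x) = (\<lambda>x. 0)"
          by (rule kernel[OF _ z]) (use fg(1,2) in \<open>simp add: ell2\<close>)
        then show "f = g" by (simp add: fun_eq_iff)
      qed
      show "?T ` ell2 ?\<G> = ell2 ?\<G>"
      proof
        show "?T ` ell2 ?\<G> \<subseteq> ell2 ?\<G>" using supp by (intro image_subsetI) (simp add: ell2)
        show "ell2 ?\<G> \<subseteq> ?T ` ell2 ?\<G>"
        proof
          fix g assume "g \<in> ell2 ?\<G>"
          then have g0: "\<forall>x. x \<notin> ?V \<longrightarrow> g x = 0" by (simp add: ell2)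
          have "\<exists>f. (\<forall>x. x \<notin> ?V \<longrightarrow> f x = 0) \<and> ?T f = g"
          proof (rule injective_operator_surjective[of ?V ?T])
            show "finite ?V" by (rule finite_quotient)
          qed (rule supp, assumption | rule add | rule scale | rule kernel, assumption+ | rule g0)+
          then obtain f where f: "\<forall>x. x \<notin> ?V \<longrightarrow> f x = 0" "?T f = g" by (elim exE conjE)
          show "g \<in> ?T ` ell2 ?\<G>"
            by (rule image_eqI[of _ _ f]) (use f in \<open>simp_all add: ell2\<close>)
        qed
      qed
    qed
    then show False using l by (simp add: laplacian_spectrum_def)
  qed
qed

theorem expander_quotientI:
  assumes "c > 0"
    and "\<And>n f :: 'a set \<Rightarrow> real. (\<Sum>x\<in>carrier (G Mod N n). f x) = 0 \<Longrightarrow>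
      c * (\<Sum>x\<in>carrier (G Mod N n). (f x)\<^sup>2) \<le> (\<Sum>(x, y)\<in>quotient_edges G S (N n). (f x - f y)\<^sup>2)"
  shows "expander (\<lambda>n. quotient_graph G S (N n))"
  unfolding expander_def
proof (intro conjI allI)
  show "pair_graph (quotient_graph G S (N n))" for n by (rule pair_graph_quotient_graph)
  show "Digraph_Component.connected (quotient_graph G S (N n))" for n by (rule connected_quotient_graph)
  show "filterlim (\<lambda>n. card (pverts (quotient_graph G S (N n)))) at_top sequentially"
    using card_quotient_at_top by (simp add: quotient_graph_simps)
  show "\<exists>d. \<forall>n. \<forall>x\<in>pverts (quotient_graph G S (N n)). out_degree (quotient_graph G S (N n)) x \<le> d"
    by (intro exI[of _ "card S"]) (simp add: out_degree_le)
  show "\<exists>c>0. \<forall>n. laplacian_spectrum (quotient_graph G S (N n)) \<subseteq> {0} \<union> complex_of_real ` {c..}"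
  proof (intro exI[of _ "c / 2"] conjI allI)
    show "laplacian_spectrum (quotient_graph G S (N n)) \<subseteq> {0} \<union> complex_of_real ` {c / 2..}" for n
      by (rule laplacian_spectrum_quotient[OF assms])
  qed (use assms(1) in simp)
qed

end

section \<open>Ultrafilters\<close>

definition ultrafilter :: "'i filter \<Rightarrow> bool" where
  "ultrafilter U \<longleftrightarrow> U \<noteq> bot \<and> (\<forall>P. eventually P U \<or> eventually (\<lambda>x. \<not> P x) U)"

text \<open>Along this ultrafilter the ultraproduct reduces to the single space on the
  \<open>n\<close>-th quotient, which is what the proof of expansion uses; a free ultrafilter is
  used only to refute geometric property (T).\<close>

lemma ultrafilter_principal: "ultrafilter (principal {n})"
  by (auto simp: ultrafilter_def eventually_principal principal_eq_bot_iff)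

text \<open>In the order of filters an ultrafilter is a minimal nontrivial one, so Zorn's lemma is
  applied to the reversed order; chains are bounded by their infimum.\<close>

lemma ultrafilter_exists:
  fixes F :: "'i filter"
  assumes "F \<noteq> bot"
  shows "\<exists>U\<le>F. ultrafilter U"
proof -
  let ?A = "{U. U \<noteq> bot \<and> U \<le> F}"
  have po: "partial_order_on ?A (relation_of (\<ge>) ?A)"
    by (auto simp: partial_order_on_def preorder_on_def refl_on_def relation_of_def
        intro!: transI antisymI)
  have "\<exists>m\<in>?A. \<forall>a\<in>?A. m \<ge> a \<longrightarrow> a = m"
  proof (rule predicate_Zorn[OF po])
    fix C assume C: "C \<in> Chains (relation_of (\<ge>) ?A)"
    then have CA: "C \<subseteq> ?A" and total: "\<And>x y. \<lbrakk>x \<in> C; y \<in> C\<rbrakk> \<Longrightarrow> x \<ge> y \<or> y \<ge> x"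
      by (auto simp: Chains_def relation_of_def)
    show "\<exists>u\<in>?A. \<forall>a\<in>C. a \<ge> u"
    proof (cases "C = {}")
      case True
      then show ?thesis using assms by auto
    next
      case False
      have "\<exists>x\<in>C. x \<le> inf a b" if "a \<in> C" "b \<in> C" for a b
        using total[OF that] that by (auto simp: inf_absorb1 inf_absorb2)
      then have "eventually P (Inf C) \<longleftrightarrow> (\<exists>b\<in>C. eventually P b)" for P
        by (rule eventually_Inf_base[OF False])
      then have "Inf C \<noteq> bot" using CA by (auto simp: trivial_limit_def)
      moreover obtain c where "c \<in> C" using False by blast
      moreover have "c \<le> F" using CA \<open>c \<in> C\<close> by auto
      ultimately have "Inf C \<in> ?A" using Inf_lower2[of c C F] by simp
      moreover have "\<forall>a\<in>C. a \<ge> Inf C" by (simp add: Inf_lower)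
      ultimately show ?thesis by (rule bexI[rotated])
    qed
  qed
  then obtain U where U: "U \<noteq> bot" "U \<le> F" and max: "\<And>V. \<lbrakk>V \<noteq> bot; V \<le> F; V \<le> U\<rbrakk> \<Longrightarrow> V = U"
    by auto
  have "eventually P U \<or> eventually (\<lambda>x. \<not> P x) U" for P
  proof (cases "eventually (\<lambda>x. \<not> P x) U")
    case False
    \<comment> \<open>If the negation of \<open>P\<close> does not hold eventually, then restricting
      the filter to \<open>P\<close> keeps it nontrivial, and minimality shows that nothing has
      changed.\<close>
    let ?V = "inf U (principal {x. P x})"
    have "?V \<noteq> bot" using False by (auto simp: trivial_limit_def eventually_inf_principal)
    then have VU: "?V = U" using U by (intro max) (auto intro: le_infI1)
    have "eventually P ?V" by (simp add: eventually_inf_principal)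
    then have "eventually P U" unfolding VU .
    then show ?thesis ..
  qed simp
  then show ?thesis using U by (auto simp: ultrafilter_def)
qed

text \<open>Compactness provides a cluster point, and along an ultrafilter a cluster point is a
  limit.\<close>

lemma ultrafilter_bounded_tendsto:
  fixes f :: "'i \<Rightarrow> 'b::heine_borel"
  assumes U: "ultrafilter U" and bdd: "bounded (range f)"
  shows "(f \<longlongrightarrow> Lim U f) U"
proof -
  let ?K = "closure (range f)"
  have "compact ?K" using bdd by (simp add: compact_eq_bounded_closed bounded_closure)
  then have K: "\<And>F. \<lbrakk>F \<noteq> bot; eventually (\<lambda>x. x \<in> ?K) F\<rbrakk> \<Longrightarrow> \<exists>x\<in>?K. inf (nhds x) F \<noteq> bot"
    unfolding compact_filter by simp
  have nb: "filtermap f U \<noteq> bot" using U by (simp add: ultrafilter_def filtermap_bot_iff)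
  have "eventually (\<lambda>x. x \<in> ?K) (filtermap f U)"
    unfolding eventually_filtermap using closure_subset[of "range f"]
    by (intro always_eventually) auto
  then obtain l where l: "inf (nhds l) (filtermap f U) \<noteq> bot"
    using K[OF nb] by auto
  have "(f \<longlongrightarrow> l) U"
  proof (rule topological_tendstoI)
    fix S assume S: "open S" "l \<in> S"
    show "eventually (\<lambda>i. f i \<in> S) U"
    proof (rule ccontr)
      assume "\<not> ?thesis"
      then have "eventually (\<lambda>i. f i \<notin> S) U" using U by (auto simp: ultrafilter_def)
      then have "eventually (\<lambda>x. x \<notin> S) (filtermap f U)" by (simp add: eventually_filtermap)
      moreover have "eventually (\<lambda>x. x \<in> S) (nhds l)" using S by (auto simp: eventually_nhds)
      ultimately have "eventually (\<lambda>x. False) (inf (nhds l) (filtermap f U))"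
        unfolding eventually_inf by blast
      then show False using l by (simp add: trivial_limit_def)
    qed
  qed
  then show ?thesis using U tendsto_Lim by (metis ultrafilter_def)
qed

section \<open>The Hilbert space of a complete semi-inner product\<close>

locale semi_inner =
  fixes B :: "('p \<Rightarrow> complex) set" and ip :: "('p \<Rightarrow> complex) \<Rightarrow> ('p \<Rightarrow> complex) \<Rightarrow> complex"
  assumes B_zero: "(\<lambda>p. 0) \<in> B"
    and B_add: "\<lbrakk>f \<in> B; g \<in> B\<rbrakk> \<Longrightarrow> (\<lambda>p. f p + g p) \<in> B"
    and B_scale: "f \<in> B \<Longrightarrow> (\<lambda>p. a * f p) \<in> B"
    and ip_add: "\<lbrakk>f \<in> B; g \<in> B; h \<in> B\<rbrakk> \<Longrightarrow> ip (\<lambda>p. f p + g p) h = ip f h + ip g h"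
    and ip_scale: "\<lbrakk>f \<in> B; h \<in> B\<rbrakk> \<Longrightarrow> ip (\<lambda>p. a * f p) h = a * ip f h"
    and ip_cnj: "\<lbrakk>f \<in> B; h \<in> B\<rbrakk> \<Longrightarrow> ip f h = cnj (ip h f)"
    and ip_nonneg: "f \<in> B \<Longrightarrow> Re (ip f f) \<ge> 0"
begin

lemma ip_add': "\<lbrakk>f \<in> B; g \<in> B; h \<in> B\<rbrakk> \<Longrightarrow> ip h (\<lambda>p. f p + g p) = ip h f + ip h g"
  by (subst ip_cnj) (auto simp: B_add ip_add ip_cnj[of h])

lemma ip_scale': "\<lbrakk>f \<in> B; h \<in> B\<rbrakk> \<Longrightarrow> ip h (\<lambda>p. a * f p) = cnj a * ip h f"
  by (subst ip_cnj) (auto simp: B_scale ip_scale ip_cnj[of h])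

lemma B_diff: "\<lbrakk>f \<in> B; g \<in> B\<rbrakk> \<Longrightarrow> (\<lambda>p. f p - g p) \<in> B"
  using B_add[OF _ B_scale[of g "- 1"], of f] by simp

lemma ip_diff: "\<lbrakk>f \<in> B; g \<in> B; h \<in> B\<rbrakk> \<Longrightarrow> ip (\<lambda>p. f p - g p) h = ip f h - ip g h"
  using ip_add[OF _ B_scale[of g "- 1"], of f h] ip_scale[of g h "- 1"] by simp

lemma ip_diff': "\<lbrakk>f \<in> B; g \<in> B; h \<in> B\<rbrakk> \<Longrightarrow> ip h (\<lambda>p. f p - g p) = ip h f - ip h g"
  using ip_add'[OF _ B_scale[of g "- 1"], of f h] ip_scale'[of g h "- 1"] by simp

lemma ip_zero: "h \<in> B \<Longrightarrow> ip (\<lambda>p. 0) h = 0"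
  using ip_scale[OF B_zero, of h 0] by simp

definition snorm :: "('p \<Rightarrow> complex) \<Rightarrow> real" where
  "snorm f = sqrt (Re (ip f f))"

lemma snorm_nonneg: "f \<in> B \<Longrightarrow> 0 \<le> snorm f"
  by (simp add: snorm_def ip_nonneg)

lemma snorm_power2: "f \<in> B \<Longrightarrow> (snorm f)\<^sup>2 = Re (ip f f)"
  by (simp add: snorm_def ip_nonneg)

lemma ip_Cauchy_Schwarz:
  assumes f: "f \<in> B" and g: "g \<in> B"
  shows "cmod (ip f g) \<le> snorm f * snorm g"
proof -
  \<comment> \<open>A phase that makes \<open>u * ip f g\<close> a nonnegative real, so that the
    quadratic polynomial in the real variable \<open>t\<close> controls the modulus.\<close>
  define u where "u = (if ip f g = 0 then 1 else cnj (ip f g) / of_real (cmod (ip f g)))"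
  have u: "u * ip f g = of_real (cmod (ip f g))" "cmod u = 1"
    by (auto simp: u_def norm_divide complex_norm_square[symmetric] power2_eq_square mult.commute)
  let ?a = "Re (ip f f)" and ?b = "cmod (ip f g)" and ?c = "Re (ip g g)"
  have *: "0 \<le> ?a + 2 * t * ?b + t\<^sup>2 * ?c" for t :: real
  proof -
    let ?h = "\<lambda>p. u * f p + of_real t * g p"
    have uf: "(\<lambda>p. u * f p) \<in> B" and tg: "(\<lambda>p. of_real t * g p) \<in> B" using f g by (auto intro: B_scale)
    have "ip ?h ?h = u * cnj u * ip f f + of_real t * (u * ip f g) + of_real t * cnj (u * ip f g) + of_real (t\<^sup>2) * ip g g"
      using f g uf tg B_add[OF uf tg]
      by (simp add: ip_add ip_add' ip_scale ip_scale' ip_cnj[OF g f] algebra_simps power2_eq_square)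
    moreover have "u * cnj u = 1" using u(2) complex_norm_square[of u] by simp
    ultimately have "Re (ip ?h ?h) = ?a + 2 * t * ?b + t\<^sup>2 * ?c"
      unfolding u(1) by simp
    then show ?thesis using ip_nonneg[OF B_add[OF uf tg]] by simp
  qed
  have "?b\<^sup>2 \<le> ?a * ?c"
  proof (cases "?c = 0")
    case True
    have "?b = 0"
    proof (rule ccontr)
      assume b: "?b \<noteq> 0"
      have "0 \<le> ?a + 2 * (- (?a + 1) / (2 * ?b)) * ?b"
        using *[of "- (?a + 1) / (2 * ?b)"] True by simp
      also have "\<dots> = - 1" using b by (simp add: field_simps)
      finally show False by simp
    qed
    then show ?thesis using True by simp
  next
    case False
    then have c: "?c > 0" using ip_nonneg[OF g] by simp
    have "0 \<le> ?a + 2 * (- ?b / ?c) * ?b + (- ?b / ?c)\<^sup>2 * ?c" by (rule *)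
    also have "\<dots> = ?a - ?b\<^sup>2 / ?c" using c by (simp add: field_simps power2_eq_square)
    finally show ?thesis using c by (simp add: pos_divide_le_eq)
  qed
  then have "?b\<^sup>2 \<le> (snorm f * snorm g)\<^sup>2"
    using f g by (simp add: power_mult_distrib snorm_power2)
  then show ?thesis by (rule power2_le_imp_le) (use f g snorm_nonneg in simp)
qed

lemma snorm_triangle:
  assumes f: "f \<in> B" and g: "g \<in> B"
  shows "snorm (\<lambda>p. f p + g p) \<le> snorm f + snorm g"
proof (rule power2_le_imp_le)
  have "Re (ip f g) \<le> snorm f * snorm g"
    using ip_Cauchy_Schwarz[OF f g] complex_Re_le_cmod order_trans by blast
  moreover have "(snorm (\<lambda>p. f p + g p))\<^sup>2 = Re (ip f f) + 2 * Re (ip f g) + Re (ip g g)"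
    using f g by (simp add: snorm_power2 B_add ip_add ip_add' ip_cnj[OF g f])
  ultimately show "(snorm (\<lambda>p. f p + g p))\<^sup>2 \<le> (snorm f + snorm g)\<^sup>2"
    using snorm_power2[OF f] snorm_power2[OF g] by (simp add: power2_eq_square algebra_simps)
qed (use snorm_nonneg[OF f] snorm_nonneg[OF g] in simp)

lemma snorm_minus_commute:
  assumes "f \<in> B" "g \<in> B"
  shows "snorm (\<lambda>p. f p - g p) = snorm (\<lambda>p. g p - f p)"
  using assms by (simp add: snorm_def ip_diff ip_diff' B_diff algebra_simps)

lemma snorm_triangle_diff:
  assumes "f \<in> B" "g \<in> B" "h \<in> B"
  shows "snorm (\<lambda>p. f p - h p) \<le> snorm (\<lambda>p. f p - g p) + snorm (\<lambda>p. g p - h p)"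
  using snorm_triangle[OF B_diff[OF assms(1,2)] B_diff[OF assms(2,3)]] by simp

lemma snorm_eq_0_ip: "\<lbrakk>f \<in> B; g \<in> B; snorm f = 0\<rbrakk> \<Longrightarrow> ip f g = 0"
  using ip_Cauchy_Schwarz[of f g] by simp

text \<open>Instead of passing to equivalence classes modulo the null vectors, the Hilbert space consists
  of chosen representatives.\<close>

definition nf :: "('p \<Rightarrow> complex) \<Rightarrow> 'p \<Rightarrow> complex" where
  "nf f = (SOME g. g \<in> B \<and> (\<forall>h\<in>B. ip g h = ip f h))"

lemma nf:
  assumes "f \<in> B"
  shows "nf f \<in> B" and "h \<in> B \<Longrightarrow> ip (nf f) h = ip f h"
  using someI[of "\<lambda>g. g \<in> B \<and> (\<forall>h\<in>B. ip g h = ip f h)" f] assms by (auto simp: nf_def)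

lemma nf': "\<lbrakk>f \<in> B; h \<in> B\<rbrakk> \<Longrightarrow> ip h (nf f) = ip h f"
  using nf(2)[of f h] ip_cnj[of h f] ip_cnj[of h "nf f"] nf(1) by simp

text \<open>The choice in \<open>nf\<close> sees \<open>f\<close> only through the functional
  \<open>ip f\<close> on \<open>B\<close>. Vectors with the same functional, that is, vectors
  differing by a null vector, therefore get literally the same representative.\<close>

lemma nf_eqI: "(\<And>h. h \<in> B \<Longrightarrow> ip f h = ip g h) \<Longrightarrow> nf f = nf g"
  by (simp add: nf_def)

definition hilb :: "('p \<Rightarrow> complex) hilbert" where
  "hilb = \<lparr>carrier = nf ` B, mult = undefined, one = undefined, zero = nf (\<lambda>p. 0),
     add = (\<lambda>f g. nf (\<lambda>p. f p + g p)), smult = (\<lambda>a f. nf (\<lambda>p. a * f p)), cinner = ip\<rparr>"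

lemma hilb_simps [simp]:
  "carrier hilb = nf ` B" "\<zero>\<^bsub>hilb\<^esub> = nf (\<lambda>p. 0)"
  "f \<oplus>\<^bsub>hilb\<^esub> g = nf (\<lambda>p. f p + g p)" "a \<odot>\<^bsub>hilb\<^esub> f = nf (\<lambda>p. a * f p)" "cinner hilb = ip"
  by (simp_all add: hilb_def)

lemma hilb_carrier: "f \<in> nf ` B \<Longrightarrow> f \<in> B"
  using nf(1) by blast

lemma hilb_eqI:
  "\<lbrakk>f \<in> nf ` B; g \<in> nf ` B; \<And>h. h \<in> B \<Longrightarrow> ip f h = ip g h\<rbrakk> \<Longrightarrow> f = g"
  using nf nf_eqI by (metis (no_types, lifting) imageE)

lemma hilb_hnorm: "hnorm hilb f = snorm f"
  by (simp add: hnorm_def snorm_def)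

lemma cring_complex_ring: "cring complex_ring"
proof (rule cringI)
  show "abelian_group complex_ring"
  proof (rule abelian_groupI)
    fix x assume "x \<in> carrier complex_ring"
    show "\<exists>y\<in>carrier complex_ring. y \<oplus>\<^bsub>complex_ring\<^esub> x = \<zero>\<^bsub>complex_ring\<^esub>"
      by (rule bexI[of _ "- x"]) (simp_all add: complex_ring_def)
  qed (simp_all add: complex_ring_def)
  show "Group.comm_monoid complex_ring"
    by (rule comm_monoidI) (simp_all add: complex_ring_def)
qed (simp add: complex_ring_def algebra_simps)

lemma module_hilb: "module complex_ring hilb"
proof (rule moduleI[OF cring_complex_ring])
  show "abelian_group hilb"
  proof (rule abelian_groupI)
    fix f assume "f \<in> carrier hilb"
    then have f: "f \<in> B" by (simp add: hilb_carrier)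
    have m: "(\<lambda>p. - 1 * f p) \<in> B" by (rule B_scale[OF f])
    have "nf (\<lambda>p. nf (\<lambda>p. - 1 * f p) p + f p) = nf (\<lambda>p. 0)"
      by (rule nf_eqI) (simp only: ip_add nf[OF m] f ip_scale[OF f] ip_zero, simp)
    then show "\<exists>g\<in>carrier hilb. g \<oplus>\<^bsub>hilb\<^esub> f = \<zero>\<^bsub>hilb\<^esub>"
      using m by (intro bexI[of _ "nf (\<lambda>p. - 1 * f p)"]) simp_all
  next
    fix f assume "f \<in> carrier hilb"
    then show "\<zero>\<^bsub>hilb\<^esub> \<oplus>\<^bsub>hilb\<^esub> f = f"
      by (intro hilb_eqI) (auto simp: hilb_carrier nf B_add B_zero ip_add ip_zero)
  next
    fix f g h assume "f \<in> carrier hilb" "g \<in> carrier hilb" "h \<in> carrier hilb"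
    then have "f \<in> B" "g \<in> B" "h \<in> B" by (simp_all add: hilb_carrier)
    then show "f \<oplus>\<^bsub>hilb\<^esub> g \<oplus>\<^bsub>hilb\<^esub> h = f \<oplus>\<^bsub>hilb\<^esub> (g \<oplus>\<^bsub>hilb\<^esub> h)"
      by (simp, intro nf_eqI) (simp add: nf B_add ip_add)
    show "f \<oplus>\<^bsub>hilb\<^esub> g = g \<oplus>\<^bsub>hilb\<^esub> f" by (simp add: add.commute)
  qed (auto simp: hilb_carrier B_add B_zero)
next
  fix a b f assume "f \<in> carrier hilb"
  then have f: "f \<in> B" "f \<in> nf ` B" by (simp_all add: hilb_carrier)
  show "a \<odot>\<^bsub>hilb\<^esub> f \<in> carrier hilb" using f by (simp add: B_scale)
  show "(a \<oplus>\<^bsub>complex_ring\<^esub> b) \<odot>\<^bsub>hilb\<^esub> f = a \<odot>\<^bsub>hilb\<^esub> f \<oplus>\<^bsub>hilb\<^esub> b \<odot>\<^bsub>hilb\<^esub> f"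
    using f by (simp add: complex_ring_def, intro nf_eqI) (simp add: nf B_scale ip_add ip_scale algebra_simps)
  show "(a \<otimes>\<^bsub>complex_ring\<^esub> b) \<odot>\<^bsub>hilb\<^esub> f = a \<odot>\<^bsub>hilb\<^esub> (b \<odot>\<^bsub>hilb\<^esub> f)"
    using f by (simp add: complex_ring_def, intro nf_eqI) (simp add: nf B_scale ip_scale)
  show "\<one>\<^bsub>complex_ring\<^esub> \<odot>\<^bsub>hilb\<^esub> f = f"
    by (rule hilb_eqI) (use f in \<open>simp_all add: complex_ring_def nf\<close>)
  fix g assume "g \<in> carrier hilb"
  then have g: "g \<in> B" by (simp add: hilb_carrier)
  show "a \<odot>\<^bsub>hilb\<^esub> (f \<oplus>\<^bsub>hilb\<^esub> g) = a \<odot>\<^bsub>hilb\<^esub> f \<oplus>\<^bsub>hilb\<^esub> a \<odot>\<^bsub>hilb\<^esub> g"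
    using f(1) g by (simp, intro nf_eqI) (simp add: nf B_add B_scale ip_add ip_scale algebra_simps)
qed

lemma hilb_minus:
  assumes f: "f \<in> carrier hilb" and g: "g \<in> carrier hilb"
  shows "f \<ominus>\<^bsub>hilb\<^esub> g = nf (\<lambda>p. f p - g p)"
proof -
  interpret module complex_ring hilb by (rule module_hilb)
  have B: "f \<in> B" "g \<in> B" using f g by (simp_all add: hilb_carrier)
  have m: "(\<lambda>p. - 1 * g p) \<in> B" by (rule B_scale[OF B(2)])
  have "nf (\<lambda>p. nf (\<lambda>p. - 1 * g p) p + g p) = nf (\<lambda>p. 0)"
    by (rule nf_eqI) (simp only: ip_add nf[OF m] B ip_scale[OF B(2)] ip_zero, simp)
  then have "\<ominus>\<^bsub>hilb\<^esub> g = nf (\<lambda>p. - 1 * g p)"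
    using g m by (intro M.minus_equality) simp_all
  then have "f \<ominus>\<^bsub>hilb\<^esub> g = nf (\<lambda>p. f p + nf (\<lambda>p. - 1 * g p) p)" by (simp add: a_minus_def)
  also have "\<dots> = nf (\<lambda>p. f p - g p)"
    by (rule nf_eqI) (simp only: ip_add nf[OF m] B ip_scale[OF B(2)] ip_diff[OF B], simp)
  finally show ?thesis .
qed

lemma snorm_nf: "f \<in> B \<Longrightarrow> snorm (nf f) = snorm f"
  by (simp add: snorm_def nf nf')

lemma snorm_nf_diff:
  "\<lbrakk>f \<in> B; g \<in> B\<rbrakk> \<Longrightarrow> snorm (\<lambda>p. f p - nf g p) = snorm (\<lambda>p. f p - g p)"
  by (simp add: snorm_def nf nf' B_diff ip_diff ip_diff')

end

locale complete_semi_inner = semi_inner +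
  assumes complete: "\<lbrakk>\<And>n::nat. \<sigma> n \<in> B;
      \<And>e. e > 0 \<Longrightarrow> \<exists>N. \<forall>m\<ge>N. \<forall>n\<ge>N. snorm (\<lambda>p. \<sigma> m p - \<sigma> n p) < e\<rbrakk>
      \<Longrightarrow> \<exists>l\<in>B. (\<lambda>n. snorm (\<lambda>p. \<sigma> n p - l p)) \<longlonglongrightarrow> 0"
begin

lemma hilbert_space_hilb: "hilbert_space hilb"
proof (intro hilbert_space.intro hilbert_space_axioms.intro module_hilb)
  fix x assume x: "x \<in> carrier hilb" "x \<noteq> \<zero>\<^bsub>hilb\<^esub>"
  then have xB: "x \<in> B" by (simp add: hilb_carrier)
  have "Re (ip x x) \<noteq> 0"
  proof
    assume "Re (ip x x) = 0"
    then have "snorm x = 0" by (simp add: snorm_def)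
    then have "x = nf (\<lambda>p. 0)"
      using x xB by (intro hilb_eqI) (auto simp: snorm_eq_0_ip B_zero nf ip_zero)
    then show False using x by simp
  qed
  then show "0 < Re (cinner hilb x x)" using ip_nonneg[OF xB] by simp
next
  fix \<sigma> :: "nat \<Rightarrow> 'a \<Rightarrow> complex"
  assume \<sigma>: "range \<sigma> \<subseteq> carrier hilb"
    and C: "\<forall>e>0. \<exists>N. \<forall>m\<ge>N. \<forall>n\<ge>N. hnorm hilb (\<sigma> m \<ominus>\<^bsub>hilb\<^esub> \<sigma> n) < e"
  have \<sigma>': "\<sigma> n \<in> nf ` B" "\<sigma> n \<in> B" for n using \<sigma> hilb_carrier by auto
  have "\<exists>N. \<forall>m\<ge>N. \<forall>n\<ge>N. snorm (\<lambda>p. \<sigma> m p - \<sigma> n p) < e" if "e > 0" for e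
    using C that \<sigma>' by (simp add: hilb_minus hilb_hnorm snorm_nf B_diff)
  then obtain l where l: "l \<in> B" "(\<lambda>n. snorm (\<lambda>p. \<sigma> n p - l p)) \<longlonglongrightarrow> 0"
    using complete[of \<sigma>] \<sigma>' by blast
  then show "\<exists>l\<in>carrier hilb. (\<lambda>n. hnorm hilb (\<sigma> n \<ominus>\<^bsub>hilb\<^esub> l)) \<longlonglongrightarrow> 0"
    using \<sigma>' by (intro bexI[of _ "nf l"])
      (simp_all add: hilb_minus hilb_hnorm snorm_nf snorm_nf_diff B_diff nf)
qed (auto simp: hilb_carrier nf B_add B_scale ip_add ip_scale intro: ip_cnj)

end

section \<open>Ultraproducts of finite-dimensional Hilbert spaces\<close>

locale ultraproduct =
  fixes V :: "nat \<Rightarrow> 'v set" and U :: "nat filter"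
  assumes finite_V: "finite (V n)" and V_nonempty: "V n \<noteq> {}" and ultra: "ultrafilter U"
begin

text \<open>Normalized counting measure, so that the constant function 1 has norm 1 on every level
  and hence in the ultraproduct.\<close>

definition loc :: "nat \<Rightarrow> (nat \<times> 'v \<Rightarrow> complex) \<Rightarrow> (nat \<times> 'v \<Rightarrow> complex) \<Rightarrow> complex" where
  "loc n f g = (\<Sum>x\<in>V n. f (n, x) * cnj (g (n, x))) / of_nat (card (V n))"

lemma card_V_pos: "card (V n) > 0"
  using finite_V V_nonempty by (simp add: card_gt_0_iff)

lemma loc_cong:
  "\<lbrakk>\<And>x. x \<in> V n \<Longrightarrow> f (n, x) = f' (n, x); \<And>x. x \<in> V n \<Longrightarrow> g (n, x) = g' (n, x)\<rbrakk> \<Longrightarrow> loc n f g = loc n f' g'"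
  by (simp add: loc_def)

lemma loc_self: "loc n f f = of_real ((\<Sum>x\<in>V n. (cmod (f (n, x)))\<^sup>2) / real (card (V n)))"
  by (simp only: loc_def complex_norm_square[symmetric]) simp

sublocale L: semi_inner UNIV "loc n" for n
proof
  show "loc n f h = cnj (loc n h f)" for f h
    by (simp add: loc_def mult.commute)
  show "0 \<le> Re (loc n f f)" for f
    unfolding loc_self by (simp add: sum_nonneg)
qed (simp_all add: loc_def algebra_simps sum.distrib add_divide_distrib sum_distrib_left)

lemma lsnorm_power2: "(L.snorm n f)\<^sup>2 = (\<Sum>x\<in>V n. (cmod (f (n, x)))\<^sup>2) / real (card (V n))"
  by (simp add: L.snorm_power2 loc_self del: of_real_divide of_real_sum)

lemma lsnorm_cong: "(\<And>x. x \<in> V n \<Longrightarrow> f (n, x) = g (n, x)) \<Longrightarrow> L.snorm n f = L.snorm n g"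
  by (simp add: L.snorm_def loc_cong[of n f g f g])

lemma lsnorm_zero: "L.snorm n (\<lambda>p. 0) = 0"
  by (simp add: L.snorm_def loc_def)

lemma cmod_le_lsnorm:
  assumes "x \<in> V n"
  shows "cmod (f (n, x)) \<le> sqrt (real (card (V n))) * L.snorm n f"
proof (rule power2_le_imp_le)
  have "(cmod (f (n, x)))\<^sup>2 \<le> (\<Sum>x\<in>V n. (cmod (f (n, x)))\<^sup>2)"
    using assms finite_V by (intro member_le_sum) auto
  then show "(cmod (f (n, x)))\<^sup>2 \<le> (sqrt (real (card (V n))) * L.snorm n f)\<^sup>2"
    using card_V_pos[of n] by (simp add: power_mult_distrib lsnorm_power2)
qed (simp add: L.snorm_nonneg)

definition bdd :: "(nat \<times> 'v \<Rightarrow> complex) set" where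
  "bdd = {f. \<exists>K. \<forall>n. L.snorm n f \<le> K}"

definition uip :: "(nat \<times> 'v \<Rightarrow> complex) \<Rightarrow> (nat \<times> 'v \<Rightarrow> complex) \<Rightarrow> complex" where
  "uip f g = Lim U (\<lambda>n. loc n f g)"

lemma U_nontrivial: "U \<noteq> bot"
  using ultra by (simp add: ultrafilter_def)

lemma loc_tendsto:
  assumes "f \<in> bdd" "g \<in> bdd"
  shows "((\<lambda>n. loc n f g) \<longlongrightarrow> uip f g) U"
proof -
  obtain K M where K: "\<And>n. L.snorm n f \<le> K" and M: "\<And>n. L.snorm n g \<le> M"
    using assms by (auto simp: bdd_def)
  have "cmod (loc n f g) \<le> K * M" for n
  proof -
    have "cmod (loc n f g) \<le> L.snorm n f * L.snorm n g" by (rule L.ip_Cauchy_Schwarz) auto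
    also have "\<dots> \<le> K * M"
      using K[of n] M[of n] L.snorm_nonneg[of f n] L.snorm_nonneg[of g n] by (intro mult_mono) auto
    finally show ?thesis .
  qed
  then have "bounded (range (\<lambda>n. loc n f g))" by (auto simp: bounded_iff)
  from ultrafilter_bounded_tendsto[OF ultra this] show ?thesis by (simp add: uip_def)
qed

lemma uip_eqI: "\<lbrakk>f \<in> bdd; g \<in> bdd; ((\<lambda>n. loc n f g) \<longlongrightarrow> l) U\<rbrakk> \<Longrightarrow> uip f g = l"
  using tendsto_unique[OF U_nontrivial loc_tendsto] by blast

lemma bddI: "(\<And>n. L.snorm n f \<le> K) \<Longrightarrow> f \<in> bdd"
  by (auto simp: bdd_def)

lemma bdd_add: "\<lbrakk>f \<in> bdd; g \<in> bdd\<rbrakk> \<Longrightarrow> (\<lambda>p. f p + g p) \<in> bdd"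
proof -
  assume "f \<in> bdd" "g \<in> bdd"
  then obtain K M where K: "\<And>n. L.snorm n f \<le> K" and M: "\<And>n. L.snorm n g \<le> M" by (auto simp: bdd_def)
  have "L.snorm n (\<lambda>p. f p + g p) \<le> K + M" for n
    by (rule order_trans[OF L.snorm_triangle add_mono[OF K M]]) auto
  then show ?thesis by (rule bddI)
qed

lemma lsnorm_scale: "L.snorm n (\<lambda>p. a * f p) = cmod a * L.snorm n f"
proof -
  have "Re (loc n (\<lambda>p. a * f p) (\<lambda>p. a * f p)) = (cmod a)\<^sup>2 * Re (loc n f f)"
    unfolding loc_self
    by (simp add: norm_mult power_mult_distrib sum_distrib_left[symmetric] del: of_real_divide of_real_sum of_real_mult)
  then show ?thesis by (simp add: L.snorm_def real_sqrt_mult)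
qed

lemma bdd_scale: "f \<in> bdd \<Longrightarrow> (\<lambda>p. a * f p) \<in> bdd"
proof -
  assume "f \<in> bdd"
  then obtain K where "\<And>n. L.snorm n f \<le> K" by (auto simp: bdd_def)
  then have "L.snorm n (\<lambda>p. a * f p) \<le> cmod a * K" for n
    unfolding lsnorm_scale by (rule mult_left_mono) simp
  then show ?thesis by (rule bddI)
qed

sublocale semi_inner bdd uip
proof
  show "(\<lambda>p. 0) \<in> bdd" by (rule bddI[of _ 0]) (simp add: L.snorm_def loc_def)
  show "uip (\<lambda>p. f p + g p) h = uip f h + uip g h" if "f \<in> bdd" "g \<in> bdd" "h \<in> bdd" for f g h
    using tendsto_add[OF loc_tendsto[OF that(1,3)] loc_tendsto[OF that(2,3)]] that
    by (intro uip_eqI) (simp_all add: bdd_add L.ip_add)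
  show "uip (\<lambda>p. a * f p) h = a * uip f h" if "f \<in> bdd" "h \<in> bdd" for a f h
    using tendsto_mult_left[OF loc_tendsto[OF that]] that
    by (intro uip_eqI) (simp_all add: bdd_scale L.ip_scale)
  show "uip f h = cnj (uip h f)" if "f \<in> bdd" "h \<in> bdd" for f h
  proof (rule uip_eqI[OF that])
    have eq: "(\<lambda>n. loc n f h) = (\<lambda>n. cnj (loc n h f))" by (rule ext, rule L.ip_cnj) simp_all
    show "((\<lambda>n. loc n f h) \<longlongrightarrow> cnj (uip h f)) U"
      unfolding eq by (rule tendsto_cnj[OF loc_tendsto[OF that(2,1)]])
  qed
  show "0 \<le> Re (uip f f)" if "f \<in> bdd" for f
    by (rule tendsto_lowerbound[OF tendsto_Re[OF loc_tendsto[OF that that]] _ U_nontrivial])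
      (simp add: L.ip_nonneg)
qed (auto intro: bdd_add bdd_scale)

lemma snorm_tendsto: "f \<in> bdd \<Longrightarrow> ((\<lambda>n. L.snorm n f) \<longlongrightarrow> snorm f) U"
  unfolding snorm_def L.snorm_def by (intro tendsto_real_sqrt tendsto_Re loc_tendsto)

lemma snorm_le: "\<lbrakk>f \<in> bdd; eventually (\<lambda>n. L.snorm n f \<le> c) U\<rbrakk> \<Longrightarrow> snorm f \<le> c"
  by (rule tendsto_upperbound[OF snorm_tendsto _ U_nontrivial])

sublocale complete_semi_inner bdd uip
proof
  fix \<sigma> :: "nat \<Rightarrow> nat \<times> 'v \<Rightarrow> complex"
  assume \<sigma>: "\<And>n. \<sigma> n \<in> bdd"
    and C: "\<And>e. e > 0 \<Longrightarrow> \<exists>N. \<forall>m\<ge>N. \<forall>n\<ge>N. snorm (\<lambda>p. \<sigma> m p - \<sigma> n p) < e"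
  have "\<forall>j::nat. \<exists>N. \<forall>m\<ge>N. \<forall>n\<ge>N. snorm (\<lambda>p. \<sigma> m p - \<sigma> n p) < (1 / 2) ^ j"
    using C by simp
  then obtain N where N: "\<And>j m n. \<lbrakk>m \<ge> N j; n \<ge> N j\<rbrakk> \<Longrightarrow> snorm (\<lambda>p. \<sigma> m p - \<sigma> n p) < (1 / 2) ^ j"
    by metis
  \<comment> \<open>Partial sums make the chosen indices nondecreasing while keeping each of them at
    least \<open>N j\<close>.\<close>
  define k where "k j = (\<Sum>i\<le>j. N i)" for j
  have k: "N j \<le> k j" "k j \<le> k (Suc j)" for j
    unfolding k_def by (auto intro: member_le_sum)
  define g where "g j = \<sigma> (k j)" for j
  have g: "g j \<in> bdd" for j by (simp add: g_def \<sigma>)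
  define E where "E j = {n. L.snorm n (\<lambda>p. g j p - g (Suc j) p) < (1 / 2) ^ j}" for j :: nat
  have E: "eventually (\<lambda>n. n \<in> E j) U" for j
  proof -
    have "snorm (\<lambda>p. g j p - g (Suc j) p) < (1 / 2) ^ j"
      unfolding g_def using k[of j] by (intro N) auto
    then show ?thesis unfolding E_def using order_tendstoD(2)[OF snorm_tendsto[OF B_diff[OF g g]]] by simp
  qed
  define good where "good j n \<longleftrightarrow> (\<forall>i\<le>j. n \<in> E i)" for j n :: nat
  \<comment> \<open>Level \<open>n\<close> follows \<open>g\<close> as long as \<open>n\<close> has
    stayed in all the sets \<open>E i\<close>; at the first failure it keeps its value from then on,
    since \<open>good\<close> requires all earlier sets too.\<close>
  define h where "h = rec_nat (g 0) (\<lambda>j r p. if good j (fst p) then g (Suc j) p else r p)"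
  have h0: "h 0 = g 0" and hS: "h (Suc j) (n, x) = (if good j n then g (Suc j) (n, x) else h j (n, x))" for j n x
    by (simp_all add: h_def)
  have hg: "h j (n, x) = g j (n, x)" if "\<forall>i<j. n \<in> E i" for j n x
    using that by (cases j) (auto simp: h0 hS good_def less_Suc_eq_le)
  have step: "L.snorm n (\<lambda>p. h j p - h (Suc j) p) \<le> (1 / 2) ^ j" for n j
  proof (cases "good j n")
    case True
    then have "L.snorm n (\<lambda>p. h j p - h (Suc j) p) = L.snorm n (\<lambda>p. g j p - g (Suc j) p)"
      by (intro lsnorm_cong) (auto simp: hS hg good_def)
    then show ?thesis using True by (auto simp: good_def E_def intro: less_imp_le)
  next
    case False
    then have "L.snorm n (\<lambda>p. h j p - h (Suc j) p) = L.snorm n (\<lambda>p. 0)"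
      by (intro lsnorm_cong) (auto simp: hS)
    then show ?thesis by (simp only: lsnorm_zero) simp
  qed
  have conv: "convergent (\<lambda>j. h j (n, x))" if x: "x \<in> V n" for n x
  proof -
    have bound: "norm (h (Suc j) (n, x) - h j (n, x)) \<le> sqrt (real (card (V n))) * (1 / 2) ^ j" for j
    proof -
      have "cmod (h j (n, x) - h (Suc j) (n, x)) \<le> sqrt (real (card (V n))) * L.snorm n (\<lambda>p. h j p - h (Suc j) p)"
        by (rule cmod_le_lsnorm[OF x])
      also have "\<dots> \<le> sqrt (real (card (V n))) * (1 / 2) ^ j"
        by (intro mult_left_mono step) simp
      finally show ?thesis by (simp add: norm_minus_commute)
    qed
    have "summable (\<lambda>j. sqrt (real (card (V n))) * (1 / 2) ^ j)"
      by (intro summable_mult summable_geometric) simp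
    then have "summable (\<lambda>j. h (Suc j) (n, x) - h j (n, x))"
      by (rule summable_comparison_test'[where N = 0]) (rule bound)
    then have "convergent (\<lambda>m. \<Sum>j<m. h (Suc j) (n, x) - h j (n, x))"
      by (simp add: summable_iff_convergent)
    then have "convergent (\<lambda>m. h m (n, x) - h 0 (n, x))" 
      by (simp only: sum_lessThan_telescope[of "\<lambda>j. h j (n, x)"])
    from convergent_add[OF this convergent_const[of "h 0 (n, x)"]] show ?thesis by simp
  qed
  define l where "l p = lim (\<lambda>j. h j p)" for p
  have lim: "(\<lambda>j. h j (n, x)) \<longlonglongrightarrow> l (n, x)" if "x \<in> V n" for n x
    using conv[OF that] by (simp add: l_def convergent_LIMSEQ_iff)
  have hm: "L.snorm n (\<lambda>p. h j p - h (j + m) p) \<le> 2 * (1 / 2) ^ j - 2 * (1 / 2) ^ (j + m)" for n j m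
  proof (induction m)
    case 0
    then show ?case by (simp add: lsnorm_zero)
  next
    case (Suc m)
    have "L.snorm n (\<lambda>p. h j p - h (j + Suc m) p) \<le> L.snorm n (\<lambda>p. h j p - h (j + m) p)
        + L.snorm n (\<lambda>p. h (j + m) p - h (j + Suc m) p)"
      by (rule L.snorm_triangle_diff) auto
    also have "\<dots> \<le> (2 * (1 / 2) ^ j - 2 * (1 / 2) ^ (j + m)) + (1 / 2) ^ (j + m)"
      using Suc step[of n "j + m"] by simp
    finally show ?case by simp
  qed
  have hl: "L.snorm n (\<lambda>p. h j p - l p) \<le> 2 * (1 / 2) ^ j" for n j
  proof (rule tendsto_upperbound)
    have "(\<lambda>m. L.snorm n (\<lambda>p. h j p - h m p)) \<longlonglongrightarrow> L.snorm n (\<lambda>p. h j p - l p)"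
      unfolding L.snorm_def loc_def using card_V_pos[of n] by (intro tendsto_intros lim) auto
    then show "(\<lambda>m. L.snorm n (\<lambda>p. h j p - h (j + m) p)) \<longlonglongrightarrow> L.snorm n (\<lambda>p. h j p - l p)"
      by (subst add.commute) (rule LIMSEQ_ignore_initial_segment)
    have "L.snorm n (\<lambda>p. h j p - h (j + m) p) \<le> 2 * (1 / 2) ^ j" for m
      using hm[of n j m] by (rule order_trans) simp
    then show "\<forall>\<^sub>F m in sequentially. L.snorm n (\<lambda>p. h j p - h (j + m) p) \<le> 2 * (1 / 2) ^ j"
      by (intro always_eventually allI)
  qed simp
  have l: "l \<in> bdd"
  proof -
    obtain K where K: "\<And>n. L.snorm n (g 0) \<le> K" using g[of 0] by (auto simp: bdd_def)
    have "L.snorm n l \<le> K + 2" for n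
    proof -
      have "L.snorm n l = L.snorm n (\<lambda>p. h 0 p + (l p - h 0 p))" by simp
      also have "\<dots> \<le> L.snorm n (h 0) + L.snorm n (\<lambda>p. l p - h 0 p)"
        by (rule L.snorm_triangle) auto
      also have "L.snorm n (\<lambda>p. l p - h 0 p) = L.snorm n (\<lambda>p. h 0 p - l p)"
        by (rule L.snorm_minus_commute) auto
      finally show ?thesis using K[of n] hl[of n 0] by (simp add: h0)
    qed
    then show ?thesis by (rule bddI)
  qed
  have gl: "snorm (\<lambda>p. g j p - l p) \<le> 2 * (1 / 2) ^ j" for j
  proof (rule snorm_le[OF B_diff[OF g l]])
    have "eventually (\<lambda>n. \<forall>i\<in>{..<j}. n \<in> E i) U" by (intro eventually_ball_finite) (auto simp: E)
    then show "eventually (\<lambda>n. L.snorm n (\<lambda>p. g j p - l p) \<le> 2 * (1 / 2) ^ j) U"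
    proof (rule eventually_mono)
      fix n assume "\<forall>i\<in>{..<j}. n \<in> E i"
      then have "L.snorm n (\<lambda>p. g j p - l p) = L.snorm n (\<lambda>p. h j p - l p)"
        by (intro lsnorm_cong) (simp add: hg)
      then show "L.snorm n (\<lambda>p. g j p - l p) \<le> 2 * (1 / 2) ^ j" using hl by simp
    qed
  qed
  have "(\<lambda>n. snorm (\<lambda>p. \<sigma> n p - l p)) \<longlonglongrightarrow> 0"
  proof (rule LIMSEQ_I)
    fix e :: real assume "0 < e"
    then obtain j :: nat where j: "(1 / 2) ^ j < e / 3" using real_arch_pow_inv[of "e / 3" "1 / 2"] by auto
    have "norm (snorm (\<lambda>p. \<sigma> n p - l p) - 0) < e" if "n \<ge> k j" for n
    proof -
      have "snorm (\<lambda>p. \<sigma> n p - l p) \<le> snorm (\<lambda>p. \<sigma> n p - g j p) + snorm (\<lambda>p. g j p - l p)"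
        by (rule snorm_triangle_diff[OF \<sigma> g l])
      moreover have "snorm (\<lambda>p. \<sigma> n p - g j p) < (1 / 2) ^ j"
        unfolding g_def using k(1)[of j] that by (intro N) auto
      ultimately show ?thesis using gl[of j] j snorm_nonneg[OF B_diff[OF \<sigma> l], of n] by simp
    qed
    then show "\<exists>n0. \<forall>n\<ge>n0. norm (snorm (\<lambda>p. \<sigma> n p - l p) - 0) < e" by blast
  qed
  then show "\<exists>l\<in>bdd. (\<lambda>n. snorm (\<lambda>p. \<sigma> n p - l p)) \<longlonglongrightarrow> 0" using l by blast
qed

end

section \<open>Twisted representations of the translation algebra of a box space\<close>

context quotient_data
begin

abbreviation "Q n \<equiv> carrier (G Mod N n)"
abbreviation "X \<equiv> box_space G N"
abbreviation "\<E> \<equiv> box_coarse_structure G S N"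

lemma Q_act: "\<lbrakk>x \<in> Q n; g \<in> carrier G\<rbrakk> \<Longrightarrow> x #> g \<in> Q n"
  using finite_right_action.act_closed[OF quotient_right_action] .

lemma Q_act_mult: "\<lbrakk>x \<in> Q n; g \<in> carrier G; h \<in> carrier G\<rbrakk> \<Longrightarrow> x #> g #> h = x #> (g \<otimes> h)"
  using finite_right_action.act_mult[OF quotient_right_action] .

lemma Q_act_one: "x \<in> Q n \<Longrightarrow> x #> \<one> = x"
  using finite_right_action.act_one[OF quotient_right_action] .

lemma Q_act_eq_iff:
  assumes "x \<in> Q n" "g \<in> carrier G" "h \<in> carrier G"
  shows "x #> g = x #> h \<longleftrightarrow> g \<otimes> inv h \<in> N n"
proof -
  interpret normal "N n" G by (rule N_normal)
  obtain k where k: "k \<in> carrier G" "x = N n #> k" using assms(1) by (rule quotient_carrierE)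
  have "x #> g = x #> h \<longleftrightarrow> N n #> (k \<otimes> g) = N n #> (k \<otimes> h)"
    using k assms by (simp add: coset_mult_assoc[OF N_subset])
  also have "\<dots> \<longleftrightarrow> N n #> g = N n #> h"
  proof
    assume "N n #> (k \<otimes> g) = N n #> (k \<otimes> h)"
    then have "(N n #> inv k) <#> (N n #> (k \<otimes> g)) = (N n #> inv k) <#> (N n #> (k \<otimes> h))" by simp
    then show "N n #> g = N n #> h" using k assms by (simp add: rcos_sum m_assoc[symmetric])
  next
    assume "N n #> g = N n #> h"
    then have "(N n #> k) <#> (N n #> g) = (N n #> k) <#> (N n #> h)" by simp
    then show "N n #> (k \<otimes> g) = N n #> (k \<otimes> h)" using k assms by (simp add: rcos_sum)
  qed
  also have "\<dots> \<longleftrightarrow> g \<otimes> inv h \<in> N n"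
  proof
    assume "N n #> g = N n #> h"
    then have "N n #> (g \<otimes> inv h) = N n" by (rule coset_mult_inv2) (use assms N_subset in auto)
    then show "g \<otimes> inv h \<in> N n" by (rule coset_join1) (use assms N_subgroup in auto)
  next
    assume "g \<otimes> inv h \<in> N n"
    then have "N n #> (g \<otimes> inv h) = N n" by (intro coset_join2 N_subgroup) (use assms in auto)
    then show "N n #> g = N n #> h" by (rule coset_mult_inv1) (use assms N_subset in auto)
  qed
  finally show ?thesis .
qed

section \<open>Controlled sets as sets of translations by finitely many group elements\<close>

definition translates :: "'a set \<Rightarrow> (nat \<times> 'a set) rel" where
  "translates F = {((n, x), (n, x #> g)) | n x g. x \<in> Q n \<and> g \<in> F}"

lemma translatesI: "\<lbrakk>x \<in> Q n; g \<in> F\<rbrakk> \<Longrightarrow> ((n, x), (n, x #> g)) \<in> translates F"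
  by (auto simp: translates_def)

lemma translatesE:
  assumes "(p, q) \<in> translates F"
  obtains n x g where "p = (n, x)" "q = (n, x #> g)" "x \<in> Q n" "g \<in> F"
  using assms by (auto simp: translates_def)

lemma translates_mono: "F \<subseteq> H \<Longrightarrow> translates F \<subseteq> translates H"
  by (auto simp: translates_def)

lemma translates_subset: "F \<subseteq> carrier G \<Longrightarrow> translates F \<subseteq> X \<times> X"
  unfolding translates_def box_space_def using Q_act by auto

text \<open>This explicit coarse structure contains the box edges, with \<open>F = S\<close>, and
  therefore every controlled set. In \<open>controlledE\<close> it follows that a controlled set
  involves finitely many group elements, the same on all levels.\<close>

lemma coarse_structure_translates:
  "coarse_structure X {T. \<exists>F. finite F \<and> F \<subseteq> carrier G \<and> T \<subseteq> translates F}" (is "coarse_structure _ ?C")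
  unfolding coarse_structure_def
proof (intro conjI ballI allI impI)
  show "?C \<subseteq> Pow (X \<times> X)"
  proof
    fix A assume "A \<in> ?C"
    then obtain F where F: "F \<subseteq> carrier G" "A \<subseteq> translates F" by auto
    then show "A \<in> Pow (X \<times> X)" using order_trans[OF F(2) translates_subset[OF F(1)]] by simp
  qed
  have "Id_on X \<subseteq> translates {\<one>}"
    using translatesI[of _ _ \<one> "{\<one>}"] by (auto simp: box_space_def Q_act_one)
  then show "Id_on X \<in> ?C" by (intro CollectI exI[of _ "{\<one>}"]) simp
next
  fix A B assume "A \<in> ?C" "B \<in> ?C"
  then obtain F H where F: "finite F" "F \<subseteq> carrier G" "A \<subseteq> translates F"
    and H: "finite H" "H \<subseteq> carrier G" "B \<subseteq> translates H" by auto
  have "A \<union> B \<subseteq> translates (F \<union> H)"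
    using F(3) H(3) translates_mono[of F "F \<union> H"] translates_mono[of H "F \<union> H"] by auto
  then show "A \<union> B \<in> ?C" using F(1,2) H(1,2) by (intro CollectI exI[of _ "F \<union> H"]) simp
  have "A O B \<subseteq> translates ((\<lambda>(g, h). g \<otimes> h) ` (F \<times> H))"
  proof (rule subrelI)
    fix p q assume "(p, q) \<in> A O B"
    then obtain r where "(p, r) \<in> translates F" "(r, q) \<in> translates H" using F(3) H(3) by auto
    then obtain n x g h where *: "p = (n, x)" "q = (n, x #> g #> h)" "x \<in> Q n" "g \<in> F" "h \<in> H"
      by (auto elim!: translatesE)
    have "g \<in> carrier G" "h \<in> carrier G" using * F(2) H(2) by blast+
    then have "q = (n, x #> (g \<otimes> h))" using * by (simp add: Q_act_mult)
    then show "(p, q) \<in> translates ((\<lambda>(g, h). g \<otimes> h) ` (F \<times> H))"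
      using * by (auto intro!: translatesI)
  qed
  then show "A O B \<in> ?C"
    using F(1,2) H(1,2) by (intro CollectI exI[of _ "(\<lambda>(g, h). g \<otimes> h) ` (F \<times> H)"]) auto
next
  fix A assume "A \<in> ?C"
  then obtain F where F: "finite F" "F \<subseteq> carrier G" "A \<subseteq> translates F" by auto
  have "A\<inverse> \<subseteq> translates ((\<lambda>g. inv g) ` F)"
  proof (rule subrelI)
    fix p q assume "(p, q) \<in> A\<inverse>"
    then have "(q, p) \<in> translates F" using F(3) by auto
    then obtain n x g where *: "q = (n, x)" "p = (n, x #> g)" "x \<in> Q n" "g \<in> F" by (rule translatesE)
    have "g \<in> carrier G" using * F(2) by blast
    then have "x #> g \<in> Q n" "x #> g #> inv g = x" using * by (simp_all add: Q_act Q_act_mult Q_act_one)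
    then show "(p, q) \<in> translates ((\<lambda>g. inv g) ` F)"
      using * translatesI[of "x #> g" n "inv g"] by auto
  qed
  then show "A\<inverse> \<in> ?C" using F(1,2) by (intro CollectI exI[of _ "(\<lambda>g. inv g) ` F"]) auto
qed blast

lemma controlledE:
  assumes "T \<in> \<E>"
  obtains F where "finite F" "F \<subseteq> carrier G" "T \<subseteq> translates F"
proof -
  have "box_edges G S N \<subseteq> translates S"
    by (auto simp: box_edges_def quotient_edges_iff translates_def)
  then have "box_edges G S N \<in> {T. \<exists>F. finite F \<and> F \<subseteq> carrier G \<and> T \<subseteq> translates F}"
    using finite_gens gens_closed by blast
  from coarse_structure_generatedD[OF assms[unfolded box_coarse_structure_def] coarse_structure_translates this]
  show ?thesis using that by auto
qed

lemma controlled_subset: "\<lbrakk>T \<in> \<E>; T' \<subseteq> T\<rbrakk> \<Longrightarrow> T' \<in> \<E>"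
  using coarse_structure_box unfolding coarse_structure_def by blast

lemma box_edges_controlled: "box_edges G S N \<in> \<E>"
  unfolding box_coarse_structure_def by (rule coarse_structure_generatedI)

lemma coarse_ops:
  "Id_on X \<in> \<E>"
  "\<lbrakk>A \<in> \<E>; B \<in> \<E>\<rbrakk> \<Longrightarrow> A \<union> B \<in> \<E>"
  "\<lbrakk>A \<in> \<E>; B \<in> \<E>\<rbrakk> \<Longrightarrow> A O B \<in> \<E>"
  "A \<in> \<E> \<Longrightarrow> A\<inverse> \<in> \<E>"
  using coarse_structure_box unfolding coarse_structure_def by blast+

lemma translates_controlled:
  assumes "g \<in> carrier G"
  shows "translates {g} \<in> \<E>"
proof -
  have "g \<in> generate G S" using assms gens_generate by simp
  then show ?thesis
  proof (induction rule: generate.induct)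
    case one
    have "translates {\<one>} \<subseteq> Id_on X" by (auto simp: translates_def box_space_def Q_act_one Id_on_def)
    then show ?case using coarse_ops(1) controlled_subset by blast
  next
    case (incl s)
    have "translates {s} \<subseteq> box_edges G S N"
      using incl by (auto simp: translates_def box_edges_def quotient_edges_iff)
    then show ?case using box_edges_controlled controlled_subset by blast
  next
    case (inv s)
    have "translates {inv s} \<subseteq> box_edges G S N"
      using gens_inv[OF inv] by (auto simp: translates_def box_edges_def quotient_edges_iff)
    then show ?case using box_edges_controlled controlled_subset by blast
  next
    case (eng g h)
    then have c: "g \<in> carrier G" "h \<in> carrier G" using gens_generate by auto
    have "translates {g \<otimes> h} \<subseteq> translates {g} O translates {h}"
    proof (rule subrelI)
      fix p q assume "(p, q) \<in> translates {g \<otimes> h}"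
      then obtain n x where *: "p = (n, x)" "q = (n, x #> (g \<otimes> h))" "x \<in> Q n" by (auto elim!: translatesE)
      then have "q = (n, x #> g #> h)" using c by (simp add: Q_act_mult)
      then show "(p, q) \<in> translates {g} O translates {h}"
        using * c translatesI[of x n g "{g}"] translatesI[of "x #> g" n h "{h}"] by (auto simp: Q_act)
    qed
    then show ?case using coarse_ops(3)[OF eng.IH] controlled_subset by blast
  qed
qed

text \<open>The diagonal is added so that the powers increase on \<open>X\<close>; then the sets
  contained in some power form a coarse structure, which must contain the generated one.\<close>

lemma generating_edges: "coarse_generating \<E> (box_edges G S N \<union> Id_on X)" (is "coarse_generating _ ?E")
  unfolding coarse_generating_def
proof (intro conjI ballI)
  show "?E \<in> \<E>" by (intro coarse_ops box_edges_controlled)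
  have EX: "?E \<subseteq> X \<times> X" using box_edges_subset by auto
  have sym: "?E\<inverse> = ?E"
    using sym_quotient_edges by (auto simp: box_edges_def sym_def)
  let ?C = "{F. F \<subseteq> X \<times> X \<and> (\<exists>n\<ge>1. F \<subseteq> ?E ^^ n)}"
  have mono: "?E ^^ n \<inter> X \<times> X \<subseteq> ?E ^^ (n + k)" for n k
  proof (induction k)
    case (Suc k)
    show ?case
    proof
      fix pq assume pq: "pq \<in> ?E ^^ n \<inter> X \<times> X"
      then obtain p q where "pq = (p, q)" "(p, q) \<in> ?E ^^ (n + k)" "q \<in> X" using Suc by auto
      then show "pq \<in> ?E ^^ (n + Suc k)" by (auto intro!: relcompI[of p q])
    qed
  qed simp
  have C: "coarse_structure X ?C"
    unfolding coarse_structure_def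
  proof (intro conjI ballI allI impI)
    show "Id_on X \<in> ?C" by (auto intro!: exI[of _ 1])
  next
    fix A B assume "A \<in> ?C" "B \<in> ?C"
    then obtain m n where A: "A \<subseteq> X \<times> X" "m \<ge> 1" "A \<subseteq> ?E ^^ m" and B: "B \<subseteq> X \<times> X" "n \<ge> 1" "B \<subseteq> ?E ^^ n" by auto
    have "A \<subseteq> ?E ^^ (m + n)" "B \<subseteq> ?E ^^ (n + m)" using A B mono by blast+
    then show "A \<union> B \<in> ?C" using A B by (auto simp: add.commute intro!: exI[of _ "m + n"])
    have "A O B \<subseteq> ?E ^^ (m + n)" unfolding relpow_add using A B by blast
    then show "A O B \<in> ?C" using A B by (auto intro!: exI[of _ "m + n"])
  next
    fix A assume "A \<in> ?C"
    then obtain m where A: "A \<subseteq> X \<times> X" "m \<ge> 1" "A \<subseteq> ?E ^^ m" by auto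
    have "(?E ^^ m)\<inverse> = ?E ^^ m" 
      by (induction m) (simp_all only: relpow.simps converse_Id converse_relcomp sym relpow_commute)
    then have "A\<inverse> \<subseteq> ?E ^^ m" using A by auto
    then show "A\<inverse> \<in> ?C" using A by auto
  qed auto
  have "box_edges G S N \<in> ?C" using box_edges_subset by (auto intro!: exI[of _ 1])
  note gen = coarse_structure_generatedD[OF _ C this]
  fix F assume "F \<in> \<E>"
  from gen[OF this[unfolded box_coarse_structure_def]] show "\<exists>n\<ge>1. F \<subseteq> ?E ^^ n" by simp
qed

end

text \<open>The twist \<open>\<kappa>\<close> is a family of unitary cocycles on the finite quotients which converges along the
  ultrafilter to the character \<open>\<tau>\<close>. No finite quotient need carry \<open>\<tau>\<close> itself.\<close>

locale twisted_box = quotient_data G S N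
  for G (structure) and S :: "'a set" and N :: "nat \<Rightarrow> 'a set" +
  fixes U :: "nat filter" and \<tau> :: "'a \<Rightarrow> complex" and \<kappa> :: "nat \<Rightarrow> 'a set \<Rightarrow> 'a set \<Rightarrow> complex"
  assumes ultrafilter: "ultrafilter U"
    and \<tau>_mult: "\<lbrakk>g \<in> carrier G; h \<in> carrier G\<rbrakk> \<Longrightarrow> \<tau> (g \<otimes> h) = \<tau> g * \<tau> h"
    and \<tau>_norm: "g \<in> carrier G \<Longrightarrow> cmod (\<tau> g) = 1"
    and \<kappa>_norm: "cmod (\<kappa> n x y) = 1"
    and \<kappa>_\<tau>: "g \<in> carrier G \<Longrightarrow> eventually (\<lambda>n. \<forall>x\<in>Q n. \<kappa> n x (x #> g) = \<tau> g) U"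
begin

sublocale ultraproduct Q U
  by unfold_locales (use finite_quotient N_in_quotient ultrafilter in auto)

lemma eventually_\<kappa>:
  assumes "finite F" "F \<subseteq> carrier G"
  shows "eventually (\<lambda>n. \<forall>g\<in>F. \<forall>x\<in>Q n. \<kappa> n x (x #> g) = \<tau> g) U"
  using assms by (intro eventually_ball_finite) (auto intro: \<kappa>_\<tau>)

lemma \<tau>_one: "\<tau> \<one> = 1"
  using \<tau>_mult[of \<one> \<one>] \<tau>_norm[of \<one>] by auto

lemma \<tau>_inv: "g \<in> carrier G \<Longrightarrow> \<tau> (inv g) = cnj (\<tau> g)"
proof -
  assume g: "g \<in> carrier G"
  have "\<tau> g * \<tau> (inv g) = 1" using \<tau>_mult[of g "inv g"] g \<tau>_one by simp
  moreover have "\<tau> g * cnj (\<tau> g) = 1" using complex_norm_square[of "\<tau> g"] \<tau>_norm[OF g] by simp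
  ultimately show ?thesis by (metis mult_cancel_left mult_zero_left zero_neq_one)
qed

text \<open>The entrywise product of \<open>T\<close> with the twist, acting level by level. It is
  multiplicative and compatible with adjoints only along the ultrafilter, on levels where
  \<open>\<kappa>\<close> agrees with \<open>\<tau>\<close> for the finitely many group elements
  that the matrices involve.\<close>

definition op :: "(nat \<times> 'a set) cmatrix \<Rightarrow> (nat \<times> 'a set \<Rightarrow> complex) \<Rightarrow> nat \<times> 'a set \<Rightarrow> complex" where
  "op T f = (\<lambda>(n, x). \<Sum>y\<in>Q n. T (n, x) (n, y) * \<kappa> n x y * f (n, y))"

lemma algebraE:
  assumes "T \<in> translation_algebra \<E>"
  obtains F where "finite F" "F \<subseteq> carrier G" "mat_support T \<subseteq> translates F"
  using assms by (auto simp: translation_algebra_def elim: controlledE)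

lemma support_translates:
  assumes "mat_support T \<subseteq> translates F" "T (n, x) q \<noteq> 0"
  shows "x \<in> Q n" "\<exists>g\<in>F. q = (n, x #> g)"
proof -
  have "((n, x), q) \<in> translates F" using assms by (auto simp: mat_support_def)
  then show "x \<in> Q n" "\<exists>g\<in>F. q = (n, x #> g)" by (auto elim!: translatesE)
qed

text \<open>A row of \<open>T\<close> has at most \<open>card F\<close> nonzero entries, and each
  \<open>g\<close> in \<open>F\<close> permutes the level. Cauchy-Schwarz over \<open>F\<close>
  gives a bound that does not depend on the level.\<close>

lemma op_bounded:
  assumes T: "T \<in> translation_algebra \<E>"
  shows "\<exists>M\<ge>0. \<forall>n f. L.snorm n (op T f) \<le> M * L.snorm n f"
proof -
  obtain F where F: "finite F" "F \<subseteq> carrier G" "mat_support T \<subseteq> translates F"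
    using T by (rule algebraE)
  obtain K where K2: "\<And>p q. cmod (T p q) \<le> K" using T by (auto simp: translation_algebra_def)
  have K: "K \<ge> 0" using order_trans[OF norm_ge_zero K2[of undefined undefined]] .
  have "L.snorm n (op T f) \<le> (K * real (card F)) * L.snorm n f" for n f
  proof (rule power2_le_imp_le)
    interpret finite_right_action G "Q n" "\<lambda>x g. x #> g" by (rule quotient_right_action)
    have *: "(cmod (op T f (n, x)))\<^sup>2 \<le> K\<^sup>2 * real (card F) * (\<Sum>g\<in>F. (cmod (f (n, x #> g)))\<^sup>2)"
      if x: "x \<in> Q n" for x
    proof -
      let ?Y = "(\<lambda>g. x #> g) ` F"
      have Y: "?Y \<subseteq> Q n" using F x by auto
      have "op T f (n, x) = (\<Sum>y\<in>?Y. T (n, x) (n, y) * \<kappa> n x y * f (n, y))"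
        unfolding op_def prod.case
        by (rule sum.mono_neutral_right[OF finite_quotient Y])
          (use support_translates(2)[OF F(3)] in fastforce)
      then have "cmod (op T f (n, x)) \<le> (\<Sum>y\<in>?Y. K * cmod (f (n, y)))"
        using K2 by (auto simp: norm_mult \<kappa>_norm intro!: sum_norm_le mult_right_mono)
      also have "\<dots> \<le> (\<Sum>g\<in>F. K * cmod (f (n, x #> g)))"
        using sum_image_le[OF F(1), of "\<lambda>y. K * cmod (f (n, y))" "\<lambda>g. x #> g"] K by simp
      also have "\<dots> = K * (\<Sum>g\<in>F. 1 * cmod (f (n, x #> g)))" by (simp add: sum_distrib_left)
      finally have "(cmod (op T f (n, x)))\<^sup>2 \<le> (K * (\<Sum>g\<in>F. 1 * cmod (f (n, x #> g))))\<^sup>2"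
        by (rule power_mono) simp
      also have "\<dots> = K\<^sup>2 * (\<Sum>g\<in>F. 1 * cmod (f (n, x #> g)))\<^sup>2" by (rule power_mult_distrib)
      also have "\<dots> \<le> K\<^sup>2 * ((\<Sum>g\<in>F. 1\<^sup>2) * (\<Sum>g\<in>F. (cmod (f (n, x #> g)))\<^sup>2))"
        by (intro mult_left_mono Cauchy_Schwarz_ineq_sum) simp
      finally show ?thesis by simp
    qed
    have "(\<Sum>x\<in>Q n. (cmod (op T f (n, x)))\<^sup>2)
        \<le> (\<Sum>x\<in>Q n. K\<^sup>2 * real (card F) * (\<Sum>g\<in>F. (cmod (f (n, x #> g)))\<^sup>2))"
      by (rule sum_mono[OF *])
    also have "\<dots> = K\<^sup>2 * real (card F) * (\<Sum>x\<in>Q n. \<Sum>g\<in>F. (cmod (f (n, x #> g)))\<^sup>2)"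
      by (simp add: sum_distrib_left)
    also have "(\<Sum>x\<in>Q n. \<Sum>g\<in>F. (cmod (f (n, x #> g)))\<^sup>2) = (\<Sum>g\<in>F. \<Sum>x\<in>Q n. (cmod (f (n, x #> g)))\<^sup>2)"
      by (rule sum.swap)
    also have "\<dots> = (\<Sum>g\<in>F. \<Sum>x\<in>Q n. (cmod (f (n, x)))\<^sup>2)"
      using F(2) by (intro sum.cong refl sum.reindex_bij_betw[OF act_bij, of _ "\<lambda>x. (cmod (f (n, x)))\<^sup>2"]) auto
    also have "K\<^sup>2 * real (card F) * \<dots> = (K * real (card F))\<^sup>2 * (\<Sum>x\<in>Q n. (cmod (f (n, x)))\<^sup>2)"
      by (simp add: power2_eq_square)
    finally have "(\<Sum>x\<in>Q n. (cmod (op T f (n, x)))\<^sup>2) / real (card (Q n))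
        \<le> (K * real (card F))\<^sup>2 * (\<Sum>x\<in>Q n. (cmod (f (n, x)))\<^sup>2) / real (card (Q n))"
      by (rule divide_right_mono) simp
    then show "(L.snorm n (op T f))\<^sup>2 \<le> (K * real (card F) * L.snorm n f)\<^sup>2"
      by (simp only: power_mult_distrib[of "K * real (card F)"] lsnorm_power2 times_divide_eq_right)
  qed (use K L.snorm_nonneg in simp)
  then show ?thesis using K by (intro exI[of _ "K * real (card F)"]) simp
qed

lemma op_bdd: "\<lbrakk>T \<in> translation_algebra \<E>; f \<in> bdd\<rbrakk> \<Longrightarrow> op T f \<in> bdd"
proof -
  assume T: "T \<in> translation_algebra \<E>" and "f \<in> bdd"
  then obtain K where K: "\<And>n. L.snorm n f \<le> K" by (auto simp: bdd_def)
  obtain M where M: "\<And>n f. L.snorm n (op T f) \<le> M * L.snorm n f" "M \<ge> 0" using op_bounded[OF T] by auto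
  have "L.snorm n (op T f) \<le> M * K" for n
    using M(1)[of n f] mult_left_mono[OF K M(2)] by (rule order_trans)
  then show ?thesis by (rule bddI)
qed

lemma op_snorm:
  assumes T: "T \<in> translation_algebra \<E>"
  shows "\<exists>M. \<forall>f\<in>bdd. snorm (op T f) \<le> M * snorm f"
proof -
  obtain M where M: "\<And>n f. L.snorm n (op T f) \<le> M * L.snorm n f" "M \<ge> 0" using op_bounded[OF T] by auto
  have "snorm (op T f) \<le> M * snorm f" if f: "f \<in> bdd" for f
    by (rule tendsto_le[OF U_nontrivial tendsto_mult_left[OF snorm_tendsto[OF f]] snorm_tendsto[OF op_bdd[OF T f]]])
      (simp add: M)
  then show ?thesis by (intro exI[of _ M]) simp
qed

lemma op_add: "op T (\<lambda>p. f p + g p) = (\<lambda>p. op T f p + op T g p)"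
  by (simp add: op_def fun_eq_iff distrib_left sum.distrib)

lemma op_scale: "op T (\<lambda>p. a * f p) = (\<lambda>p. a * op T f p)"
  by (simp add: op_def fun_eq_iff sum_distrib_left mult_ac)

lemma op_diff: "op T (\<lambda>p. f p - g p) = (\<lambda>p. op T f p - op T g p)"
  by (simp add: op_def fun_eq_iff right_diff_distrib sum_subtractf)

lemma uip_eventually_cong:
  assumes "f \<in> bdd" "g \<in> bdd" "f' \<in> bdd" "g' \<in> bdd" "eventually (\<lambda>n. loc n f g = loc n f' g') U"
  shows "uip f g = uip f' g'"
  using tendsto_cong[THEN iffD2, OF assms(5) loc_tendsto[OF assms(3,4)]]
  by (rule uip_eqI[OF assms(1,2)])

text \<open>Algebraic identities between operators need to hold only on a set of levels in the
  ultrafilter; passing to representatives makes them exact.\<close>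

lemma nf_eventually_cong:
  assumes "f \<in> bdd" "g \<in> bdd" "eventually (\<lambda>n. \<forall>x\<in>Q n. f (n, x) = g (n, x)) U"
  shows "nf f = nf g"
proof (rule nf_eqI)
  fix h assume "h \<in> bdd"
  then show "uip f h = uip g h"
    using assms by (intro uip_eventually_cong) (auto elim!: eventually_mono intro!: loc_cong)
qed

definition rep :: "(nat \<times> 'a set) cmatrix \<Rightarrow> (nat \<times> 'a set \<Rightarrow> complex) \<Rightarrow> nat \<times> 'a set \<Rightarrow> complex" where
  "rep T f = nf (op T f)"

lemma nf_op_nf:
  assumes T: "T \<in> translation_algebra \<E>" and f: "f \<in> bdd"
  shows "nf (op T (nf f)) = nf (op T f)"
proof (rule nf_eqI)
  fix h assume h: "h \<in> bdd"
  obtain M where M: "\<And>f. f \<in> bdd \<Longrightarrow> snorm (op T f) \<le> M * snorm f" using op_snorm[OF T] by auto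
  have d: "(\<lambda>p. nf f p - f p) \<in> bdd" using f by (intro B_diff nf)
  have "snorm (\<lambda>p. nf f p - f p) = 0"
    using d f nf(1)[OF f] by (simp add: snorm_def nf ip_diff)
  then have "snorm (op T (\<lambda>p. nf f p - f p)) = 0"
    using M[OF d] snorm_nonneg[OF op_bdd[OF T d]] by simp
  then have "uip (op T (\<lambda>p. nf f p - f p)) h = 0" by (rule snorm_eq_0_ip[OF op_bdd[OF T d] h])
  then show "uip (op T (nf f)) h = uip (op T f) h"
    unfolding op_diff using op_bdd[OF T] f nf(1)[OF f] h by (simp add: ip_diff)
qed

lemma rep_nf: "\<lbrakk>T \<in> translation_algebra \<E>; f \<in> bdd\<rbrakk> \<Longrightarrow> rep T (nf f) = nf (op T f)"
  by (simp add: rep_def nf_op_nf)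

lemma sum_support:
  assumes "mat_support T \<subseteq> translates F" "x \<in> Q n" "F \<subseteq> carrier G"
    and "\<And>g. g \<in> F \<Longrightarrow> h (x #> g) = k (x #> g)"
  shows "(\<Sum>y\<in>Q n. T (n, x) (n, y) * h y) = (\<Sum>y\<in>Q n. T (n, x) (n, y) * k y)"
proof (rule sum.cong[OF refl])
  fix y
  show "T (n, x) (n, y) * h y = T (n, x) (n, y) * k y"
    using support_translates(2)[OF assms(1), of n x "(n, y)"] assms(4) by (cases "T (n, x) (n, y) = 0") auto
qed

lemma op_one:
  shows "eventually (\<lambda>n. \<forall>x\<in>Q n. op (mat_one X) f (n, x) = f (n, x)) U"
  using \<kappa>_\<tau>[OF one_closed]
proof (rule eventually_mono)
  fix n assume *: "\<forall>x\<in>Q n. \<kappa> n x (x #> \<one>) = \<tau> \<one>"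
  show "\<forall>x\<in>Q n. op (mat_one X) f (n, x) = f (n, x)"
  proof
    fix x assume x: "x \<in> Q n"
    have "op (mat_one X) f (n, x) = (\<Sum>y\<in>Q n. if y = x then \<kappa> n x x * f (n, x) else 0)"
      unfolding op_def prod.case using x by (intro sum.cong) (auto simp: mat_one_def box_space_def)
    also have "\<dots> = \<kappa> n x x * f (n, x)" using x finite_quotient by simp
    also have "\<kappa> n x x = 1" using * x by (metis Q_act_one \<tau>_one)
    finally show "op (mat_one X) f (n, x) = f (n, x)" by simp
  qed
qed

lemma op_times:
  assumes S: "A \<in> translation_algebra \<E>" and T: "T \<in> translation_algebra \<E>"
  shows "eventually (\<lambda>n. \<forall>x\<in>Q n. op (mat_times A T) f (n, x) = op A (op T f) (n, x)) U"
proof -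
  obtain F where F: "finite F" "F \<subseteq> carrier G" "mat_support A \<subseteq> translates F" using S by (rule algebraE)
  obtain H where H: "finite H" "H \<subseteq> carrier G" "mat_support T \<subseteq> translates H" using T by (rule algebraE)
  \<comment> \<open>The products are included because the cocycle identity at \<open>x\<close>,
    \<open>x #> g\<close> and \<open>x #> g #> h\<close> needs \<open>\<kappa>\<close> to agree with
    \<open>\<tau>\<close> at \<open>g\<close>, at \<open>h\<close> and at their product.\<close>
  let ?K = "F \<union> H \<union> (\<lambda>(g, h). g \<otimes> h) ` (F \<times> H)"
  have "finite ?K" "?K \<subseteq> carrier G" using F H by auto
  from eventually_\<kappa>[OF this] show ?thesis
  proof (rule eventually_mono)
    fix n assume *: "\<forall>g\<in>?K. \<forall>x\<in>Q n. \<kappa> n x (x #> g) = \<tau> g"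
    show "\<forall>x\<in>Q n. op (mat_times A T) f (n, x) = op A (op T f) (n, x)"
    proof
      fix x assume x: "x \<in> Q n"
      have mt: "mat_times A T (n, x) (n, y) = (\<Sum>z\<in>Q n. A (n, x) (n, z) * T (n, z) (n, y))" for y
      proof -
        let ?Z = "{z. A (n, x) z \<noteq> 0 \<and> T z (n, y) \<noteq> 0}"
        have sub: "?Z \<subseteq> Pair n ` Q n"
          using support_translates(2)[OF F(3)] F(2) x by (fastforce intro: Q_act)
        have "mat_times A T (n, x) (n, y) = (\<Sum>z\<in>Pair n ` Q n. A (n, x) z * T z (n, y))"
          unfolding mat_times_def using finite_quotient sub by (intro sum.mono_neutral_left) auto
        also have "\<dots> = (\<Sum>z\<in>Q n. A (n, x) (n, z) * T (n, z) (n, y))"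
          by (subst sum.reindex) (auto simp: inj_on_def)
        finally show ?thesis .
      qed
      have "op (mat_times A T) f (n, x)
          = (\<Sum>y\<in>Q n. \<Sum>z\<in>Q n. A (n, x) (n, z) * (T (n, z) (n, y) * (\<kappa> n x y * f (n, y))))"
        unfolding op_def prod.case mt by (simp add: sum_distrib_right mult.assoc)
      also have "\<dots> = (\<Sum>z\<in>Q n. A (n, x) (n, z) * (\<Sum>y\<in>Q n. T (n, z) (n, y) * (\<kappa> n x y * f (n, y))))"
        by (subst sum.swap) (simp add: sum_distrib_left)
      also have "\<dots> = (\<Sum>z\<in>Q n. A (n, x) (n, z) * (\<kappa> n x z * (\<Sum>y\<in>Q n. T (n, z) (n, y) * (\<kappa> n z y * f (n, y)))))"
      proof (rule sum_support[OF F(3) x F(2)])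
        fix g assume g: "g \<in> F"
        then have gc: "g \<in> carrier G" using F(2) by blast
        have xg: "x #> g \<in> Q n" by (rule Q_act[OF x gc])
        have "(\<Sum>y\<in>Q n. T (n, x #> g) (n, y) * (\<kappa> n x y * f (n, y)))
          = (\<Sum>y\<in>Q n. T (n, x #> g) (n, y) * (\<kappa> n x (x #> g) * (\<kappa> n (x #> g) y * f (n, y))))"
        proof (rule sum_support[OF H(3) xg H(2)])
          fix h assume h: "h \<in> H"
          then have hc: "h \<in> carrier G" using H(2) by blast
          have K: "g \<in> ?K" "h \<in> ?K" "g \<otimes> h \<in> ?K" using g h by auto
          have "\<kappa> n x (x #> g #> h) = \<kappa> n x (x #> g) * \<kappa> n (x #> g) (x #> g #> h)"
            using bspec[OF bspec[OF * K(1)] x] bspec[OF bspec[OF * K(2)] xg] bspec[OF bspec[OF * K(3)] x]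
            by (simp add: \<tau>_mult[OF gc hc] Q_act_mult[OF x gc hc])
          then show "\<kappa> n x (x #> g #> h) * f (n, x #> g #> h)
            = \<kappa> n x (x #> g) * (\<kappa> n (x #> g) (x #> g #> h) * f (n, x #> g #> h))" by simp
        qed
        then show "(\<Sum>y\<in>Q n. T (n, x #> g) (n, y) * (\<kappa> n x y * f (n, y)))
          = \<kappa> n x (x #> g) * (\<Sum>y\<in>Q n. T (n, x #> g) (n, y) * (\<kappa> n (x #> g) y * f (n, y)))"
          by (simp add: sum_distrib_left mult_ac)
      qed
      also have "\<dots> = op A (op T f) (n, x)" unfolding op_def prod.case by (simp add: mult.assoc)
      finally show "op (mat_times A T) f (n, x) = op A (op T f) (n, x)" .
    qed
  qed
qed

lemma loc_op_star:
  assumes T: "T \<in> translation_algebra \<E>"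
  shows "eventually (\<lambda>n. loc n (op T f) g = loc n f (op (mat_star T) g)) U"
proof -
  obtain F where F: "finite F" "F \<subseteq> carrier G" "mat_support T \<subseteq> translates F" using T by (rule algebraE)
  \<comment> \<open>The adjoint reverses each translation, so the inverses are needed as well; there
    \<open>\<tau>\<close> takes the conjugate value.\<close>
  let ?K = "F \<union> (\<lambda>g. inv g) ` F"
  have "finite ?K" "?K \<subseteq> carrier G" using F by auto
  from eventually_\<kappa>[OF this] show ?thesis
  proof (rule eventually_mono)
    fix n assume *: "\<forall>g\<in>?K. \<forall>x\<in>Q n. \<kappa> n x (x #> g) = \<tau> g"
    have k: "T (n, x) (n, y) * \<kappa> n x y = T (n, x) (n, y) * cnj (\<kappa> n y x)" for x y
    proof (cases "T (n, x) (n, y) = 0")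
      case False
      then obtain g where g: "x \<in> Q n" "g \<in> F" "y = x #> g"
        using support_translates[OF F(3)] by blast
      then have gc: "g \<in> carrier G" using F(2) by blast
      have K: "g \<in> ?K" "inv g \<in> ?K" using g by auto
      have x: "y #> inv g = x" "y \<in> Q n" using g gc by (simp_all add: Q_act Q_act_mult Q_act_one)
      have "\<kappa> n y x = \<tau> (inv g)" using bspec[OF bspec[OF * K(2)] x(2)] unfolding x(1) .
      moreover have "\<kappa> n x y = \<tau> g" using bspec[OF bspec[OF * K(1)] g(1)] g(3) by simp
      ultimately show ?thesis using gc by (simp add: \<tau>_inv)
    qed simp
    have "(\<Sum>x\<in>Q n. op T f (n, x) * cnj (g (n, x)))
        = (\<Sum>x\<in>Q n. \<Sum>y\<in>Q n. (T (n, x) (n, y) * \<kappa> n x y) * f (n, y) * cnj (g (n, x)))"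
      by (simp add: op_def sum_distrib_right)
    also have "\<dots> = (\<Sum>y\<in>Q n. \<Sum>x\<in>Q n. (T (n, x) (n, y) * cnj (\<kappa> n y x)) * f (n, y) * cnj (g (n, x)))"
      unfolding k by (rule sum.swap)
    also have "\<dots> = (\<Sum>y\<in>Q n. f (n, y) * cnj (op (mat_star T) g (n, y)))"
      by (simp add: op_def mat_star_def sum_distrib_left mult_ac)
    finally show "loc n (op T f) g = loc n f (op (mat_star T) g)" by (simp add: loc_def)
  qed
qed

theorem representation_rep: "representation X \<E> hilb rep"
proof (intro representation.intro representation_axioms.intro hilbert_space_hilb)
  note coarse = coarse_structure_box and bg = bounded_geometry_box
  fix T assume T: "T \<in> translation_algebra \<E>"
  obtain M where M: "\<And>f. f \<in> bdd \<Longrightarrow> snorm (op T f) \<le> M * snorm f" using op_snorm[OF T] by auto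
  show "bounded_operator hilb (rep T)"
    unfolding bounded_operator_def
  proof (intro conjI ballI allI exI[of _ M])
    show "rep T \<in> carrier hilb \<rightarrow> carrier hilb" using T by (auto simp: rep_def hilb_carrier op_bdd)
    fix f assume "f \<in> carrier hilb"
    then have f: "f \<in> bdd" by (simp add: hilb_carrier)
    show "hnorm hilb (rep T f) \<le> M * hnorm hilb f"
      using M[OF f] T f by (simp add: hilb_hnorm rep_def snorm_nf op_bdd)
    show "rep T (a \<odot>\<^bsub>hilb\<^esub> f) = a \<odot>\<^bsub>hilb\<^esub> rep T f" for a
      using T f by (simp add: rep_nf B_scale op_scale, simp add: rep_def)
        (rule nf_eqI, simp add: ip_scale nf op_bdd)
    fix g assume "g \<in> carrier hilb"
    then have g: "g \<in> bdd" by (simp add: hilb_carrier)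
    show "rep T (f \<oplus>\<^bsub>hilb\<^esub> g) = rep T f \<oplus>\<^bsub>hilb\<^esub> rep T g"
      using T f g by (simp add: rep_nf B_add op_add, simp add: rep_def)
        (rule nf_eqI, simp add: ip_add nf op_bdd)
  qed
next
  fix f assume "f \<in> carrier hilb"
  then obtain f0 where f: "f0 \<in> bdd" "f = nf f0" by auto
  show "rep (mat_one X) f = f"
    unfolding f(2) rep_nf[OF translation_algebra_one[OF coarse_structure_box] f(1)]
    by (rule nf_eventually_cong[OF op_bdd[OF translation_algebra_one[OF coarse_structure_box] f(1)] f(1) op_one])
next
  fix A T f assume A: "A \<in> translation_algebra \<E>" and T: "T \<in> translation_algebra \<E>" and "f \<in> carrier hilb"
  then have f: "f \<in> bdd" by (simp add: hilb_carrier)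
  have "op (mat_plus A T) f = (\<lambda>p. op A f p + op T f p)"
    by (simp add: op_def mat_plus_def fun_eq_iff distrib_right sum.distrib)
  then show "rep (mat_plus A T) f = rep A f \<oplus>\<^bsub>hilb\<^esub> rep T f"
    using A T f by (simp add: rep_def) (rule nf_eqI, simp add: ip_add nf op_bdd)
  have AT: "mat_times A T \<in> translation_algebra \<E>"
    by (rule translation_algebra_times[OF coarse_structure_box bounded_geometry_box A T])
  have "nf (op (mat_times A T) f) = nf (op A (op T f))"
    by (rule nf_eventually_cong[OF op_bdd[OF AT f] op_bdd[OF A op_bdd[OF T f]] op_times[OF A T]])
  then show "rep (mat_times A T) f = rep A (rep T f)"
    unfolding rep_def by (simp only: nf_op_nf[OF A op_bdd[OF T f]])
next
  fix T f a assume T: "T \<in> translation_algebra \<E>" and "f \<in> carrier hilb"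
  then have f: "f \<in> bdd" by (simp add: hilb_carrier)
  have "op (mat_scale a T) f = (\<lambda>p. a * op T f p)"
    by (simp add: op_def mat_scale_def fun_eq_iff sum_distrib_left mult_ac)
  then show "rep (mat_scale a T) f = a \<odot>\<^bsub>hilb\<^esub> rep T f"
    using T f by (simp add: rep_def) (rule nf_eqI, simp add: ip_scale nf op_bdd)
next
  fix T f g assume T: "T \<in> translation_algebra \<E>" and "f \<in> carrier hilb" "g \<in> carrier hilb"
  then have fg: "f \<in> bdd" "g \<in> bdd" by (simp_all add: hilb_carrier)
  have T': "mat_star T \<in> translation_algebra \<E>" by (rule translation_algebra_star[OF coarse_structure_box T])
  have "uip (op T f) g = uip f (op (mat_star T) g)"
    by (rule uip_eventually_cong[OF op_bdd[OF T fg(1)] fg(2) fg(1) op_bdd[OF T' fg(2)] loc_op_star[OF T]])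
  then show "cinner hilb (rep T f) g = cinner hilb f (rep (mat_star T) g)"
    using T T' fg by (simp add: rep_def nf nf' op_bdd)
qed

end

section \<open>Partial translations in a twisted representation\<close>

lemma translation_matrix_range:
  assumes "inj_on t A"
  shows "mat_times (translation_matrix A t) (mat_star (translation_matrix A t)) p q
    = (if p = q \<and> p \<in> t ` A then 1 else 0)"
proof -
  let ?Z = "{z. translation_matrix A t p z \<noteq> 0 \<and> mat_star (translation_matrix A t) z q \<noteq> 0}"
  have Z: "?Z = {z \<in> A. t z = p \<and> t z = q}"
    by (auto simp: translation_matrix_def mat_star_def)
  show ?thesis
  proof (cases "p = q \<and> p \<in> t ` A")
    case True
    then obtain z where z: "z \<in> A" "t z = p" by blast
    then have "?Z = {z}" unfolding Z using True assms by (auto dest: inj_onD)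
    then show ?thesis using True z by (simp add: mat_times_def) (auto simp: translation_matrix_def mat_star_def)
  next
    case False
    then have "?Z = {}" unfolding Z by auto
    then show ?thesis using False by (simp only: mat_times_def sum.empty if_False)
  qed
qed

context quotient_data
begin

definition shift :: "'a \<Rightarrow> (nat \<times> 'a set) cmatrix" where
  "shift g = translation_matrix X (\<lambda>(n, x). (n, x #> g))"

lemma shift_bij:
  assumes g: "g \<in> carrier G"
  shows "bij_betw (\<lambda>(n, x). (n, x #> g)) X X"
  by (rule bij_betwI[where g = "\<lambda>(n, x). (n, x #> inv g)"])
    (use g in \<open>auto simp: box_space_def Q_act Q_act_mult Q_act_one\<close>)

lemma shift_partial_translation:
  assumes g: "g \<in> carrier G"
  shows "shift g \<in> partial_translations X \<E>"
proof -
  let ?t = "\<lambda>(n, x). (n, x #> g)"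
  have "{(?t p, p) | p. p \<in> X} \<subseteq> (translates {g})\<inverse>"
    by (auto simp: translates_def box_space_def)
  then have "{(?t p, p) | p. p \<in> X} \<in> \<E>"
    using controlled_subset[OF coarse_ops(4)[OF translates_controlled[OF g]]] by blast
  then show ?thesis
    unfolding partial_translations_def shift_def using shift_bij[OF g]
    by (intro CollectI exI[of _ X] exI[of _ X] exI[of _ ?t]) simp
qed

lemma shift_range: "g \<in> carrier G \<Longrightarrow> mat_times (shift g) (mat_star (shift g)) = mat_one X"
  using shift_bij[of g] unfolding shift_def
  by (simp add: fun_eq_iff translation_matrix_range bij_betw_def mat_one_def)

lemma shift_entry:
  assumes "g \<in> carrier G" "x \<in> Q n" "y \<in> Q n"
  shows "shift g (n, x) (n, y) = (if y = x #> inv g then 1 else 0)"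
proof -
  have "y #> g = x \<longleftrightarrow> y = x #> inv g"
    using assms by (auto simp: Q_act_mult Q_act_one)
  then show ?thesis using assms by (auto simp: shift_def translation_matrix_def box_space_def)
qed

end

context twisted_box
begin

lemma op_shift:
  assumes "g \<in> carrier G" "x \<in> Q n"
  shows "op (shift g) f (n, x) = \<kappa> n x (x #> inv g) * f (n, x #> inv g)"
proof -
  have "op (shift g) f (n, x)
      = (\<Sum>y\<in>Q n. if y = x #> inv g then \<kappa> n x (x #> inv g) * f (n, x #> inv g) else 0)"
    unfolding op_def prod.case using assms by (intro sum.cong) (auto simp: shift_entry)
  also have "\<dots> = \<kappa> n x (x #> inv g) * f (n, x #> inv g)"
    using assms Q_act[of x n "inv g"] finite_quotient by simp
  finally show ?thesis .
qed

text \<open>A shift is a bijection of the whole space, so its range projection is the identity and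
  constancy says that the vector is fixed by every group element.\<close>

lemma constant_vector_shift:
  assumes \<eta>: "\<eta> \<in> constant_vectors X \<E> hilb rep" and g: "g \<in> carrier G" and h: "h \<in> bdd"
  shows "\<eta> \<in> bdd" "uip \<eta> h = uip (op (shift g) \<eta>) h"
proof -
  interpret R: representation X \<E> hilb rep by (rule representation_rep)
  show \<eta>B: "\<eta> \<in> bdd" using \<eta> by (simp add: constant_vectors_def hilb_carrier)
  have sh: "shift g \<in> translation_algebra \<E>"
    using shift_partial_translation[OF g] partial_translations_in_algebra by blast
  have "rep (shift g) \<eta> = rep (mat_one X) \<eta>"
    using \<eta> shift_partial_translation[OF g] shift_range[OF g] by (auto simp: constant_vectors_def)
  also have "\<dots> = \<eta>" using \<eta> by (intro R.rep_one) (simp add: constant_vectors_def)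
  finally show "uip \<eta> h = uip (op (shift g) \<eta>) h"
    using nf(2)[OF op_bdd[OF sh \<eta>B] h] by (simp add: rep_def)
qed

text \<open>A partial translation has at most one nonzero entry in each row, so at every point the
  displacement is either 0 or a twisted difference of two values along a pair in \<open>E\<close>.
  The representative \<open>d\<close> makes pointwise estimates possible.\<close>

lemma displacement:
  assumes v: "v \<in> partial_translations X \<E>" "mat_support v \<subseteq> E" and f: "f \<in> bdd"
  shows "\<exists>d\<in>bdd. hnorm hilb (rep (mat_times v (mat_star v)) (nf f) \<ominus>\<^bsub>hilb\<^esub> rep v (nf f)) = snorm d \<and>
    (\<forall>n. \<forall>x\<in>Q n. d (n, x) = 0 \<or>
       (\<exists>y\<in>Q n. ((n, x), (n, y)) \<in> E \<and> d (n, x) = \<kappa> n x x * f (n, x) - \<kappa> n x y * f (n, y)))"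
proof -
  obtain A B t where t: "v = translation_matrix A t" "A \<subseteq> X" "bij_betw t A B" "{(t x, x) | x. x \<in> A} \<in> \<E>"
    using v(1) by (auto simp: partial_translations_def)
  have inj: "inj_on t A" using t(3) by (simp add: bij_betw_def)
  have va: "v \<in> translation_algebra \<E>" using v(1) partial_translations_in_algebra by blast
  have vv: "mat_times v (mat_star v) \<in> translation_algebra \<E>"
    by (rule translation_algebra_times[OF coarse_structure_box bounded_geometry_box va
          translation_algebra_star[OF coarse_structure_box va]])
  let ?d = "\<lambda>p. op (mat_times v (mat_star v)) f p - op v f p"
  have bdd: "op (mat_times v (mat_star v)) f \<in> bdd" "op v f \<in> bdd" using op_bdd va vv f by auto
  have "hnorm hilb (rep (mat_times v (mat_star v)) (nf f) \<ominus>\<^bsub>hilb\<^esub> rep v (nf f)) = snorm ?d"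
  proof -
    have "nf (\<lambda>p. nf (op (mat_times v (mat_star v)) f) p - nf (op v f) p) = nf ?d"
      using bdd by (intro nf_eqI) (simp add: ip_diff nf)
    then show ?thesis
      using bdd by (simp add: rep_nf va vv f hilb_minus hilb_hnorm snorm_nf B_diff)
  qed
  moreover have "?d (n, x) = 0 \<or>
       (\<exists>y\<in>Q n. ((n, x), (n, y)) \<in> E \<and> ?d (n, x) = \<kappa> n x x * f (n, x) - \<kappa> n x y * f (n, y))"
    if x: "x \<in> Q n" for n x
  proof (cases "(n, x) \<in> t ` A")
    case False
    then have "t q \<noteq> (n, x)" if "q \<in> A" for q using that by (metis imageI)
    then have "op v f (n, x) = 0"
      unfolding op_def prod.case t(1) translation_matrix_def by (intro sum.neutral) auto
    moreover have "op (mat_times v (mat_star v)) f (n, x) = 0"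
      unfolding op_def prod.case t(1) translation_matrix_range[OF inj] using False by (intro sum.neutral) auto
    ultimately show ?thesis by simp
  next
    case True
    then obtain q where q: "q \<in> A" "t q = (n, x)" by force
    have tq: "(t q, q) \<in> mat_support v" using q(1) by (simp add: t(1) mat_support_def translation_matrix_def)
    obtain F where F: "mat_support v \<subseteq> translates F" "F \<subseteq> carrier G" using va by (rule algebraE)
    have "(t q, q) \<in> translates F" by (rule subsetD[OF F(1) tq])
    then obtain m z g where "t q = (m, z)" "q = (m, z #> g)" "g \<in> F" by (rule translatesE)
    then have "q = (n, x #> g)" "x #> g \<in> Q n" using q(2) F(2) Q_act[OF x] by auto
    then obtain y where y: "q = (n, y)" "y \<in> Q n" by simp
    have E: "((n, x), (n, y)) \<in> E" using subsetD[OF v(2) tq] q y by simp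
    have "op v f (n, x) = (\<Sum>z\<in>Q n. if z = y then \<kappa> n x y * f (n, y) else 0)"
      unfolding op_def prod.case
    proof (rule sum.cong[OF refl])
      fix z
      have "z = y" if "(n, z) \<in> A" "t (n, z) = (n, x)"
        using inj_onD[OF inj _ that(1) q(1)] that(2) q(2) y(1) by simp
      then have "(n, z) \<in> A \<and> t (n, z) = (n, x) \<longleftrightarrow> z = y" using q y by blast
      then have "v (n, x) (n, z) = (if z = y then 1 else 0)"
        by (simp add: t(1) translation_matrix_def)
      then show "v (n, x) (n, z) * \<kappa> n x z * f (n, z) = (if z = y then \<kappa> n x y * f (n, y) else 0)" by simp
    qed
    then have 1: "op v f (n, x) = \<kappa> n x y * f (n, y)" using y finite_quotient by simp
    have "op (mat_times v (mat_star v)) f (n, x) = (\<Sum>z\<in>Q n. if z = x then \<kappa> n x x * f (n, x) else 0)"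
      unfolding op_def prod.case t(1) translation_matrix_range[OF inj] using True by (intro sum.cong) auto
    then have "op (mat_times v (mat_star v)) f (n, x) = \<kappa> n x x * f (n, x)" using x finite_quotient by simp
    then show ?thesis using 1 y(2) E by auto
  qed
  ultimately show ?thesis using B_diff[OF bdd] by (intro bexI[of _ ?d]) auto
qed

lemma displaced:
  assumes D: "displaces_nonconstant_vectors X \<E> E c hilb rep"
    and orth: "nf f \<in> orthogonal_complement hilb (constant_vectors X \<E> hilb rep)" and f: "f \<in> bdd"
  shows "\<exists>d\<in>bdd. c * snorm f \<le> snorm d \<and> (\<forall>n. \<forall>x\<in>Q n. d (n, x) = 0 \<or>
       (\<exists>y\<in>Q n. ((n, x), (n, y)) \<in> E \<and> d (n, x) = \<kappa> n x x * f (n, x) - \<kappa> n x y * f (n, y)))"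
proof -
  obtain v where v: "v \<in> partial_translations X \<E>" "mat_support v \<subseteq> E"
    and le: "c * hnorm hilb (nf f) \<le> hnorm hilb (rep (mat_times v (mat_star v)) (nf f) \<ominus>\<^bsub>hilb\<^esub> rep v (nf f))"
    using bspec[OF D[unfolded displaces_nonconstant_vectors_def] orth] by auto
  obtain d where "d \<in> bdd"
    "hnorm hilb (rep (mat_times v (mat_star v)) (nf f) \<ominus>\<^bsub>hilb\<^esub> rep v (nf f)) = snorm d"
    and d: "\<forall>n. \<forall>x\<in>Q n. d (n, x) = 0 \<or>
       (\<exists>y\<in>Q n. ((n, x), (n, y)) \<in> E \<and> d (n, x) = \<kappa> n x x * f (n, x) - \<kappa> n x y * f (n, y))"
    using displacement[OF v f] by (elim bexE conjE) (rule that)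
  moreover have "hnorm hilb (nf f) = snorm f" using f by (simp add: hilb_hnorm snorm_nf)
  ultimately show ?thesis using le by (intro bexI[of _ d] conjI d) simp_all
qed

lemma lsnorm_le:
  assumes "\<And>x. x \<in> Q n \<Longrightarrow> cmod (f (n, x)) \<le> K" "K \<ge> 0"
  shows "L.snorm n f \<le> K"
proof (rule power2_le_imp_le)
  have "(\<Sum>x\<in>Q n. (cmod (f (n, x)))\<^sup>2) \<le> (\<Sum>x\<in>Q n. K\<^sup>2)"
    by (intro sum_mono power_mono assms) auto
  then show "(L.snorm n f)\<^sup>2 \<le> K\<^sup>2"
    using card_V_pos[of n] by (simp add: lsnorm_power2 divide_le_eq mult.commute)
qed (rule assms)

end

section \<open>Geometric property (T) implies expansion\<close>

context quotient_data
begin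

text \<open>With the principal ultrafilter at \<open>n\<close> and the trivial twist, the
  representation lives on the \<open>n\<close>-th quotient alone. Its constant vectors are invariant
  under all shifts, hence constant on that quotient, so mean-zero functions are orthogonal to them.
  Since \<open>c\<close> serves for all representations, the gap \<open>c\<^sup>2\<close> is uniform
  in \<open>n\<close>.\<close>

lemma geometric_property_T_imp_gap:
  assumes "geometric_property_T X \<E>"
  shows "\<exists>c>0. \<forall>n. \<forall>f :: 'a set \<Rightarrow> real. (\<Sum>x\<in>Q n. f x) = 0 \<longrightarrow>
      c * (\<Sum>x\<in>Q n. (f x)\<^sup>2) \<le> (\<Sum>(x, y)\<in>quotient_edges G S (N n). (f x - f y)\<^sup>2)"
proof -
  let ?E = "box_edges G S N \<union> Id_on X"
  obtain c where c: "c > 0" and disp: "\<And>(H :: (nat \<times> 'a set \<Rightarrow> complex) hilbert) \<pi>.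
      representation X \<E> H \<pi> \<Longrightarrow> displaces_nonconstant_vectors X \<E> ?E c H \<pi>"
    using geometric_property_T_box_any_type[OF assms generating_edges] by metis
  have "c\<^sup>2 * (\<Sum>x\<in>Q n. (f x)\<^sup>2) \<le> (\<Sum>(x, y)\<in>quotient_edges G S (N n). (f x - f y)\<^sup>2)"
    if mean: "(\<Sum>x\<in>Q n. f x) = 0" for n and f :: "'a set \<Rightarrow> real"
  proof -
    interpret twisted_box G S N "principal {n}" "\<lambda>_. 1" "\<lambda>_ _ _. 1"
      by unfold_locales (simp_all add: ultrafilter_principal)
    have uip: "uip h k = loc n h k" if "h \<in> bdd" "k \<in> bdd" for h k
      using that by (intro uip_eqI) (auto intro: tendsto_eventually simp: eventually_principal)
    have snorm: "snorm h = L.snorm n h" if "h \<in> bdd" for h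
      using that by (simp add: snorm_def L.snorm_def uip)
    define F where "F = (\<lambda>(m :: nat, x). complex_of_real (if m = n then f x else 0))"
    have F: "F \<in> bdd"
    proof (rule bddI)
      fix m
      have "L.snorm m F = L.snorm m (\<lambda>p. 0)" if "m \<noteq> n"
        using that by (intro lsnorm_cong) (simp add: F_def)
      then show "L.snorm m F \<le> L.snorm n F"
        using L.snorm_nonneg[of F n] by (cases "m = n") (auto simp: lsnorm_zero)
    qed
    have "nf F \<in> orthogonal_complement hilb (constant_vectors X \<E> hilb rep)"
      unfolding orthogonal_complement_def
    proof (intro CollectI conjI ballI)
      show "nf F \<in> carrier hilb" using F by simp
      fix \<eta> assume \<eta>: "\<eta> \<in> constant_vectors X \<E> hilb rep"
      have \<eta>B: "\<eta> \<in> bdd" by (rule constant_vector_shift(1)[OF \<eta> one_closed F])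
      have inv: "\<eta> (n, x) = \<eta> (n, x #> inv g)" if x: "x \<in> Q n" and g: "g \<in> carrier G" for x g
      proof -
        have sh: "shift g \<in> translation_algebra \<E>"
          using shift_partial_translation[OF g] partial_translations_in_algebra by blast
        let ?d = "\<lambda>p. \<eta> p - op (shift g) \<eta> p"
        have d: "?d \<in> bdd" by (intro B_diff \<eta>B op_bdd sh)
        have "uip ?d ?d = 0"
          using constant_vector_shift(2)[OF \<eta> g d] by (simp only: ip_diff \<eta>B op_bdd sh d) simp
        then have "L.snorm n ?d = 0" using snorm[OF d] by (simp add: snorm_def)
        then have "cmod (?d (n, x)) \<le> 0" using cmod_le_lsnorm[OF x, of ?d] by simp
        then show ?thesis using op_shift[OF g x, of \<eta>] by simp
      qed
      have const: "\<eta> (n, x) = \<eta> (n, N n)" if x: "x \<in> Q n" for x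
      proof -
        obtain g where g: "g \<in> carrier G" "x = N n #> g" using x by (rule quotient_carrierE)
        then show ?thesis using inv[OF N_in_quotient, of "inv g"] by simp
      qed
      have "uip (nf F) \<eta> = loc n F \<eta>" by (simp only: nf(2)[OF F \<eta>B] uip[OF F \<eta>B])
      also have "\<dots> = (\<Sum>x\<in>Q n. of_real (f x) * cnj (\<eta> (n, N n))) / of_nat (card (Q n))"
        unfolding loc_def by (simp add: F_def const cong: sum.cong)
      also have "\<dots> = of_real (\<Sum>x\<in>Q n. f x) * cnj (\<eta> (n, N n)) / of_nat (card (Q n))"
        by (simp add: sum_distrib_right)
      finally show "cinner hilb (nf F) \<eta> = 0" using mean by simp
    qed
    from displaced[OF disp[OF representation_rep] this F] obtain d where d: "d \<in> bdd"
      "c * snorm F \<le> snorm d"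
      "\<And>m x. x \<in> Q m \<Longrightarrow> d (m, x) = 0 \<or>
       (\<exists>y\<in>Q m. ((m, x), (m, y)) \<in> ?E \<and> d (m, x) = 1 * F (m, x) - 1 * F (m, y))"
      by auto
    then have le: "c * L.snorm n F \<le> L.snorm n d"
      using F by (simp add: snorm)
    have fin: "finite {y. (x, y) \<in> quotient_edges G S (N n)}" for x
      by (rule finite_subset[OF _ finite_quotient[of n]]) (use quotient_edges_subset in auto)
    \<comment> \<open>Which edge leaves \<open>x\<close> is not known, so its contribution is
      bounded by the sum over all edges at \<open>x\<close>.\<close>
    have dle: "(cmod (d (n, x)))\<^sup>2 \<le> (\<Sum>y | (x, y) \<in> quotient_edges G S (N n). (f x - f y)\<^sup>2)"
      if x: "x \<in> Q n" for x
    proof (cases "d (n, x) = 0")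
      case True
      then show ?thesis by (simp add: sum_nonneg)
    next
      case False
      then obtain y where y: "((n, x), (n, y)) \<in> ?E" "d (n, x) = of_real (f x - f y)"
        using d(3)[OF x] by (auto simp: F_def)
      then have "(x, y) \<in> quotient_edges G S (N n)" using False by (auto simp: box_edges_def)
      then have "(f x - f y)\<^sup>2 \<le> (\<Sum>y | (x, y) \<in> quotient_edges G S (N n). (f x - f y)\<^sup>2)"
        using fin by (intro member_le_sum) auto
      moreover have "(cmod (d (n, x)))\<^sup>2 = (f x - f y)\<^sup>2" unfolding y(2) norm_of_real by simp
      ultimately show ?thesis by simp
    qed
    have "c\<^sup>2 * (\<Sum>x\<in>Q n. (f x)\<^sup>2) = (c * L.snorm n F)\<^sup>2 * card (Q n)"
      using card_V_pos[of n] by (simp add: power_mult_distrib lsnorm_power2 F_def)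
    also have "\<dots> \<le> (L.snorm n d)\<^sup>2 * card (Q n)"
      using le c L.snorm_nonneg[of F n] by (intro mult_right_mono power_mono) auto
    also have "\<dots> = (\<Sum>x\<in>Q n. (cmod (d (n, x)))\<^sup>2)"
      using card_V_pos[of n] by (simp add: lsnorm_power2)
    also have "\<dots> \<le> (\<Sum>x\<in>Q n. \<Sum>y | (x, y) \<in> quotient_edges G S (N n). (f x - f y)\<^sup>2)"
      by (rule sum_mono[OF dle])
    also have "\<dots> = (\<Sum>(x, y)\<in>quotient_edges G S (N n). (f x - f y)\<^sup>2)"
    proof -
      have "quotient_edges G S (N n) = Sigma (Q n) (\<lambda>x. {y. (x, y) \<in> quotient_edges G S (N n)})"
        using quotient_edges_subset by auto
      then show ?thesis using fin finite_quotient by (subst sum.Sigma) auto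
    qed
    finally show ?thesis .
  qed
  then show ?thesis using c by (intro exI[of _ "c\<^sup>2"]) simp
qed

theorem geometric_property_T_imp_expander:
  assumes "geometric_property_T X \<E>"
  shows "expander (\<lambda>n. quotient_graph G S (N n))"
proof -
  obtain c where "c > 0" and "\<And>n f :: 'a set \<Rightarrow> real. (\<Sum>x\<in>Q n. f x) = 0 \<Longrightarrow>
      c * (\<Sum>x\<in>Q n. (f x)\<^sup>2) \<le> (\<Sum>(x, y)\<in>quotient_edges G S (N n). (f x - f y)\<^sup>2)"
    using geometric_property_T_imp_gap[OF assms] by auto
  then show ?thesis by (rule expander_quotientI)
qed

end

section \<open>Infinite abelianization excludes geometric property (T)\<close>

lemma cmod_one_minus_cis_le: "cmod (1 - cis a) \<le> \<bar>a\<bar>"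
proof (rule power2_le_imp_le)
  have "(cmod (1 - cis a))\<^sup>2 = (1 - cos a)\<^sup>2 + (sin a)\<^sup>2" by (simp add: cmod_power2)
  also have "\<dots> = 2 - 2 * cos (2 * (a / 2))"
    using sin_cos_squared_add[of a] by (simp add: power2_eq_square algebra_simps)
  also have "\<dots> = 4 * (sin (a / 2))\<^sup>2" unfolding cos_double_sin by simp
  also have "\<dots> \<le> 4 * (a / 2)\<^sup>2"
    using abs_sin_x_le_abs_x[of "a / 2"] unfolding abs_le_square_iff by (rule mult_left_mono) simp
  also have "\<dots> = \<bar>a\<bar>\<^sup>2" by (simp add: power2_eq_square)
  finally show "(cmod (1 - cis a))\<^sup>2 \<le> \<bar>a\<bar>\<^sup>2" .
qed simp

context quotient_data
begin

text \<open>The first group element, in some enumeration of \<open>G\<close>, that moves \<open>x\<close> to \<open>y\<close>. In the \<open>n\<close>-th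
  quotient it recovers each fixed \<open>g\<close> from \<open>(x, x #> g)\<close> as soon as \<open>n\<close> is large.\<close>

definition first_mover :: "'a set \<Rightarrow> 'a set \<Rightarrow> 'a" where
  "first_mover x y = arg_min (to_nat_on (carrier G)) (\<lambda>g. g \<in> carrier G \<and> y = x #> g)"

lemma eventually_first_mover:
  assumes cnt: "countable (carrier G)" and g: "g \<in> carrier G"
  shows "eventually (\<lambda>n. \<forall>x\<in>Q n. first_mover x (x #> g) = g) sequentially"
proof -
  let ?e = "to_nat_on (carrier G)"
  let ?D = "{h \<in> carrier G. ?e h \<le> ?e g}"
  have "finite (?e ` ?D)" by (rule finite_subset[of _ "{..?e g}"]) auto
  then have "finite ?D"
    by (rule finite_imageD) (rule inj_on_subset[OF inj_on_to_nat_on[OF cnt]], auto)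
  then obtain n0 where n0: "\<And>n. n \<ge> n0 \<Longrightarrow> (\<lambda>h. h \<otimes> inv g) ` ?D \<inter> N n \<subseteq> {\<one>}"
    using eventually_N_separates[of "(\<lambda>h. h \<otimes> inv g) ` ?D"] by auto
  have "first_mover x (x #> g) = g" if n: "n \<ge> n0" and x: "x \<in> Q n" for n x
  proof -
    let ?h = "first_mover x (x #> g)"
    have h: "?h \<in> carrier G" "x #> g = x #> ?h" "?e ?h \<le> ?e g"
      using arg_min_nat_lemma[of "\<lambda>h. h \<in> carrier G \<and> x #> g = x #> h" g ?e] g
      unfolding first_mover_def by auto
    have "?h \<otimes> inv g \<in> N n" using Q_act_eq_iff[OF x h(1) g] h(2) by simp
    then have "?h \<otimes> inv g = \<one>" using n0[OF n] h by auto
    then show ?thesis using h(1) g by (metis inv_equality inv_inv inv_closed)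
  qed
  then show ?thesis unfolding eventually_sequentially by blast
qed

text \<open>In the representation twisted by the character with small angle \<open>\<theta>\<close>,
  the constant function 1 is a unit vector that each shift multiplies by a value of the character.
  It is orthogonal to all constant vectors because one of these values is not 1, yet partial
  translations along the edges move it by less than \<open>c\<close>.\<close>

theorem not_geometric_property_T_if_hom_int:
  fixes \<phi> :: "'a \<Rightarrow> int"
  assumes cnt: "countable (carrier G)"
    and \<phi>: "\<And>g h. \<lbrakk>g \<in> carrier G; h \<in> carrier G\<rbrakk> \<Longrightarrow> \<phi> (g \<otimes> h) = \<phi> g + \<phi> h"
    and g: "g \<in> carrier G" "\<phi> g \<noteq> 0"
  shows "\<not> geometric_property_T X \<E>"
proof
  assume T: "geometric_property_T X \<E>"
  let ?E = "box_edges G S N \<union> Id_on X"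
  obtain c where c: "c > 0" and disp: "\<And>(H :: (nat \<times> 'a set \<Rightarrow> complex) hilbert) \<pi>.
      representation X \<E> H \<pi> \<Longrightarrow> displaces_nonconstant_vectors X \<E> ?E c H \<pi>"
    using geometric_property_T_box_any_type[OF T generating_edges] by metis
  have "finite (insert 0 ((\<lambda>s. \<bar>\<phi> s\<bar>) ` S))" using finite_gens by simp
  then obtain M where "\<forall>m\<in>insert 0 ((\<lambda>s. \<bar>\<phi> s\<bar>) ` S). m \<le> M"
    using bounded_imp_bdd_above[OF finite_imp_bounded] by (meson Max_ge)
  then have M: "M \<ge> 0" "\<And>s. s \<in> S \<Longrightarrow> \<bar>\<phi> s\<bar> \<le> M" by auto
  \<comment> \<open>The first bound makes the displacement along generators, at most
    \<open>\<theta> * M\<close>, smaller than \<open>c\<close>; the summand 1 covers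
    \<open>M = 0\<close>. The second keeps \<open>\<theta> * \<bar>\<phi> g\<bar>\<close> at most 1,
    so that the character is nontrivial at \<open>g\<close>.\<close>
  define \<theta> :: real where "\<theta> = min (c / (2 * (M + 1))) (1 / \<bar>\<phi> g\<bar>)"
  have M1: "real_of_int M + 1 > 0" using M(1) by simp
  have \<theta>0: "\<theta> > 0" unfolding \<theta>_def using c M1 g(2) by (simp add: add.commute)
  have \<theta>1: "\<theta> * \<bar>\<phi> g\<bar> \<le> 1"
  proof -
    have "\<theta> \<le> 1 / \<bar>\<phi> g\<bar>" unfolding \<theta>_def by simp
    then show ?thesis using g(2) by (simp add: le_divide_eq)
  qed
  have \<theta>c: "\<theta> * M < c"
  proof -
    have "\<theta> * (M + 1) \<le> c / (2 * (M + 1)) * (M + 1)"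
      unfolding \<theta>_def using M1 by (intro mult_right_mono) auto
    also have "\<dots> = c / 2" using M1 by (simp add: field_simps)
    finally show ?thesis using \<theta>0 c by (simp add: algebra_simps)
  qed
  obtain U :: "nat filter" where U: "U \<le> sequentially" "ultrafilter U"
    using ultrafilter_exists[of sequentially] by auto
  have \<phi>_one: "\<phi> \<one> = 0" using \<phi>[of \<one> \<one>] by simp
  interpret twisted_box G S N U "\<lambda>g. cis (\<theta> * \<phi> g)" "\<lambda>n x y. cis (\<theta> * \<phi> (first_mover x y))"
  proof unfold_locales
    show "cis (\<theta> * \<phi> (g \<otimes> h)) = cis (\<theta> * \<phi> g) * cis (\<theta> * \<phi> h)"
      if "g \<in> carrier G" "h \<in> carrier G" for g h
      using that by (simp add: \<phi> cis_mult distrib_left)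
    show "eventually (\<lambda>n. \<forall>x\<in>Q n. cis (\<theta> * \<phi> (first_mover x (x #> g))) = cis (\<theta> * \<phi> g)) U"
      if "g \<in> carrier G" for g
      using filter_leD[OF U(1) eventually_first_mover[OF cnt that]] by (rule eventually_mono) simp
  qed (use U in simp_all)
  let ?\<tau> = "\<lambda>g. cis (\<theta> * \<phi> g)" and ?\<kappa> = "\<lambda>x y. cis (\<theta> * \<phi> (first_mover x y))"
  let ?one = "\<lambda>p :: nat \<times> 'a set. 1 :: complex"
  have loc1: "loc n ?one ?one = 1" for n using card_V_pos[of n] by (simp add: loc_def)
  then have L1: "L.snorm n ?one = 1" for n by (simp add: L.snorm_def)
  have one: "?one \<in> bdd" by (rule bddI[of _ 1]) (simp add: L1)
  have "nf ?one \<in> orthogonal_complement hilb (constant_vectors X \<E> hilb rep)"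
    unfolding orthogonal_complement_def
  proof (intro CollectI conjI ballI)
    show "nf ?one \<in> carrier hilb" using one by simp
    fix \<eta> assume \<eta>: "\<eta> \<in> constant_vectors X \<E> hilb rep"
    have \<eta>B: "\<eta> \<in> bdd" by (rule constant_vector_shift(1)[OF \<eta> one_closed one])
    have sh: "shift g \<in> translation_algebra \<E>"
      using shift_partial_translation[OF g(1)] partial_translations_in_algebra by blast
    \<comment> \<open>Invariance of \<open>\<eta>\<close> under the shift by \<open>g\<close>, and
      invariance of the counting measure under translation, make this inner product equal to itself
      times the character value at the inverse of \<open>g\<close>; so it is zero.\<close>
    have "uip \<eta> ?one = uip (op (shift g) \<eta>) ?one" by (rule constant_vector_shift(2)[OF \<eta> g(1) one])
    also have "\<dots> = uip (\<lambda>p. ?\<tau> (inv g) * \<eta> p) ?one"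
    proof (rule uip_eventually_cong[OF op_bdd[OF sh \<eta>B] one B_scale[OF \<eta>B] one])
      show "\<forall>\<^sub>F n in U. loc n (op (shift g) \<eta>) ?one = loc n (\<lambda>p. ?\<tau> (inv g) * \<eta> p) ?one"
        using \<kappa>_\<tau>[OF inv_closed[OF g(1)]]
      proof (rule eventually_mono)
        fix n assume *: "\<forall>x\<in>Q n. ?\<kappa> x (x #> inv g) = ?\<tau> (inv g)"
        have "(\<Sum>x\<in>Q n. op (shift g) \<eta> (n, x)) = (\<Sum>x\<in>Q n. ?\<tau> (inv g) * \<eta> (n, x #> inv g))"
          using op_shift[OF g(1)] * by (intro sum.cong) auto
        also have "\<dots> = (\<Sum>x\<in>Q n. ?\<tau> (inv g) * \<eta> (n, x))"
          using finite_right_action.act_bij[OF quotient_right_action inv_closed[OF g(1)]]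
          by (rule sum.reindex_bij_betw)
        finally show "loc n (op (shift g) \<eta>) ?one = loc n (\<lambda>p. ?\<tau> (inv g) * \<eta> p) ?one"
          by (simp add: loc_def)
      qed
    qed
    also have "\<dots> = ?\<tau> (inv g) * uip \<eta> ?one" by (rule ip_scale[OF \<eta>B one])
    finally have "(1 - ?\<tau> (inv g)) * uip \<eta> ?one = 0" by (simp add: algebra_simps)
    moreover have "?\<tau> (inv g) \<noteq> 1"
    proof
      have "\<phi> (inv g) = - \<phi> g" using \<phi>[of g "inv g"] g(1) \<phi>_one by simp
      moreover assume "?\<tau> (inv g) = 1"
      ultimately have "sin (\<theta> * \<phi> g) = 0" by (simp add: complex_eq_iff)
      moreover have "sin (\<theta> * \<bar>\<phi> g\<bar>) > 0"
        using \<theta>0 \<theta>1 g(2) pi_gt3 by (intro sin_gt_zero) auto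
      ultimately show False by (cases "\<phi> g \<ge> 0") auto
    qed
    ultimately have "uip \<eta> ?one = 0" by simp
    then show "cinner hilb (nf ?one) \<eta> = 0"
      using one \<eta>B ip_cnj[OF one \<eta>B] by (simp add: nf)
  qed
  from displaced[OF disp[OF representation_rep] this one] obtain d where d: "d \<in> bdd" "c * snorm ?one \<le> snorm d"
    and dE: "\<And>n x. x \<in> Q n \<Longrightarrow> d (n, x) = 0 \<or>
       (\<exists>y\<in>Q n. ((n, x), (n, y)) \<in> ?E \<and> d (n, x) = ?\<kappa> x x - ?\<kappa> x y)"
    by auto
  have "snorm ?one = 1" by (simp add: snorm_def uip_eqI[OF one one, of 1] loc1)
  moreover have "snorm d \<le> \<theta> * M"
  proof (rule snorm_le[OF d(1)])
    have S: "finite (insert \<one> S)" "insert \<one> S \<subseteq> carrier G" using finite_gens gens_closed by auto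
    show "\<forall>\<^sub>F n in U. L.snorm n d \<le> \<theta> * M"
      using eventually_\<kappa>[OF S]
    proof (rule eventually_mono)
      fix n assume *: "\<forall>s\<in>insert \<one> S. \<forall>x\<in>Q n. ?\<kappa> x (x #> s) = ?\<tau> s"
      show "L.snorm n d \<le> \<theta> * M"
      proof (rule lsnorm_le)
        fix x assume x: "x \<in> Q n"
        have xx: "?\<kappa> x x = 1" using bspec[OF bspec[OF *, of \<one>] x] Q_act_one[OF x] \<phi>_one by simp
        show "cmod (d (n, x)) \<le> \<theta> * M"
        proof (cases "d (n, x) = 0")
          case True
          then show ?thesis using \<theta>0 M by simp
        next
          case False
          then obtain y where y: "((n, x), (n, y)) \<in> ?E" "d (n, x) = ?\<kappa> x x - ?\<kappa> x y" using dE[OF x] by auto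
          have "x \<noteq> y" using False y(2) by auto
          then obtain s where s: "s \<in> S" "y = x #> s"
            using y(1) by (auto simp: box_edges_def quotient_edges_iff)
          have "?\<kappa> x y = ?\<tau> s" using bspec[OF bspec[OF *, of s] x] s by simp
          then have "cmod (d (n, x)) \<le> \<bar>\<theta> * \<phi> s\<bar>" unfolding y(2) xx by (simp add: cmod_one_minus_cis_le)
          also have "\<dots> = \<theta> * \<bar>\<phi> s\<bar>" using \<theta>0 by (simp add: abs_mult)
          also have "\<dots> \<le> \<theta> * M" using M(2)[OF s(1)] \<theta>0 by simp
          finally show ?thesis .
        qed
      qed (use \<theta>0 M in simp)
    qed
  qed
  ultimately show False using d(2) \<theta>c by simp
qed

end

section \<open>Elementary matrices over a ring of additive operators\<close>

text \<open>Fermat's little theorem: the cube serves as the inverse in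
  \<open>scaled_bij\<close>.\<close>

lemma type_5_inverse: "(k :: 5) \<noteq> 0 \<Longrightarrow> k * (k * k * k) = 1"
proof -
  assume k: "k \<noteq> 0"
  have five: "(5 :: 5) = 0" by simp
  obtain z where z: "k = of_int z" "0 \<le> z" "z < 5" by (cases k rule: bit1_cases) auto
  then have "z = 0 \<or> z = 1 \<or> z = 2 \<or> z = 3 \<or> z = 4" by arith
  then show ?thesis using z(1) k by (elim disjE) simp_all
qed

lemma finite_5: "finite (UNIV :: 5 set)" by simp
datatype idx = I1 | I2 | I3

definition additive_op :: "('m::ab_group_add \<Rightarrow> 'm) \<Rightarrow> bool" where
  "additive_op r \<longleftrightarrow> (\<forall>x y. r (x + y) = r x + r y)"

lemma additive_opD:
  assumes "additive_op r"
  shows "r (x + y) = r x + r y" "r 0 = 0" "r (- x) = - r x" "r (x - y) = r x - r y"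
proof -
  show a: "r (x + y) = r x + r y" for x y using assms by (simp add: additive_op_def)
  show z: "r 0 = 0" using a[of 0 0] by simp
  show m: "r (- x) = - r x" for x using a[of x "- x"] z by (simp add: eq_neg_iff_add_eq_0 add.commute)
  show "r (x - y) = r x - r y" using a[of x "- y"] m[of y] by simp
qed

text \<open>The elementary matrix with entry \<open>r\<close> in position \<open>i\<close>,
  \<open>j\<close>, acting on column vectors. Entries are operators rather than ring elements, so
  the product of entries is composition and matrix groups are groups of bijections.\<close>

definition elem :: "idx \<Rightarrow> idx \<Rightarrow> ('m::ab_group_add \<Rightarrow> 'm) \<Rightarrow> (idx \<Rightarrow> 'm) \<Rightarrow> idx \<Rightarrow> 'm" where
  "elem i j r F = F(i := F i + r (F j))"

lemma elem_add: "i \<noteq> j \<Longrightarrow> elem i j r \<circ> elem i j s = elem i j (\<lambda>x. r x + s x)"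
  by (simp add: elem_def fun_eq_iff add_ac)

lemma elem_zero: "elem i j (\<lambda>x. 0) = id"
  by (simp add: elem_def fun_eq_iff)

lemma elem_inverse:
  "i \<noteq> j \<Longrightarrow> elem i j r \<circ> elem i j (\<lambda>x. - r x) = id"
  "i \<noteq> j \<Longrightarrow> elem i j (\<lambda>x. - r x) \<circ> elem i j r = id"
  by (simp_all add: elem_add elem_zero)

lemma elem_inject: "i \<noteq> j \<Longrightarrow> elem i j r = elem i j s \<longleftrightarrow> r = s"
proof
  assume ij: "i \<noteq> j" and eq: "elem i j r = elem i j s"
  show "r = s"
  proof
    fix x
    have "elem i j r ((\<lambda>_. 0)(j := x)) i = elem i j s ((\<lambda>_. 0)(j := x)) i" using eq by simp
    then show "r x = s x" using ij by (simp add: elem_def)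
  qed
qed simp

lemma elem_commutator:
  assumes "additive_op r" "i \<noteq> j" "j \<noteq> k" "i \<noteq> k"
  shows "elem i j r \<circ> elem j k s \<circ> elem i j (\<lambda>x. - r x) \<circ> elem j k (\<lambda>x. - s x) = elem i k (\<lambda>x. r (s x))"
  using assms(2-) by (auto simp: elem_def fun_eq_iff additive_opD[OF assms(1)])

text \<open>The same relation in the order of factors that the hypothesis \<open>bij\<close> of the
  angle estimate demands.\<close>

lemma elem_commutator':
  assumes "additive_op r" "i \<noteq> j" "j \<noteq> k" "i \<noteq> k"
  shows "elem j k (\<lambda>x. - s x) \<circ> elem i j (\<lambda>x. - r x) \<circ> elem j k s \<circ> elem i j r = elem i k (\<lambda>x. - r (s x))"
  using assms(2-) by (auto simp: elem_def fun_eq_iff additive_opD[OF assms(1)])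

lemma elem_commutes:
  assumes "i \<noteq> j" "j \<noteq> k" "i \<noteq> k"
  shows "elem i j r \<circ> elem i k s = elem i k s \<circ> elem i j r"
    and "elem j k r \<circ> elem i k s = elem i k s \<circ> elem j k r"
  using assms by (auto simp: elem_def fun_eq_iff add_ac)

definition diag1 :: "idx \<Rightarrow> ('m \<Rightarrow> 'm) \<Rightarrow> (idx \<Rightarrow> 'm) \<Rightarrow> idx \<Rightarrow> 'm" where
  "diag1 i x F = F(i := x (F i))"

text \<open>Whitehead's identity: the first three factors form a monomial matrix built from
  \<open>x\<close>, the last three the inverse of the one built from the identity.\<close>

lemma elem_diag2:
  assumes x: "additive_op x" "additive_op x'" "\<And>f. x (x' f) = f" "\<And>f. x' (x f) = f" and ij: "i \<noteq> j"
  shows "elem i j x \<circ> elem j i (\<lambda>f. - x' f) \<circ> elem i j x \<circ> elem i j (\<lambda>f. - f) \<circ> elem j i (\<lambda>f. f) \<circ> elem i j (\<lambda>f. - f)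
    = diag1 i x \<circ> diag1 j x'"
  using ij by (auto simp: elem_def diag1_def fun_eq_iff additive_opD[OF x(1)] additive_opD[OF x(2)] x(3,4))

text \<open>The inverses are placed in two different positions \<open>j\<close> and
  \<open>k\<close>, where they cancel; only position \<open>i\<close> sees the commutator of
  \<open>x\<close> and \<open>y\<close>.\<close>

lemma diag2_commutator:
  assumes "i \<noteq> j" "j \<noteq> k" "i \<noteq> k" "\<And>f. x (x' f) = f" "\<And>f. x' (x f) = f" "\<And>f. y (y' f) = f" "\<And>f. y' (y f) = f"
  shows "(diag1 i x \<circ> diag1 j x') \<circ> (diag1 i y \<circ> diag1 k y') \<circ> (diag1 i x' \<circ> diag1 j x) \<circ> (diag1 i y' \<circ> diag1 k y)
    = diag1 i (\<lambda>f. x (y (x' (y' f))))"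
  using assms by (auto simp: diag1_def fun_eq_iff)

section \<open>The ring and its finite levels\<close>

text \<open>Integer quadruples carry the group law of the fibre product of two Heisenberg groups over
  their abelianization: the two central coordinates \<open>u\<close> and \<open>v\<close> are both increased by the
  commutator form. The kernels of the finite levels are congruence subgroups with modulus a power of
  two in \<open>u\<close> and a power of three in \<open>v\<close>.\<close>

type_synonym heis = "int \<times> int \<times> int \<times> int"

fun hmul :: "heis \<Rightarrow> heis \<Rightarrow> heis" where
  "hmul (x, y, u, v) (x', y', u', v') = (x + x', y + y', u + u' + x * y', v + v' + x * y')"

text \<open>Composition reverses the order, as \<open>ltr_ltr\<close> shows; this accounts for the
  products \<open>hmul b a\<close> and for a sign in \<open>lam_diag_all\<close>.\<close>

definition ltr :: "heis \<Rightarrow> (heis \<Rightarrow> 5) \<Rightarrow> heis \<Rightarrow> 5" where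
  "ltr a f h = f (hmul a h)"

lemma ltr_additive: "additive_op (ltr a)"
  by (simp add: additive_op_def ltr_def fun_eq_iff)

lemma hmul_assoc: "hmul (hmul a b) c = hmul a (hmul b c)"
  by (cases a; cases b; cases c) (simp add: algebra_simps)

lemma ltr_ltr: "ltr a (ltr b f) = ltr (hmul b a) f"
  by (simp add: ltr_def fun_eq_iff hmul_assoc)

lemma ltr_one: "ltr (0, 0, 0, 0) f = f"
  by (auto simp: ltr_def fun_eq_iff)

definition scal :: "5 \<Rightarrow> (heis \<Rightarrow> 5) \<Rightarrow> heis \<Rightarrow> 5" where
  "scal k f h = k * f h"

lemma scal_additive: "additive_op (scal k)"
  by (simp add: additive_op_def scal_def fun_eq_iff algebra_simps)

text \<open>The first two coordinates are taken modulo \<open>6 ^ n\<close>, a common multiple of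
  the two central moduli, so that the commutator form is well defined in both central
  coordinates.\<close>

fun level_cong :: "nat \<Rightarrow> heis \<Rightarrow> heis \<Rightarrow> bool" where
  "level_cong n (x, y, u, v) (x', y', u', v') \<longleftrightarrow>
     6 ^ n dvd x - x' \<and> 6 ^ n dvd y - y' \<and> 2 ^ n dvd u - u' \<and> 3 ^ n dvd v - v'"

definition level :: "nat \<Rightarrow> (heis \<Rightarrow> 5) set" where
  "level n = {f. \<forall>p q. level_cong n p q \<longrightarrow> f p = f q}"

lemma level_cong_hmul: "level_cong n p q \<Longrightarrow> level_cong n (hmul a p) (hmul a q)"
proof (cases a; cases p; cases q)
  fix x0 y0 u0 v0 x y u v x' y' u' v' :: int
  assume *: "level_cong n p q" "a = (x0, y0, u0, v0)" "p = (x, y, u, v)" "q = (x', y', u', v')"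
  have d: "(2::int) ^ n dvd 6 ^ n" "(3::int) ^ n dvd 6 ^ n"
    using dvd_power_same[of 2 "6::int" n] dvd_power_same[of 3 "6::int" n] by simp_all
  have "2 ^ n dvd x0 * (y - y')" "3 ^ n dvd x0 * (y - y')"
    using * d by (auto intro: dvd_mult dvd_trans)
  then have "2 ^ n dvd (u - u') + x0 * (y - y')" "3 ^ n dvd (v - v') + x0 * (y - y')"
    using * by (auto intro: dvd_add)
  then show ?thesis using * by (simp add: algebra_simps)
qed

lemma levelD: "\<lbrakk>f \<in> level n; level_cong n p q\<rbrakk> \<Longrightarrow> f p = f q"
  unfolding level_def by blast

lemma levelI: "(\<And>p q. level_cong n p q \<Longrightarrow> f p = f q) \<Longrightarrow> f \<in> level n"
  unfolding level_def by blast

lemma ltr_level: "f \<in> level n \<Longrightarrow> ltr a f \<in> level n"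
  by (rule levelI) (simp add: ltr_def levelD level_cong_hmul)

lemma level_add:
  assumes "f \<in> level n" "g \<in> level n"
  shows "f + g \<in> level n"
proof (rule levelI)
  fix p q assume "level_cong n p q"
  from levelD[OF assms(1) this] levelD[OF assms(2) this] show "(f + g) p = (f + g) q" by simp
qed

lemma level_scal: "f \<in> level n \<Longrightarrow> scal k f \<in> level n"
  using levelD[of f n] by (intro levelI) (metis scal_def)

lemma level_mono: "f \<in> level n \<Longrightarrow> f \<in> level (Suc n)"
proof -
  assume f: "f \<in> level n"
  have d: "b ^ n dvd z" if "b ^ Suc n dvd z" for b z :: int
    by (rule dvd_trans[OF _ that]) simp
  have "level_cong n p q" if "level_cong (Suc n) p q" for p q
  proof (cases p; cases q)
    fix x y u v x' y' u' v' assume "p = (x, y, u, v)" "q = (x', y', u', v')"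
    then show ?thesis
      using that d[of 6 "x - x'"] d[of 6 "y - y'"] d[of 2 "u - u'"] d[of 3 "v - v'"]
      by (simp del: power_Suc)
  qed
  then show ?thesis by (intro levelI levelD[OF f])
qed

lemma finite_level: "finite (level n)"
proof -
  define B :: "heis set" where "B = {0..<6 ^ n} \<times> {0..<6 ^ n} \<times> {0..<2 ^ n} \<times> {0..<3 ^ n}"
  have "finite B" unfolding B_def by simp
  have "(\<lambda>f. restrict f B) ` level n \<subseteq> B \<rightarrow>\<^sub>E UNIV"
    by (intro image_subsetI) (simp add: restrict_PiE_iff)
  moreover have "finite (B \<rightarrow>\<^sub>E (UNIV :: 5 set))" by (intro finite_PiE \<open>finite B\<close> finite_5)
  ultimately have "finite ((\<lambda>f. restrict f B) ` level n)" by (rule finite_subset)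
  then show ?thesis
  proof (rule finite_imageD)
    show "inj_on (\<lambda>f. restrict f B) (level n)"
    proof (rule inj_onI)
      fix f g assume fg: "f \<in> level n" "g \<in> level n" "restrict f B = restrict g B"
      show "f = g"
      proof
        fix p :: heis
        obtain x y u v where p: "p = (x, y, u, v)" by (cases p)
        define q where "q = (x mod 6 ^ n, y mod 6 ^ n, u mod 2 ^ n, v mod 3 ^ n)"
        have c: "level_cong n p q" unfolding p q_def by (simp add: minus_mod_eq_mult_div)
        have "q \<in> B" by (simp add: q_def B_def)
        then have "f q = g q" using fun_cong[OF fg(3), of q] by simp
        then show "f p = g p" using levelD[OF fg(1) c] levelD[OF fg(2) c] by simp
      qed
    qed
  qed
qed

lemma level_separates:
  assumes "finite D"
  obtains n where "n \<ge> m" "\<And>p q. \<lbrakk>p \<in> D; q \<in> D; level_cong n p q\<rbrakk> \<Longrightarrow> p = q"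
proof -
  let ?co = "\<lambda>p :: heis. {fst p, fst (snd p), fst (snd (snd p)), snd (snd (snd p))}"
  let ?C = "\<Union>p\<in>D. ?co p"
  have "finite ?C" using assms by simp
  then obtain K where "\<forall>z\<in>abs ` ?C. z \<le> K" by (meson Max_ge finite_imageI)
  then have K: "\<bar>z\<bar> \<le> K" if "z \<in> ?C" for z using that by auto
  define n where "n = max m (nat (2 * K + 1))"
  have "int (nat (2 * K + 1)) < 2 ^ n"
    using of_nat_less_two_power[of n] unfolding n_def by (smt (verit) of_nat_mono max.cobounded2)
  then have n: "2 * K < 2 ^ n" by linarith
  have n3: "(2::int) ^ n \<le> 3 ^ n" "(2::int) ^ n \<le> 6 ^ n" by (intro power_mono; simp)+
  have eq: "z = w" if "z \<in> ?C" "w \<in> ?C" "b dvd z - w" "2 ^ n \<le> b" for z w b :: int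
  proof (rule ccontr)
    assume "z \<noteq> w"
    then have "b \<le> \<bar>z - w\<bar>" using that(3) by (intro zdvd_imp_le) (auto)
    then show False using K[OF that(1)] K[OF that(2)] n that(4) by linarith
  qed
  have "p = q" if "p \<in> D" "q \<in> D" "level_cong n p q" for p q
  proof (cases p; cases q)
    fix x y u v x' y' u' v' assume pq: "p = (x, y, u, v)" "q = (x', y', u', v')"
    have "?co p \<subseteq> ?C" "?co q \<subseteq> ?C" using that by blast+
    then show "p = q"
      using that(3) eq[of x x' "6 ^ n"] eq[of y y' "6 ^ n"] eq[of u u' "2 ^ n"] eq[of v v' "3 ^ n"] n3
      unfolding pq by auto
  qed
  then show ?thesis by (intro that[of n]) (auto simp: n_def)
qed

text \<open>Density of the finite levels: for large \<open>n\<close> the points of \<open>D\<close>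
  are pairwise incongruent, so any values on \<open>D\<close> extend to a function of level
  \<open>n\<close>.\<close>

lemma level_interpolates:
  assumes "finite D"
  shows "\<exists>n\<ge>m. \<forall>f. \<exists>f'\<in>level n. \<forall>p\<in>D. f' p = f p"
proof -
  obtain n where n: "n \<ge> m" "\<And>p q. \<lbrakk>p \<in> D; q \<in> D; level_cong n p q\<rbrakk> \<Longrightarrow> p = q"
    using level_separates[OF assms, of m] by blast
  have refl: "level_cong n p p" for p by (cases p) simp
  have sym: "level_cong n p q \<Longrightarrow> level_cong n q p" for p q
    by (cases p; cases q) (auto simp: dvd_diff_commute)
  have trans: "level_cong n p r" if "level_cong n p q" "level_cong n q r" for p q r
  proof (cases p; cases q; cases r)
    fix x y u v x' y' u' v' x'' y'' u'' v''
    assume "p = (x, y, u, v)" "q = (x', y', u', v')" "r = (x'', y'', u'', v'')"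
    then show ?thesis
      using that dvd_add[of "6 ^ n" "x - x'" "x' - x''"] dvd_add[of "6 ^ n" "y - y'" "y' - y''"]
        dvd_add[of "2 ^ n" "u - u'" "u' - u''"] dvd_add[of "3 ^ n" "v - v'" "v' - v''"] by simp
  qed
  have "\<exists>f'\<in>level n. \<forall>p\<in>D. f' p = f p" for f
  proof -
    define f' where "f' p = (if \<exists>q\<in>D. level_cong n p q then f (SOME q. q \<in> D \<and> level_cong n p q) else 0)" for p
    have "f' p = f p" if p: "p \<in> D" for p
    proof -
      have "(SOME q. q \<in> D \<and> level_cong n p q) = p"
        by (rule some_equality) (use p refl n(2)[OF p] in blast)+
      then show ?thesis using p refl[of p] by (auto simp: f'_def simp del: split_paired_Ex)
    qed
    moreover have "f' \<in> level n"
    proof (rule levelI)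
      fix p q assume "level_cong n p q"
      then have "level_cong n p r \<longleftrightarrow> level_cong n q r" for r using sym trans by blast
      then show "f' p = f' q" by (simp only: f'_def)
    qed
    ultimately show ?thesis by blast
  qed
  then show ?thesis using n(1) by blast
qed

text \<open>Chinese remainder theorem: \<open>m\<close> is divisible by \<open>2 ^ n\<close> and
  congruent to 1 modulo \<open>3 ^ n\<close>. The diagonal central element with both coordinates
  \<open>m\<close> is a commutator, hence within reach of elementary matrices.\<close>

lemma central_shift_level:
  "\<exists>m :: int. \<forall>f\<in>level n. ltr (0, 0, 0, 1) f = ltr (0, 0, m, m) f"
proof -
  have "coprime ((2::int) ^ n) (3 ^ n)" by simp
  then obtain a b where ab: "a * 2 ^ n + b * 3 ^ n = (1::int)" using bezout_int[of "2 ^ n" "3 ^ n"] by auto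
  define m where "m = a * 2 ^ n"
  have m1: "1 - m = b * 3 ^ n" using ab by (simp add: m_def)
  have "level_cong n (hmul (0, 0, 0, 1) h) (hmul (0, 0, m, m) h)" for h
    using m1 by (cases h) (simp add: m_def)
  then have "ltr (0, 0, 0, 1) f = ltr (0, 0, m, m) f" if "f \<in> level n" for f
    using levelD[OF that] by (simp add: ltr_def fun_eq_iff del: split_paired_All)
  then show ?thesis by (intro exI[of _ m] ballI)
qed

section \<open>The group of operators\<close>

definition bijg :: "('v \<Rightarrow> 'v) monoid" where
  "bijg = \<lparr>carrier = {f. bij f}, mult = (\<circ>), one = id\<rparr>"

lemma bijg_simps [simp]: "carrier bijg = {f. bij f}" "f \<otimes>\<^bsub>bijg\<^esub> g = f \<circ> g" "\<one>\<^bsub>bijg\<^esub> = id"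
  by (simp_all add: bijg_def)

lemma group_bijg: "group bijg"
proof (rule groupI)
  fix f :: "'v \<Rightarrow> 'v" assume "f \<in> carrier bijg"
  then show "\<exists>g\<in>carrier bijg. g \<otimes>\<^bsub>bijg\<^esub> f = \<one>\<^bsub>bijg\<^esub>"
    by (intro bexI[of _ "inv_into UNIV f"]) (auto simp: bij_imp_bij_inv bij_is_inj)
qed (auto intro: bij_comp comp_assoc)

lemma bijg_inv_eqI: "\<lbrakk>f \<circ> g = id; g \<circ> f = id\<rbrakk> \<Longrightarrow> inv\<^bsub>bijg\<^esub> f = g"
  using group.inv_equality[OF group_bijg, of g f] o_bij[of g f] o_bij[of f g] by simp

definition scals :: "((heis \<Rightarrow> 5) \<Rightarrow> heis \<Rightarrow> 5) set" where
  "scals = range scal"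

text \<open>Generators of the Heisenberg group together with their inverses, which Whitehead's
  identity requires, and with the identity, so that \<open>lins\<close> contains the
  scalars.\<close>

definition ring_gens :: "heis set" where
  "ring_gens = {(0, 0, 0, 0), (1, 0, 0, 0), (- 1, 0, 0, 0), (0, 1, 0, 0), (0, - 1, 0, 0)}"

definition lin :: "(heis \<Rightarrow> 5) \<Rightarrow> (heis \<Rightarrow> 5) \<Rightarrow> heis \<Rightarrow> 5" where
  "lin k f p = (\<Sum>a\<in>ring_gens. k a * ltr a f p)"

definition lins :: "((heis \<Rightarrow> 5) \<Rightarrow> heis \<Rightarrow> 5) set" where
  "lins = range lin"

definition diag_all :: "heis \<Rightarrow> (idx \<Rightarrow> heis \<Rightarrow> 5) \<Rightarrow> idx \<Rightarrow> heis \<Rightarrow> 5" where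
  "diag_all a F i = ltr a (F i)"

text \<open>Only \<open>A3\<close> has entries from the ring generators. A commutator of
  \<open>A3\<close> with \<open>A1\<close> or \<open>A2\<close> then has entries in
  \<open>lins\<close> again, and a nonzero scalar factor acts on \<open>lins\<close> as a bijection;
  with ring entries on both sides both properties would be lost.\<close>

definition A1 where "A1 = elem I1 I2 ` scals"
definition A2 where "A2 = elem I2 I3 ` scals"
definition A3 where "A3 = elem I3 I1 ` lins"
text \<open>The three finite subgroups are taken as a whole, so that each of their elements moves a
  coset along a single edge.\<close>

definition S0 where "S0 = A1 \<union> A2 \<union> A3 \<union> {diag_all (0, 0, 0, 1), diag_all (0, 0, 0, - 1)}"
definition gam where "gam = generate bijg S0"
definition lam where "lam = generate bijg (A1 \<union> A2 \<union> A3)"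

lemma finite_ring_gens: "finite ring_gens"
  by (simp add: ring_gens_def)

lemma lin_additive: "additive_op (lin k)"
  by (simp add: additive_op_def lin_def fun_eq_iff ltr_def algebra_simps sum.distrib)

lemma lin_add: "(\<lambda>f. lin k f + lin l f) = lin (k + l)"
  by (simp add: lin_def fun_eq_iff algebra_simps sum.distrib)

lemma lin_uminus: "(\<lambda>f. - lin k f) = lin (- k)"
  by (simp add: lin_def fun_eq_iff sum_negf)

lemma scal_lin: "scal c (lin k f) = lin (\<lambda>a. c * k a) f"
  by (simp add: lin_def scal_def fun_eq_iff sum_distrib_left mult.assoc)

lemma lin_scal: "lin k (scal c f) = lin (\<lambda>a. c * k a) f"
  by (simp add: lin_def scal_def ltr_def fun_eq_iff mult_ac)

lemma scal_add: "(\<lambda>f. scal k f + scal l f) = scal (k + l)"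
  and scal_uminus: "(\<lambda>f. - scal k f) = scal (- k)"
  and scal_scal: "scal k (scal l f) = scal (k * l) f"
  and scal_one: "scal 1 f = f"
  by (simp_all add: scal_def fun_eq_iff algebra_simps)

lemma ltr_in_lins: "a \<in> ring_gens \<Longrightarrow> ltr a \<in> lins"
proof -
  assume a: "a \<in> ring_gens"
  have "lin (\<lambda>b. if b = a then 1 else 0) f p = (\<Sum>b\<in>ring_gens. if b = a then ltr a f p else 0)" for f p
    unfolding lin_def by (intro sum.cong) auto
  then have "lin (\<lambda>b. if b = a then 1 else 0) = ltr a"
    using a finite_ring_gens by (simp add: fun_eq_iff del: split_paired_All)
  then show ?thesis unfolding lins_def by (metis rangeI)
qed

lemma finite_scals: "finite scals"
  by (simp add: scals_def)

lemma finite_lins: "finite lins"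
proof -
  have "lins \<subseteq> lin ` (ring_gens \<rightarrow>\<^sub>E UNIV)"
  proof
    fix r assume "r \<in> lins"
    then obtain k where k: "r = lin k" by (auto simp: lins_def)
    have "lin k = lin (restrict k ring_gens)"
      by (intro ext) (auto simp: lin_def intro!: sum.cong)
    then show "r \<in> lin ` (ring_gens \<rightarrow>\<^sub>E UNIV)"
      unfolding k by (intro image_eqI[of _ _ "restrict k ring_gens"]) (simp_all add: restrict_PiE_iff)
  qed
  moreover have "finite (ring_gens \<rightarrow>\<^sub>E (UNIV :: 5 set))"
    by (intro finite_PiE finite_ring_gens finite_5)
  ultimately show ?thesis using finite_surj by blast
qed

definition op_group :: "(('m::ab_group_add \<Rightarrow> 'm) set) \<Rightarrow> bool" where
  "op_group P \<longleftrightarrow> (\<lambda>f. 0) \<in> P \<and> (\<forall>r\<in>P. additive_op r \<and> (\<lambda>f. - r f) \<in> P) \<and> (\<forall>r\<in>P. \<forall>s\<in>P. (\<lambda>f. r f + s f) \<in> P)"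

lemma op_group_scals: "op_group scals"
proof -
  have "(\<lambda>f. 0) = scal 0" by (simp add: scal_def fun_eq_iff)
  then show ?thesis unfolding op_group_def scals_def by (auto simp: scal_uminus scal_add scal_additive)
qed

lemma op_group_lins: "op_group lins"
proof -
  have "(\<lambda>f. 0) = lin (\<lambda>a. 0)" by (simp add: lin_def fun_eq_iff)
  then show ?thesis unfolding op_group_def lins_def by (auto simp: lin_uminus lin_add lin_additive)
qed

lemma bij_elem: "i \<noteq> j \<Longrightarrow> bij (elem i j r)"
  using o_bij[OF elem_inverse(2) elem_inverse(1)] .

lemma inv_elem: "i \<noteq> j \<Longrightarrow> inv\<^bsub>bijg\<^esub> (elem i j r) = elem i j (\<lambda>f. - r f)"
  by (intro bijg_inv_eqI elem_inverse)

lemma subgroup_elem: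
  assumes "op_group P" "i \<noteq> j"
  shows "subgroup (elem i j ` P) bijg"
proof (rule group.subgroupI[OF group_bijg])
  show "elem i j ` P \<subseteq> carrier bijg" using assms by (auto simp: bij_elem)
  show "elem i j ` P \<noteq> {}" using assms by (auto simp: op_group_def)
  fix f assume "f \<in> elem i j ` P"
  then obtain r where r: "r \<in> P" "f = elem i j r" by blast
  then show "inv\<^bsub>bijg\<^esub> f \<in> elem i j ` P" using assms by (auto simp: inv_elem op_group_def)
  fix g assume "g \<in> elem i j ` P"
  then obtain s where "s \<in> P" "g = elem i j s" by blast
  then show "f \<otimes>\<^bsub>bijg\<^esub> g \<in> elem i j ` P" using r assms by (auto simp: elem_add op_group_def)
qed

lemma diag_all_mult: "diag_all a \<circ> diag_all b = diag_all (hmul b a)"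
  by (simp add: diag_all_def fun_eq_iff ltr_ltr del: split_paired_All)

lemma diag_all_one: "diag_all (0, 0, 0, 0) = id"
  by (simp add: diag_all_def fun_eq_iff ltr_one del: split_paired_All)

lemma bij_diag_central: "bij (diag_all (0, 0, u, v))"
  and inv_diag_central: "inv\<^bsub>bijg\<^esub> (diag_all (0, 0, u, v)) = diag_all (0, 0, - u, - v)"
proof -
  have 1: "diag_all (0, 0, u, v) \<circ> diag_all (0, 0, - u, - v) = id" "diag_all (0, 0, - u, - v) \<circ> diag_all (0, 0, u, v) = id"
    by (simp_all add: diag_all_mult diag_all_one)
  show "bij (diag_all (0, 0, u, v))" by (rule o_bij[OF 1(2,1)])
  show "inv\<^bsub>bijg\<^esub> (diag_all (0, 0, u, v)) = diag_all (0, 0, - u, - v)" by (rule bijg_inv_eqI[OF 1])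
qed

lemma S0_carrier: "S0 \<subseteq> carrier bijg"
  by (auto simp: S0_def A1_def A2_def A3_def bij_elem bij_diag_central)

lemma A_subgroups: "subgroup A1 bijg" "subgroup A2 bijg" "subgroup A3 bijg"
  unfolding A1_def A2_def A3_def by (simp_all add: subgroup_elem op_group_scals op_group_lins)

lemma S0_inv: "s \<in> S0 \<Longrightarrow> inv\<^bsub>bijg\<^esub> s \<in> S0"
  using A_subgroups[THEN subgroup.m_inv_closed] inv_diag_central[of 0 1] inv_diag_central[of 0 "- 1"]
  unfolding S0_def by auto

lemma finite_S0: "finite S0"
  by (simp add: S0_def A1_def A2_def A3_def finite_scals finite_lins)

lemma gam_carrier: "\<gamma> \<in> gam \<Longrightarrow> bij \<gamma>"
  using group.generate_incl[OF group_bijg S0_carrier] by (auto simp: gam_def)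

lemma subgroup_gam: "subgroup gam bijg"
  unfolding gam_def by (rule group.generate_is_subgroup[OF group_bijg S0_carrier])

lemma gam_induct [consumes 1, case_names id gen comp]:
  assumes "\<gamma> \<in> gam" "P id" "\<And>s. s \<in> S0 \<Longrightarrow> P s"
    "\<And>\<gamma> \<delta>. \<lbrakk>\<gamma> \<in> gam; \<delta> \<in> gam; P \<gamma>; P \<delta>\<rbrakk> \<Longrightarrow> P (\<gamma> \<circ> \<delta>)"
  shows "P \<gamma>"
  using assms(1) unfolding gam_def
proof (induction rule: generate.induct)
  case one
  show ?case unfolding bijg_simps by (rule assms(2))
next
  case (incl s)
  then show ?case by (rule assms(3))
next
  case (inv s)
  then show ?case using S0_inv assms(3) by blast
next
  case (eng \<gamma> \<delta>)
  then show ?case unfolding bijg_simps by (intro assms(4)) (simp_all only: gam_def)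
qed

section \<open>Faithfulness of the action on the finite levels\<close>

definition rlocal :: "((heis \<Rightarrow> 5) \<Rightarrow> heis \<Rightarrow> 5) \<Rightarrow> bool" where
  "rlocal r \<longleftrightarrow> (\<forall>p. \<exists>D. finite D \<and> (\<forall>f f'. (\<forall>q\<in>D. f q = f' q) \<longrightarrow> r f p = r f' p))"

definition local_op :: "((idx \<Rightarrow> heis \<Rightarrow> 5) \<Rightarrow> idx \<Rightarrow> heis \<Rightarrow> 5) \<Rightarrow> bool" where
  "local_op \<gamma> \<longleftrightarrow> (\<forall>p. \<exists>D. finite D \<and>
     (\<forall>F F'. (\<forall>q\<in>D. \<forall>i. F i q = F' i q) \<longrightarrow> (\<forall>i. \<gamma> F i p = \<gamma> F' i p)))"

lemma rlocal_scal: "rlocal (scal k)"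
  unfolding rlocal_def
proof (intro allI)
  show "\<exists>D. finite D \<and> (\<forall>f f'. (\<forall>q\<in>D. f q = f' q) \<longrightarrow> scal k f p = scal k f' p)" for p
    by (intro exI[of _ "{p}"]) (simp add: scal_def)
qed

lemma rlocal_lin: "rlocal (lin k)"
  unfolding rlocal_def
proof (intro allI)
  show "\<exists>D. finite D \<and> (\<forall>f f'. (\<forall>q\<in>D. f q = f' q) \<longrightarrow> lin k f p = lin k f' p)" for p
    by (intro exI[of _ "(\<lambda>a. hmul a p) ` ring_gens"])
      (auto simp: lin_def ltr_def finite_ring_gens intro!: sum.cong simp del: split_paired_All)
qed

lemma local_elem: "rlocal r \<Longrightarrow> local_op (elem i j r)"
  unfolding local_op_def
proof (intro allI)
  fix p assume "rlocal r"
  then obtain D where D: "finite D" "\<And>f f'. (\<forall>q\<in>D. f q = f' q) \<Longrightarrow> r f p = r f' p"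
    unfolding rlocal_def by metis
  then show "\<exists>D. finite D \<and>
     (\<forall>F F'. (\<forall>q\<in>D. \<forall>i. F i q = F' i q) \<longrightarrow> (\<forall>i'. elem i j r F i' p = elem i j r F' i' p))"
    by (intro exI[of _ "insert p D"]) (auto simp: elem_def)
qed

lemma local_gam: "\<gamma> \<in> gam \<Longrightarrow> local_op \<gamma>"
proof (induction rule: gam_induct)
  case id
  show ?case unfolding local_op_def by (intro allI exI[of _ "{p}" for p]) auto
next
  case (gen s)
  have "local_op (diag_all a)" for a
    unfolding local_op_def
  proof (intro allI)
    show "\<exists>D. finite D \<and> (\<forall>F F'. (\<forall>q\<in>D. \<forall>i. F i q = F' i q) \<longrightarrow> (\<forall>i. diag_all a F i p = diag_all a F' i p))" for p
      by (intro exI[of _ "{hmul a p}"]) (simp add: diag_all_def ltr_def)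
  qed
  then show ?case using gen
    by (auto simp: S0_def A1_def A2_def A3_def scals_def lins_def local_elem rlocal_scal rlocal_lin)
next
  case (comp \<gamma> \<delta>)
  show ?case
    unfolding local_op_def
  proof (intro allI)
    fix p
    obtain D where D: "finite D" "\<And>F F'. (\<forall>q\<in>D. \<forall>i. F i q = F' i q) \<Longrightarrow> (\<forall>i. \<gamma> F i p = \<gamma> F' i p)"
      using comp.IH(1) unfolding local_op_def by metis
    obtain E where E: "\<And>p. finite (E p)"
      "\<And>p F F'. (\<forall>q\<in>E p. \<forall>i. F i q = F' i q) \<Longrightarrow> (\<forall>i. \<delta> F i p = \<delta> F' i p)"
      using comp.IH(2) unfolding local_op_def by metis
    have "(\<forall>i. (\<gamma> \<circ> \<delta>) F i p = (\<gamma> \<circ> \<delta>) F' i p)" if "\<forall>q\<in>(\<Union>p\<in>D. E p). \<forall>i. F i q = F' i q" for F F'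
    proof -
      have "\<forall>i. \<delta> F i q = \<delta> F' i q" if "q \<in> D" for q
        using \<open>\<forall>q\<in>(\<Union>p\<in>D. E p). \<forall>i. F i q = F' i q\<close> that by (intro E(2)) blast
      then show ?thesis using D(2)[of "\<delta> F" "\<delta> F'"] by simp
    qed
    then show "\<exists>D. finite D \<and> (\<forall>F F'. (\<forall>q\<in>D. \<forall>i. F i q = F' i q) \<longrightarrow> (\<forall>i. (\<gamma> \<circ> \<delta>) F i p = (\<gamma> \<circ> \<delta>) F' i p))"
      using D(1) E(1) by (intro exI[of _ "\<Union>p\<in>D. E p"]) blast
  qed
qed

definition lvec :: "nat \<Rightarrow> (idx \<Rightarrow> heis \<Rightarrow> 5) set" where
  "lvec n = {F. \<forall>i. F i \<in> level n}"

lemma lin_level: "f \<in> level n \<Longrightarrow> lin k f \<in> level n"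
proof (rule levelI)
  fix p q assume f: "f \<in> level n" and pq: "level_cong n p q"
  have "ltr a f p = ltr a f q" for a by (rule levelD[OF ltr_level[OF f] pq])
  then show "lin k f p = lin k f q" by (simp add: lin_def)
qed

lemma gam_lvec: "\<gamma> \<in> gam \<Longrightarrow> F \<in> lvec n \<Longrightarrow> \<gamma> F \<in> lvec n"
proof (induction arbitrary: F rule: gam_induct)
  case (gen s)
  then show ?case
    by (auto simp: S0_def A1_def A2_def A3_def scals_def lins_def lvec_def elem_def diag_all_def
        ltr_level lin_level level_scal level_add)
qed auto

lemma finite_lvec: "finite (lvec n)"
proof -
  have "lvec n \<subseteq> (\<lambda>(f, g, h) i. case i of I1 \<Rightarrow> f | I2 \<Rightarrow> g | I3 \<Rightarrow> h) ` (level n \<times> level n \<times> level n)"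
  proof
    fix F assume F: "F \<in> lvec n"
    have "F = (\<lambda>(f, g, h) i. case i of I1 \<Rightarrow> f | I2 \<Rightarrow> g | I3 \<Rightarrow> h) (F I1, F I2, F I3)"
      by (auto simp: fun_eq_iff split: idx.split)
    then show "F \<in> (\<lambda>(f, g, h) i. case i of I1 \<Rightarrow> f | I2 \<Rightarrow> g | I3 \<Rightarrow> h) ` (level n \<times> level n \<times> level n)"
      using F by (intro image_eqI[of _ _ "(F I1, F I2, F I3)"]) (auto simp: lvec_def)
  qed
  then show ?thesis by (rule finite_subset) (simp add: finite_level)
qed

text \<open>The value of \<open>\<gamma> F\<close> at \<open>p\<close> depends on \<open>F\<close>
  at finitely many points only. Replace \<open>F\<close> by a vector \<open>F'\<close> of some
  finite level that agrees with it at these points and at \<open>p\<close>; \<open>\<gamma>\<close>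
  fixes \<open>F'\<close>. Level 0 is avoided because the sequence of subgroups starts with the
  whole group.\<close>

lemma gam_eq_id:
  assumes \<gamma>: "\<gamma> \<in> gam" and fixed: "\<And>n F. \<lbrakk>n \<ge> 1; F \<in> lvec n\<rbrakk> \<Longrightarrow> \<gamma> F = F"
  shows "\<gamma> = id"
proof (intro ext)
  fix F :: "idx \<Rightarrow> heis \<Rightarrow> 5" and i :: idx and p :: heis
  obtain D where D: "finite D" "\<And>F F'. (\<forall>q\<in>D. \<forall>i. F i q = F' i q) \<Longrightarrow> (\<forall>i. \<gamma> F i p = \<gamma> F' i p)"
    using local_gam[OF \<gamma>] unfolding local_op_def by metis
  have "finite (insert p D)" using D(1) by simp
  from level_interpolates[OF this, of 1] obtain n where n: "n \<ge> 1"
    "\<forall>f. \<exists>f'\<in>level n. \<forall>q\<in>insert p D. f' q = f q" by (elim exE conjE)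
  have "\<forall>i. \<exists>f'. f' \<in> level n \<and> (\<forall>q\<in>insert p D. f' q = F i q)"
    using n(2) unfolding Bex_def by blast
  then have "\<exists>F'. \<forall>i. F' i \<in> level n \<and> (\<forall>q\<in>insert p D. F' i q = F i q)" by (rule choice)
  then obtain F' where F'_all: "\<forall>i. F' i \<in> level n \<and> (\<forall>q\<in>insert p D. F' i q = F i q)" by (rule exE)
  have F': "F' i \<in> level n" "q \<in> insert p D \<Longrightarrow> F' i q = F i q" for i q
    using spec[OF F'_all, of i] by blast+
  have "\<forall>q\<in>D. \<forall>i. F i q = F' i q" by (simp add: F'(2) del: split_paired_All)
  then have 1: "\<gamma> F i p = \<gamma> F' i p" using D(2) by blast
  have "F' \<in> lvec n" by (simp add: lvec_def F'(1))
  then have 2: "\<gamma> F' = F'" by (rule fixed[OF n(1)])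
  show "\<gamma> F i p = id F i p" unfolding 1 2 id_apply by (rule F'(2)) simp
qed

section \<open>The degree of a group element\<close>

fun grade :: "heis \<Rightarrow> int" where
  "grade (x, y, u, v) = v - u"

lemma grade_hmul: "grade (hmul a b) = grade a + grade b"
  by (cases a; cases b) simp

definition supp :: "int \<Rightarrow> (heis \<Rightarrow> 5) \<Rightarrow> bool" where
  "supp j f \<longleftrightarrow> (\<forall>p. grade p \<noteq> j \<longrightarrow> f p = 0)"

definition graded :: "int \<Rightarrow> ((idx \<Rightarrow> heis \<Rightarrow> 5) \<Rightarrow> idx \<Rightarrow> heis \<Rightarrow> 5) \<Rightarrow> bool" where
  "graded k \<gamma> \<longleftrightarrow> (\<forall>j F. (\<forall>i. supp j (F i)) \<longrightarrow> (\<forall>i. supp (j + k) (\<gamma> F i)))"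

lemma supp_ltr: "supp j f \<Longrightarrow> supp (j - grade a) (ltr a f)"
  unfolding supp_def ltr_def by (simp add: grade_hmul del: split_paired_All)

lemma supp_add: "\<lbrakk>supp j f; supp j g\<rbrakk> \<Longrightarrow> supp j (f + g)"
  and supp_scal: "supp j f \<Longrightarrow> supp j (scal k f)"
  unfolding supp_def scal_def by (simp_all del: split_paired_All)

lemma supp_lin:
  assumes "supp j f"
  shows "supp j (lin k f)"
proof -
  have *: "supp j (ltr a f)" if "a \<in> ring_gens" for a
    using supp_ltr[OF assms, of a] that by (auto simp: ring_gens_def)
  show ?thesis
    unfolding supp_def
  proof (intro allI impI)
    fix p assume p: "grade p \<noteq> j"
    have "ltr a f p = 0" if "a \<in> ring_gens" for a using *[OF that] p unfolding supp_def by blast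
    then show "lin k f p = 0" unfolding lin_def by (intro sum.neutral) simp
  qed
qed

lemma gradedD: "\<lbrakk>graded k \<gamma>; \<And>i. supp j (F i)\<rbrakk> \<Longrightarrow> supp (j + k) (\<gamma> F i)"
  unfolding graded_def by blast

lemma gradedI: "(\<And>j F i. (\<And>i. supp j (F i)) \<Longrightarrow> supp (j + k) (\<gamma> F i)) \<Longrightarrow> graded k \<gamma>"
  unfolding graded_def by blast

lemma graded_comp:
  assumes "graded k \<gamma>" "graded l \<delta>"
  shows "graded (k + l) (\<gamma> \<circ> \<delta>)"
proof (rule gradedI)
  fix j i and F :: "idx \<Rightarrow> heis \<Rightarrow> 5" assume "\<And>i. supp j (F i)"
  from gradedD[OF assms(1) gradedD[OF assms(2) this]] show "supp (j + (k + l)) ((\<gamma> \<circ> \<delta>) F i)"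
    by (simp add: add_ac)
qed

lemma graded_diag_all: "graded (- grade a) (diag_all a)"
proof (rule gradedI)
  fix j i and F :: "idx \<Rightarrow> heis \<Rightarrow> 5" assume "\<And>i. supp j (F i)"
  from supp_ltr[OF this, of a] show "supp (j + - grade a) (diag_all a F i)" by (simp add: diag_all_def)
qed

lemma graded_elem: "(\<And>j f. supp j f \<Longrightarrow> supp j (r f)) \<Longrightarrow> graded 0 (elem i j r)"
  by (rule gradedI) (simp add: elem_def supp_add)

lemma gam_graded: "\<gamma> \<in> gam \<Longrightarrow> \<exists>k. graded k \<gamma>"
proof (induction rule: gam_induct)
  case id
  show ?case by (rule exI[of _ 0]) (simp add: graded_def)
next
  case (gen s)
  have "graded 0 (elem i j (scal k))" "graded 0 (elem i j (lin l))" for i j k l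
    by (simp_all add: graded_elem supp_scal supp_lin)
  then have "\<exists>k. graded k s" if "s \<in> A1 \<union> A2 \<union> A3"
    using that unfolding A1_def A2_def A3_def scals_def lins_def by blast
  moreover have "\<exists>k. graded k (diag_all a)" for a by (rule exI, rule graded_diag_all)
  ultimately show ?case using gen unfolding S0_def by auto
next
  case (comp \<gamma> \<delta>)
  then show ?case using graded_comp by blast
qed

text \<open>A point mass at the identity has degree 0. If \<open>\<gamma>\<close> had two degrees,
  the image of this vector would be supported in two different degrees and vanish, as does the image
  of 0, against injectivity.\<close>

lemma graded_unique:
  assumes \<gamma>: "\<gamma> \<in> gam" and k: "graded k \<gamma>" and l: "graded l \<gamma>"
  shows "k = l"
proof (rule ccontr)
  assume kl: "k \<noteq> l"
  have two: "f = (\<lambda>p. 0)" if "supp a f" "supp b f" "a \<noteq> b" for a b f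
  proof
    fix p show "f p = 0" using that unfolding supp_def by (cases "grade p = a") (simp_all del: split_paired_All)
  qed
  define F where "F = (\<lambda>i :: idx. \<lambda>p :: heis. if p = (0, 0, 0, 0) then 1 else 0 :: 5)"
  have F: "supp 0 (F i)" for i by (simp add: supp_def F_def)
  have "\<gamma> F i = (\<lambda>p. 0)" for i
    by (rule two[OF gradedD[OF k F] gradedD[OF l F]]) (use kl in simp)
  moreover have "\<gamma> (\<lambda>i p. 0) i = (\<lambda>p. 0)" for i
  proof -
    have z: "supp j ((\<lambda>i p. 0) i)" for j and i :: idx by (simp add: supp_def)
    show ?thesis by (rule two[OF gradedD[OF k z[of 0]] gradedD[OF k z[of 1]]]) simp
  qed
  ultimately have "\<gamma> F = \<gamma> (\<lambda>i p. 0)" by (intro ext) simp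
  then have "F = (\<lambda>i p. 0)" using gam_carrier[OF \<gamma>] by (simp add: bij_def inj_eq)
  then have "F I1 (0, 0, 0, 0) = 0" by simp
  then show False by (simp add: F_def)
qed

section \<open>Central shifts become products of elementary matrices on finite levels\<close>

lemma subgroup_lam: "subgroup lam bijg"
  unfolding lam_def using S0_carrier
  by (intro group.generate_is_subgroup[OF group_bijg]) (auto simp: S0_def)

lemma lam_comp: "\<lbrakk>\<gamma> \<in> lam; \<delta> \<in> lam\<rbrakk> \<Longrightarrow> \<gamma> \<circ> \<delta> \<in> lam"
  using subgroup.m_closed[OF subgroup_lam] by simp

lemma lam_elem_uminus: "\<lbrakk>i \<noteq> j; elem i j r \<in> lam\<rbrakk> \<Longrightarrow> elem i j (\<lambda>f. - r f) \<in> lam"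
  using subgroup.m_inv_closed[OF subgroup_lam] inv_elem by metis

lemma lam_commutator:
  assumes "elem i j r \<in> lam" "elem j k s \<in> lam" "additive_op r" "i \<noteq> j" "j \<noteq> k" "i \<noteq> k"
  shows "elem i k (\<lambda>x. r (s x)) \<in> lam"
  unfolding elem_commutator[OF assms(3-6), of s, symmetric]
  by (intro lam_comp lam_elem_uminus assms)

lemma lam_gens: "s \<in> A1 \<union> A2 \<union> A3 \<Longrightarrow> s \<in> lam"
  unfolding lam_def by (rule generate.incl)

text \<open>Commutators around the cycle of the three indices: the generators have the entry 1 in
  positions 12 and 23 and any entry of \<open>lins\<close> in position 31. This yields all of
  \<open>lins\<close> in positions 32 and 21 and the entry 1 in position 13, and then all of
  \<open>lins\<close> in the remaining positions.\<close>

lemma lam_elem_lins: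
  assumes r: "r \<in> lins" and ij: "i \<noteq> j"
  shows "elem i j r \<in> lam"
proof -
  have one: "(\<lambda>f. f) \<in> scals"
    using scal_one unfolding scals_def by (metis ext rangeI)
  have one': "(\<lambda>f. f) \<in> lins"
    using ltr_in_lins[of "(0, 0, 0, 0)"] ltr_one by (simp add: ring_gens_def) (metis ext)
  have add: "additive_op (\<lambda>f :: heis \<Rightarrow> 5. f)" by (simp add: additive_op_def)
  have addr: "additive_op r" if "r \<in> lins" for r using that lin_additive by (auto simp: lins_def)
  have e12: "elem I1 I2 (\<lambda>f :: heis \<Rightarrow> 5. f) \<in> lam" and e23: "elem I2 I3 (\<lambda>f :: heis \<Rightarrow> 5. f) \<in> lam"
    using one by (auto intro!: lam_gens simp: A1_def A2_def)
  have e31: "elem I3 I1 r \<in> lam" if "r \<in> lins" for r using that by (auto intro!: lam_gens simp: A3_def)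
  have e32: "elem I3 I2 r \<in> lam" if "r \<in> lins" for r
    using lam_commutator[OF e31[OF that] e12 addr[OF that]] by simp
  have e21: "elem I2 I1 r \<in> lam" if "r \<in> lins" for r
    using lam_commutator[OF e23 e31[OF that] add] by simp
  have e13: "elem I1 I3 (\<lambda>f :: heis \<Rightarrow> 5. f) \<in> lam"
    using lam_commutator[OF e12 e23 add] by simp
  have r12: "elem I1 I2 r \<in> lam"
    using lam_commutator[OF e13 e32[OF r] add] by simp
  have r23: "elem I2 I3 r \<in> lam"
    using lam_commutator[OF e21[OF r] e13 addr[OF r]] by simp
  have r13: "elem I1 I3 r \<in> lam"
    using lam_commutator[OF r12 e23 addr[OF r]] by simp
  show ?thesis
    using ij r12 r23 r13 e31[OF r] e32[OF r] e21[OF r] by (cases i; cases j) simp_all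
qed

text \<open>Group elements available in every off-diagonal position. The set is closed under
  products, by a commutator through the third index, so entries outside \<open>lins\<close> such as
  large powers are reached too.\<close>

definition lam_ring :: "heis set" where
  "lam_ring = {a. \<forall>i j. i \<noteq> j \<longrightarrow> elem i j (ltr a) \<in> lam}"

lemma lam_ring_gens: "a \<in> ring_gens \<Longrightarrow> a \<in> lam_ring"
  unfolding lam_ring_def using lam_elem_lins[OF ltr_in_lins] by blast

lemma lam_ring_hmul:
  assumes "a \<in> lam_ring" "b \<in> lam_ring"
  shows "hmul b a \<in> lam_ring"
  unfolding lam_ring_def
proof (intro CollectI allI impI)
  fix i j :: idx assume ij: "i \<noteq> j"
  obtain k where k: "i \<noteq> k" "k \<noteq> j" by (cases i; cases j) (use ij in auto)
  have "elem i j (\<lambda>f. ltr a (ltr b f)) \<in> lam"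
    by (rule lam_commutator[of i k _ j]) (use assms ij k in \<open>auto simp: lam_ring_def ltr_additive\<close>)
  then show "elem i j (ltr (hmul b a)) \<in> lam" by (simp add: ltr_ltr)
qed

lemma lam_ring_power: "(int k, 0, 0, 0) \<in> lam_ring" "(- int k, 0, 0, 0) \<in> lam_ring"
proof -
  have g: "(1, 0, 0, 0) \<in> lam_ring" "(- 1, 0, 0, 0) \<in> lam_ring" "(0, 0, 0, 0) \<in> lam_ring"
    by (auto intro!: lam_ring_gens simp: ring_gens_def)
  show "(int k, 0, 0, 0) \<in> lam_ring"
  proof (induction k)
    case (Suc k)
    from lam_ring_hmul[OF this g(1)] show ?case by (simp add: add.commute)
  qed (use g in simp)
  show "(- int k, 0, 0, 0) \<in> lam_ring"
  proof (induction k)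
    case (Suc k)
    from lam_ring_hmul[OF this g(2)] show ?case by simp
  qed (use g in simp)
qed

lemma lam_diag2:
  assumes a: "a \<in> lam_ring" and a': "a' \<in> lam_ring" and ij: "i \<noteq> j"
    and inv: "\<And>f. ltr a (ltr a' f) = f" "\<And>f. ltr a' (ltr a f) = f"
  shows "diag1 i (ltr a) \<circ> diag1 j (ltr a') \<in> lam"
proof -
  have e: "elem k l (ltr a) \<in> lam" "elem k l (ltr a') \<in> lam" "elem k l (\<lambda>f :: heis \<Rightarrow> 5. f) \<in> lam" if "k \<noteq> l" for k l
  proof -
    have "ltr (0, 0, 0, 0) = (\<lambda>f. f)" by (intro ext) (simp add: ltr_one)
    then show "elem k l (\<lambda>f :: heis \<Rightarrow> 5. f) \<in> lam"
      using lam_elem_lins[OF ltr_in_lins[of "(0, 0, 0, 0)"] that] by (simp add: ring_gens_def)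
  qed (use a a' that in \<open>auto simp: lam_ring_def\<close>)
  show ?thesis
    unfolding elem_diag2[OF ltr_additive ltr_additive inv ij, symmetric]
    by (intro lam_comp e lam_elem_uminus ij ij[symmetric])
qed

lemma lam_diag_all: "diag_all (0, 0, m, m) \<in> lam"
proof -
  \<comment> \<open>The sign of \<open>m\<close> in \<open>a\<close> compensates for the reversed
    order of composition in \<open>ltr\<close>; the commutator then has both central coordinates
    equal to \<open>m\<close>.\<close>
  define a a' b b' :: heis where ab: "a = (- m, 0, 0, 0)" "a' = (m, 0, 0, 0)" "b = (0, 1, 0, 0)" "b' = (0, - 1, 0, 0)"
  have mem: "a \<in> lam_ring" "a' \<in> lam_ring" "b \<in> lam_ring" "b' \<in> lam_ring"
  proof -
    show "b \<in> lam_ring" "b' \<in> lam_ring" by (auto intro!: lam_ring_gens simp: ring_gens_def ab)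
    show "a \<in> lam_ring" "a' \<in> lam_ring"
      using lam_ring_power[of "nat m"] lam_ring_power[of "nat (- m)"] unfolding ab
      by (cases "0 \<le> m"; simp)+
  qed
  have inv: "ltr a (ltr a' f) = f" "ltr a' (ltr a f) = f" "ltr b (ltr b' f) = f" "ltr b' (ltr b f) = f" for f
    by (simp_all add: ab ltr_ltr ltr_one)
  have comm: "(\<lambda>f. ltr a (ltr b (ltr a' (ltr b' f)))) = ltr (0, 0, m, m)"
    by (simp add: ab ltr_ltr fun_eq_iff del: split_paired_All)
  have d: "diag1 i (ltr (0, 0, m, m)) \<in> lam" for i
  proof -
    obtain j k where jk: "i \<noteq> j" "j \<noteq> k" "i \<noteq> k" by (cases i) auto
    have "(diag1 i (ltr a) \<circ> diag1 j (ltr a')) \<circ> (diag1 i (ltr b) \<circ> diag1 k (ltr b'))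
        \<circ> (diag1 i (ltr a') \<circ> diag1 j (ltr a)) \<circ> (diag1 i (ltr b') \<circ> diag1 k (ltr b)) \<in> lam"
      by (intro lam_comp lam_diag2 mem inv jk)
    then show ?thesis unfolding diag2_commutator[OF jk inv] comm .
  qed
  have "diag_all (0, 0, m, m) = diag1 I1 (ltr (0, 0, m, m)) \<circ> diag1 I2 (ltr (0, 0, m, m)) \<circ> diag1 I3 (ltr (0, 0, m, m))"
  proof (intro ext)
    fix F i p
    show "diag_all (0, 0, m, m) F i p
      = (diag1 I1 (ltr (0, 0, m, m)) \<circ> diag1 I2 (ltr (0, 0, m, m)) \<circ> diag1 I3 (ltr (0, 0, m, m))) F i p"
      by (cases i) (simp_all add: diag_all_def diag1_def)
  qed
  then show ?thesis using d lam_comp by simp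
qed

lemma gam_eq_lam_on_level:
  assumes "\<gamma> \<in> gam"
  shows "\<exists>\<delta>\<in>lam. \<forall>F\<in>lvec n. \<gamma> F = \<delta> F"
  using assms
proof (induction rule: gam_induct)
  case id
  then show ?case using subgroup.one_closed[OF subgroup_lam] by (intro bexI[of _ id]) simp_all
next
  case (gen s)
  from central_shift_level[of n] obtain m
    where m_all: "\<forall>f\<in>level n. ltr (0, 0, 0, 1) f = ltr (0, 0, m, m) f" by (rule exE)
  note m = bspec[OF m_all]
  have m': "ltr (0, 0, 0, - 1) f = ltr (0, 0, - m, - m) f" if f: "f \<in> level n" for f
  proof -
    define g where "g = ltr (0, 0, 0, - 1) f"
    have "f = ltr (0, 0, 0, 1) g" by (simp add: g_def ltr_ltr ltr_one)
    also have "\<dots> = ltr (0, 0, m, m) g" by (rule m) (simp add: g_def ltr_level f)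
    finally have "ltr (0, 0, - m, - m) f = g" by (simp add: ltr_ltr ltr_one)
    then show ?thesis by (simp add: g_def)
  qed
  consider "s \<in> A1 \<union> A2 \<union> A3" | "s = diag_all (0, 0, 0, 1)" | "s = diag_all (0, 0, 0, - 1)"
    using gen by (auto simp: S0_def)
  then show ?case
  proof cases
    case 1
    then show ?thesis using lam_gens by blast
  next
    case 2
    then have "\<forall>F\<in>lvec n. s F = diag_all (0, 0, m, m) F"
      by (auto simp: lvec_def diag_all_def fun_eq_iff m simp del: split_paired_All)
    then show ?thesis using lam_diag_all by blast
  next
    case 3
    then have "\<forall>F\<in>lvec n. s F = diag_all (0, 0, - m, - m) F"
      by (auto simp: lvec_def diag_all_def fun_eq_iff m' simp del: split_paired_All)
    then show ?thesis using lam_diag_all by blast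
  qed
next
  case (comp \<gamma> \<delta>)
  then obtain \<gamma>' \<delta>' where *: "\<gamma>' \<in> lam" "\<forall>F\<in>lvec n. \<gamma> F = \<gamma>' F" "\<delta>' \<in> lam" "\<forall>F\<in>lvec n. \<delta> F = \<delta>' F" by blast
  then have "(\<gamma> \<circ> \<delta>) F = (\<gamma>' \<circ> \<delta>') F" if "F \<in> lvec n" for F
    using gam_lvec[OF comp.hyps(2) that] that by simp
  then show ?case using lam_comp[OF *(1,3)] by blast
qed

section \<open>The group on the natural numbers\<close>

lemma (in group) countable_generate:
  assumes S: "S \<subseteq> carrier G" "countable S"
  shows "countable (generate G S)"
proof -
  let ?T = "S \<union> (\<lambda>s. inv s) ` S" and ?w = "\<lambda>xs. foldr (\<otimes>) xs \<one>"
  have T: "?T \<subseteq> carrier G" using S by auto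
  have closed: "?w xs \<in> carrier G" if "xs \<in> lists ?T" for xs
    using that by (induction xs) (use T in auto)
  have append: "?w (xs @ ys) = ?w xs \<otimes> ?w ys" if "xs \<in> lists ?T" "ys \<in> lists ?T" for xs ys
    using that
  proof (induction xs)
    case (Cons x xs)
    then have "x \<in> carrier G" using T by auto
    then show ?case using Cons closed[of xs] closed[of ys] by (auto simp: m_assoc)
  qed (use closed in auto)
  have "g \<in> ?w ` lists ?T" if "g \<in> generate G S" for g
    using that
  proof (induction rule: generate.induct)
    case one
    show ?case by (rule image_eqI[of _ _ "[]"]) auto
  next
    case (incl s)
    then show ?case using S by (intro image_eqI[of _ _ "[s]"]) auto
  next
    case (inv s)
    then show ?case using S by (intro image_eqI[of _ _ "[inv s]"]) auto
  next
    case (eng g h)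
    then obtain xs ys where "xs \<in> lists ?T" "g = ?w xs" "ys \<in> lists ?T" "h = ?w ys" by blast
    then show ?case using append[of xs ys]
      by (intro image_eqI[of _ _ "xs @ ys"]) (simp_all del: foldr_append)
  qed
  then have "generate G S \<subseteq> ?w ` lists ?T" by blast
  moreover have "countable (?w ` lists ?T)" using S by (intro countable_image countable_lists) auto
  ultimately show ?thesis by (rule countable_subset)
qed

lemma countable_gam: "countable gam"
  unfolding gam_def
  by (rule group.countable_generate[OF group_bijg S0_carrier countable_finite[OF finite_S0]])

lemma gam_id: "id \<in> gam"
  using subgroup.one_closed[OF subgroup_gam] by simp

lemma gam_comp: "\<lbrakk>\<gamma> \<in> gam; \<delta> \<in> gam\<rbrakk> \<Longrightarrow> \<gamma> \<circ> \<delta> \<in> gam"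
  using subgroup.m_closed[OF subgroup_gam] by simp

lemma gam_gens: "s \<in> S0 \<Longrightarrow> s \<in> gam"
  unfolding gam_def by (rule generate.incl)

lemma lam_subset_gam: "lam \<subseteq> gam"
  unfolding lam_def gam_def by (rule group.mono_generate[OF group_bijg]) (auto simp: S0_def)

lemma infinite_gam: "infinite gam"
proof -
  have mem: "diag_all (0, 0, 0, int k) \<in> gam" for k
  proof (induction k)
    case 0
    then show ?case using gam_id by (simp only: of_nat_0 diag_all_one)
  next
    case (Suc k)
    have "diag_all (0, 0, 0, 1) \<in> gam" by (rule gam_gens) (simp add: S0_def)
    from gam_comp[OF this Suc] have "diag_all (hmul (0, 0, 0, int k) (0, 0, 0, 1)) \<in> gam"
      unfolding diag_all_mult .
    then show ?case by (simp add: add.commute)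
  qed
  have "inj (\<lambda>k. diag_all (0, 0, 0, int k))"
  proof (rule injI)
    fix k l assume eq: "diag_all (0, 0, 0, int k) = diag_all (0, 0, 0, int l)"
    have "- grade (0, 0, 0, int k) = - grade (0, 0, 0, int l)"
      using graded_unique[OF mem graded_diag_all] graded_diag_all[of "(0, 0, 0, int l)"] unfolding eq[symmetric] by blast
    then show "k = l" by simp
  qed
  then have "infinite (range (\<lambda>k. diag_all (0, 0, 0, int k)))" by (simp add: finite_image_iff)
  then show ?thesis using mem by (meson finite_subset image_subsetI)
qed

text \<open>Since \<open>gam\<close> is countable and infinite, \<open>en\<close> is a bijection
  from all natural numbers onto \<open>gam\<close>. It transports the group to the type that the
  existence statement asks for.\<close>

definition en :: "nat \<Rightarrow> (idx \<Rightarrow> heis \<Rightarrow> 5) \<Rightarrow> idx \<Rightarrow> heis \<Rightarrow> 5" where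
  "en = from_nat_into gam"

definition co :: "((idx \<Rightarrow> heis \<Rightarrow> 5) \<Rightarrow> idx \<Rightarrow> heis \<Rightarrow> 5) \<Rightarrow> nat" where
  "co = to_nat_on gam"

lemma en_gam: "en n \<in> gam"
  unfolding en_def using gam_id by (intro from_nat_into) auto

lemma en_co: "\<gamma> \<in> gam \<Longrightarrow> en (co \<gamma>) = \<gamma>"
  unfolding en_def co_def by (rule from_nat_into_to_nat_on[OF countable_gam])

lemma co_en: "co (en n) = n"
  unfolding en_def co_def by (rule to_nat_on_from_nat_into_infinite[OF countable_gam infinite_gam])

lemma en_inject: "en m = en n \<longleftrightarrow> m = n"
  using co_en by metis

definition ng :: "nat monoid" where
  "ng = \<lparr>carrier = UNIV, mult = (\<lambda>m n. co (en m \<circ> en n)), one = co id\<rparr>"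

lemma ng_carrier [simp]: "carrier ng = UNIV"
  by (simp add: ng_def)

lemma en_mult: "en (m \<otimes>\<^bsub>ng\<^esub> n) = en m \<circ> en n"
  by (simp add: ng_def en_co gam_comp en_gam)

lemma en_one: "en \<one>\<^bsub>ng\<^esub> = id"
  by (simp add: ng_def en_co gam_id)

lemma co_mult: "\<lbrakk>\<gamma> \<in> gam; \<delta> \<in> gam\<rbrakk> \<Longrightarrow> co \<gamma> \<otimes>\<^bsub>ng\<^esub> co \<delta> = co (\<gamma> \<circ> \<delta>)"
  by (simp add: ng_def en_co)

lemma gam_inv: "\<gamma> \<in> gam \<Longrightarrow> inv\<^bsub>bijg\<^esub> \<gamma> \<in> gam"
  using subgroup.m_inv_closed[OF subgroup_gam] .

lemma gam_l_inv: "\<gamma> \<in> gam \<Longrightarrow> inv\<^bsub>bijg\<^esub> \<gamma> \<circ> \<gamma> = id"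
  and gam_r_inv: "\<gamma> \<in> gam \<Longrightarrow> \<gamma> \<circ> inv\<^bsub>bijg\<^esub> \<gamma> = id"
  using group.l_inv[OF group_bijg, of \<gamma>] group.r_inv[OF group_bijg, of \<gamma>] gam_carrier[of \<gamma>] by simp_all

lemma group_ng: "group ng"
proof (rule groupI)
  fix x
  have "en (co (inv\<^bsub>bijg\<^esub> (en x)) \<otimes>\<^bsub>ng\<^esub> x) = en \<one>\<^bsub>ng\<^esub>"
    by (simp only: en_mult en_one en_co[OF gam_inv[OF en_gam]] gam_l_inv[OF en_gam])
  then show "\<exists>y\<in>carrier ng. y \<otimes>\<^bsub>ng\<^esub> x = \<one>\<^bsub>ng\<^esub>" unfolding en_inject by auto
next
  fix x y z
  have "en (x \<otimes>\<^bsub>ng\<^esub> y \<otimes>\<^bsub>ng\<^esub> z) = en (x \<otimes>\<^bsub>ng\<^esub> (y \<otimes>\<^bsub>ng\<^esub> z))" by (simp only: en_mult comp_assoc)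
  then show "x \<otimes>\<^bsub>ng\<^esub> y \<otimes>\<^bsub>ng\<^esub> z = x \<otimes>\<^bsub>ng\<^esub> (y \<otimes>\<^bsub>ng\<^esub> z)" unfolding en_inject .
  have "en (\<one>\<^bsub>ng\<^esub> \<otimes>\<^bsub>ng\<^esub> x) = en x" by (simp only: en_mult en_one id_comp)
  then show "\<one>\<^bsub>ng\<^esub> \<otimes>\<^bsub>ng\<^esub> x = x" unfolding en_inject .
qed simp_all

lemma co_inv: "\<gamma> \<in> gam \<Longrightarrow> inv\<^bsub>ng\<^esub> (co \<gamma>) = co (inv\<^bsub>bijg\<^esub> \<gamma>)"
proof (rule group.inv_equality[OF group_ng])
  assume "\<gamma> \<in> gam"
  then have "en (co (inv\<^bsub>bijg\<^esub> \<gamma>) \<otimes>\<^bsub>ng\<^esub> co \<gamma>) = en \<one>\<^bsub>ng\<^esub>"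
    by (simp only: en_mult en_one en_co gam_inv gam_l_inv)
  then show "co (inv\<^bsub>bijg\<^esub> \<gamma>) \<otimes>\<^bsub>ng\<^esub> co \<gamma> = \<one>\<^bsub>ng\<^esub>" unfolding en_inject .
qed simp_all

lemma en_inv: "en (inv\<^bsub>ng\<^esub> n) = inv\<^bsub>bijg\<^esub> (en n)"
  using co_inv[OF en_gam, of n] en_co[OF gam_inv[OF en_gam, of n]] by (simp add: co_en)

definition Sn :: "nat set" where
  "Sn = co ` S0"

text \<open>The kernel of the action on vectors of level \<open>n\<close>. Level 0 consists of
  constant functions, on which scalar elementary matrices still act nontrivially, so the first term
  is set to the whole group separately.\<close>

definition Nl :: "nat \<Rightarrow> nat set" where
  "Nl n = {m. n = 0 \<or> (\<forall>F\<in>lvec n. en m F = F)}"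

lemma lvec_mono: "lvec n \<subseteq> lvec (Suc n)"
  using level_mono by (auto simp: lvec_def)

lemma Nl_subgroup: "subgroup (Nl n) ng"
proof (rule group.subgroupI[OF group_ng])
  have "\<one>\<^bsub>ng\<^esub> \<in> Nl n" by (simp add: Nl_def en_one)
  then show "Nl n \<noteq> {}" by blast
  show "a \<otimes>\<^bsub>ng\<^esub> b \<in> Nl n" if "a \<in> Nl n" "b \<in> Nl n" for a b
    using that by (auto simp: Nl_def en_mult)
  show "inv\<^bsub>ng\<^esub> a \<in> Nl n" if "a \<in> Nl n" for a
  proof (cases "n = 0")
    case False
    have "(inv\<^bsub>bijg\<^esub> (en a)) F = F" if F: "F \<in> lvec n" for F
    proof -
      have "en a F = F" using \<open>a \<in> Nl n\<close> False F by (auto simp: Nl_def)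
      then show ?thesis using fun_cong[OF gam_l_inv[OF en_gam[of a]], of F] by simp
    qed
    then show ?thesis by (simp add: Nl_def en_inv)
  qed (simp add: Nl_def)
qed simp

lemma Nl_normal: "Nl n \<lhd> ng"
proof (rule group.normal_invI[OF group_ng Nl_subgroup])
  fix x h assume h: "h \<in> Nl n"
  have "(en x \<circ> en h \<circ> inv\<^bsub>bijg\<^esub> (en x)) F = F" if n: "n \<noteq> 0" and F: "F \<in> lvec n" for F
  proof -
    have "(inv\<^bsub>bijg\<^esub> (en x)) F \<in> lvec n" by (rule gam_lvec[OF gam_inv[OF en_gam] F])
    then have "en h ((inv\<^bsub>bijg\<^esub> (en x)) F) = (inv\<^bsub>bijg\<^esub> (en x)) F" using h n by (auto simp: Nl_def)
    then show ?thesis using fun_cong[OF gam_r_inv[OF en_gam[of x]], of F] by simp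
  qed
  then show "x \<otimes>\<^bsub>ng\<^esub> h \<otimes>\<^bsub>ng\<^esub> inv\<^bsub>ng\<^esub> x \<in> Nl n" by (auto simp: Nl_def en_mult en_inv)
qed

lemma Nl_coset_eqI:
  assumes "\<forall>F\<in>lvec n. en a F = en b F"
  shows "Nl n #>\<^bsub>ng\<^esub> a = Nl n #>\<^bsub>ng\<^esub> b"
proof (rule group.coset_mult_inv1[OF group_ng])
  have "en (a \<otimes>\<^bsub>ng\<^esub> inv\<^bsub>ng\<^esub> b) F = F" if F: "F \<in> lvec n" for F
  proof -
    have "(inv\<^bsub>bijg\<^esub> (en b)) F \<in> lvec n" by (rule gam_lvec[OF gam_inv[OF en_gam] F])
    then have "en a ((inv\<^bsub>bijg\<^esub> (en b)) F) = en b ((inv\<^bsub>bijg\<^esub> (en b)) F)" using assms by blast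
    then show ?thesis using fun_cong[OF gam_r_inv[OF en_gam[of b]], of F] by (simp add: en_mult en_inv)
  qed
  then have "a \<otimes>\<^bsub>ng\<^esub> inv\<^bsub>ng\<^esub> b \<in> Nl n" by (simp add: Nl_def)
  then show "Nl n #>\<^bsub>ng\<^esub> (a \<otimes>\<^bsub>ng\<^esub> inv\<^bsub>ng\<^esub> b) = Nl n"
    by (intro group.coset_join2[OF group_ng] Nl_subgroup) simp_all
qed simp_all

lemma finite_range_if_determined:
  assumes "finite (range f)" "\<And>a b. f a = f b \<Longrightarrow> g a = g b"
  shows "finite (range g)"
proof -
  have "g a = g (inv_into UNIV f (f a))" for a
    by (rule assms(2)) (simp add: f_inv_into_f)
  then have "range g \<subseteq> (\<lambda>y. g (inv_into UNIV f y)) ` range f" by blast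
  then show ?thesis using assms(1) by (meson finite_imageI finite_subset)
qed

lemma quotient_data_ng: "quotient_data ng Sn Nl"
proof (intro quotient_data.intro quotient_data_axioms.intro group_ng)
  show "infinite (carrier ng)" by simp
  show "finite Sn" by (simp add: Sn_def finite_S0)
  show "Sn \<subseteq> carrier ng" by simp
  show "Sn = (\<lambda>s. inv\<^bsub>ng\<^esub> s) ` Sn"
  proof -
    have inv: "inv\<^bsub>ng\<^esub> s \<in> Sn" if "s \<in> Sn" for s
      using that S0_inv gam_gens by (auto simp: Sn_def co_inv)
    have "s \<in> (\<lambda>s. inv\<^bsub>ng\<^esub> s) ` Sn" if "s \<in> Sn" for s
      using inv[OF that] group.inv_inv[OF group_ng, of s] by (intro image_eqI[of _ _ "inv\<^bsub>ng\<^esub> s"]) simp_all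
    then show ?thesis using inv by auto
  qed
  show "generate ng Sn = carrier ng"
  proof -
    have "co \<gamma> \<in> generate ng Sn" if "\<gamma> \<in> gam" for \<gamma>
      using that
    proof (induction rule: gam_induct)
      case id
      have "co id = \<one>\<^bsub>ng\<^esub>" by (simp only: ng_def monoid.simps)
      then show ?case using generate.one[of ng Sn] by (simp only:)
    next
      case (gen s)
      then show ?case by (intro generate.incl) (simp add: Sn_def)
    next
      case (comp \<gamma> \<delta>)
      from generate.eng[OF comp.IH] show ?case by (simp only: co_mult comp.hyps)
    qed
    from this[OF en_gam] show ?thesis by (auto simp: co_en)
  qed
  show "Nl 0 = carrier ng" by (simp add: Nl_def)
  show "Nl (Suc n) \<subseteq> Nl n" for n using lvec_mono by (auto simp: Nl_def)
  show "Nl n \<lhd> ng" for n by (rule Nl_normal)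
  show "finite (rcosets\<^bsub>ng\<^esub> (Nl n))" for n
  proof -
    have "finite (range (\<lambda>a. restrict (en a) (lvec n)))"
    proof (rule finite_subset)
      show "range (\<lambda>a. restrict (en a) (lvec n)) \<subseteq> lvec n \<rightarrow>\<^sub>E lvec n"
        using gam_lvec[OF en_gam] by (intro image_subsetI) (simp add: restrict_PiE_iff)
      show "finite (lvec n \<rightarrow>\<^sub>E lvec n)" by (intro finite_PiE finite_lvec)
    qed
    then have "finite (range (\<lambda>a. Nl n #>\<^bsub>ng\<^esub> a))"
    proof (rule finite_range_if_determined)
      fix a b assume "restrict (en a) (lvec n) = restrict (en b) (lvec n)"
      then have "\<forall>F\<in>lvec n. en a F = en b F" by (metis restrict_apply')
      then show "Nl n #>\<^bsub>ng\<^esub> a = Nl n #>\<^bsub>ng\<^esub> b" by (rule Nl_coset_eqI)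
    qed
    moreover have "rcosets\<^bsub>ng\<^esub> (Nl n) = range (\<lambda>a. Nl n #>\<^bsub>ng\<^esub> a)" by (auto simp: RCOSETS_def)
    ultimately show ?thesis by simp
  qed
  show "(\<Inter>n. Nl n) = {\<one>\<^bsub>ng\<^esub>}"
  proof
    show "(\<Inter>n. Nl n) \<subseteq> {\<one>\<^bsub>ng\<^esub>}"
    proof
      fix m assume m: "m \<in> (\<Inter>n. Nl n)"
      have "en m F = F" if "n \<ge> 1" "F \<in> lvec n" for n F
      proof -
        have "m \<in> Nl n" using m by blast
        then show ?thesis using that by (simp add: Nl_def)
      qed
      then have "en m = id" by (rule gam_eq_id[OF en_gam])
      then have "en m = en \<one>\<^bsub>ng\<^esub>" by (simp only: en_one)
      then show "m \<in> {\<one>\<^bsub>ng\<^esub>}" unfolding en_inject by simp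
    qed
    show "{\<one>\<^bsub>ng\<^esub>} \<subseteq> (\<Inter>n. Nl n)" by (auto simp: Nl_def en_one)
  qed
qed

lemma ng_not_geometric_property_T:
  "\<not> geometric_property_T (box_space ng Nl) (box_coarse_structure ng Sn Nl)"
proof -
  define \<phi> where "\<phi> n = (THE k. graded k (en n))" for n
  have \<phi>: "\<phi> n = k" if "graded k (en n)" for n k
    unfolding \<phi>_def using that graded_unique[OF en_gam] by (intro the_equality) blast+
  have ex: "graded (\<phi> n) (en n)" for n using gam_graded[OF en_gam] \<phi> by metis
  have mult: "\<phi> (m \<otimes>\<^bsub>ng\<^esub> n) = \<phi> m + \<phi> n" for m n
    using graded_comp[OF ex ex] by (intro \<phi>) (simp add: en_mult)
  have "diag_all (0, 0, 0, 1) \<in> gam" by (rule gam_gens) (simp add: S0_def)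
  then have "\<phi> (co (diag_all (0, 0, 0, 1))) = - 1"
    using graded_diag_all[of "(0, 0, 0, 1)"] by (intro \<phi>) (simp add: en_co)
  then show ?thesis
    using mult by (intro quotient_data.not_geometric_property_T_if_hom_int[OF quotient_data_ng, of \<phi> "co (diag_all (0, 0, 0, 1))"]) simp_all
qed

section \<open>The quotients are expanders\<close>

lemma subgroup_co_image:
  assumes A: "subgroup A bijg" "A \<subseteq> gam"
  shows "subgroup (co ` A) ng"
proof (rule group.subgroupI[OF group_ng])
  show "co ` A \<noteq> {}" using subgroup.one_closed[OF A(1)] by auto
  fix a assume "a \<in> co ` A"
  then obtain \<alpha> where \<alpha>: "\<alpha> \<in> A" "a = co \<alpha>" by blast
  show "inv\<^bsub>ng\<^esub> a \<in> co ` A"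
    using \<alpha> subgroup.m_inv_closed[OF A(1) \<alpha>(1)] A(2) by (auto simp: co_inv)
  fix b assume "b \<in> co ` A"
  then obtain \<beta> where \<beta>: "\<beta> \<in> A" "b = co \<beta>" by blast
  show "a \<otimes>\<^bsub>ng\<^esub> b \<in> co ` A"
    using \<alpha> \<beta> subgroup.m_closed[OF A(1) \<alpha>(1) \<beta>(1)] A(2) by (simp add: co_mult subsetD)
qed simp

lemma co_inj_on: "inj_on co gam"
  by (rule inj_on_inverseI[of _ en]) (rule en_co)

lemma scal_in_lins: "scal c \<in> lins"
proof -
  have "ltr (0, 0, 0, 0) \<in> lins" by (rule ltr_in_lins) (simp add: ring_gens_def)
  then obtain k where k: "ltr (0, 0, 0, 0) = lin k" by (auto simp: lins_def)
  have "scal c f = lin (\<lambda>a. c * k a) f" for f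
    using scal_lin[of c k f] by (simp add: ltr_one flip: k)
  then show ?thesis unfolding lins_def by (metis ext rangeI)
qed

lemma scals_subset_lins: "scals \<subseteq> lins"
  using scal_in_lins by (auto simp: scals_def)

lemma elem_lins_gam: "\<lbrakk>r \<in> lins; i \<noteq> j\<rbrakk> \<Longrightarrow> elem i j r \<in> gam"
  using lam_elem_lins lam_subset_gam by blast

lemma scal_inject: "scal c = scal d \<longleftrightarrow> c = d"
proof
  assume "scal c = scal d"
  then have "scal c (\<lambda>h. 1) (0, 0, 0, 0) = scal d (\<lambda>h. 1) (0, 0, 0, 0)" by simp
  then show "c = d" by (simp add: scal_def)
qed simp

lemma scaled_bij:
  assumes P: "P = scals \<or> P = lins" and c: "c \<noteq> 0"
  shows "bij_betw (\<lambda>r x. scal c (r x)) P P"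
proof (rule bij_betw_byWitness[where f' = "\<lambda>r x. scal (c * c * c) (r x)"])
  have closed: "(\<lambda>x. scal d (r x)) \<in> P" if "r \<in> P" for d r
    using P that by (auto simp: scals_def lins_def scal_scal scal_lin simp flip: ext)
  show "(\<lambda>r x. scal c (r x)) ` P \<subseteq> P" "(\<lambda>r x. scal (c * c * c) (r x)) ` P \<subseteq> P"
    using closed by blast+
  have "c * (c * c * c) = 1" "(c * c * c) * c = 1"
    using type_5_inverse[OF c] by (simp_all add: mult_ac)
  then show "\<forall>r\<in>P. (\<lambda>x. scal (c * c * c) (scal c (r x))) = r" "\<forall>r\<in>P. (\<lambda>x. scal c (scal (c * c * c) (r x))) = r"
    by (simp_all add: scal_scal scal_one)
qed

text \<open>One form for all three pairs: \<open>scals\<close> plays the group \<open>B\<close> of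
  five elements, \<open>P\<close> is either \<open>scals\<close> or \<open>lins\<close>, and the
  commutators fill position \<open>m\<close>, \<open>n\<close>. The sign \<open>\<sigma>\<close>
  depends on the order of the two positions in the commutator.\<close>

lemma dev_pair_elem:
  assumes act: "finite_right_action ng X act"
    and P: "P = scals \<or> P = lins"
    and neq: "i \<noteq> j" "k \<noteq> l" "m \<noteq> n"
    and AC: "\<And>r s. elem i j r \<circ> elem m n s = elem m n s \<circ> elem i j (r :: (heis \<Rightarrow> 5) \<Rightarrow> heis \<Rightarrow> 5)"
    and BC: "\<And>r s. elem k l r \<circ> elem m n s = elem m n s \<circ> elem k l (r :: (heis \<Rightarrow> 5) \<Rightarrow> heis \<Rightarrow> 5)"
    and comm: "\<And>c r. r \<in> P \<Longrightarrow>
      elem k l (\<lambda>x. - scal c x) \<circ> elem i j (\<lambda>x. - r x) \<circ> elem k l (scal c) \<circ> elem i j r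
        = elem m n (\<lambda>x. scal (\<sigma> * c) (r x))"
    and \<sigma>: "\<sigma> = 1 \<or> \<sigma> = - 1"
  shows "2 * finite_right_action.ip X (finite_right_action.dev act (co ` elem i j ` P) f)
      (finite_right_action.dev act (co ` elem k l ` scals) f)
    \<ge> - (9 / 20) * (finite_right_action.ip X (finite_right_action.dev act (co ` elem i j ` P) f) f
      + finite_right_action.ip X (finite_right_action.dev act (co ` elem k l ` scals) f) f)"
proof -
  interpret finite_right_action ng X act by (rule act)
  have PL: "P \<subseteq> lins" using P scals_subset_lins by blast
  have opP: "op_group P" using P op_group_scals op_group_lins by blast
  have finP: "finite P" using P finite_scals finite_lins by blast
  have gam: "elem a b r \<in> gam" if "a \<noteq> b" "r \<in> P \<or> r \<in> scals" for a b r
    using that PL scals_subset_lins by (blast intro: elem_lins_gam)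
  have sub: "subgroup (co ` elem a b ` Q) ng" if "a \<noteq> b" "Q = P \<or> Q = scals" for a b Q
    using that gam opP op_group_scals by (intro subgroup_co_image subgroup_elem) auto
  show ?thesis
  proof (rule dev_pair[where C = "co ` elem m n ` P"])
    show "subgroup (co ` elem i j ` P) ng" "subgroup (co ` elem k l ` scals) ng" "subgroup (co ` elem m n ` P) ng"
      using neq by (simp_all add: sub)
    show "finite (co ` elem i j ` P)" "finite (co ` elem k l ` scals)" "finite (co ` elem m n ` P)"
      using finP finite_scals by simp_all
    show "a \<otimes>\<^bsub>ng\<^esub> c = c \<otimes>\<^bsub>ng\<^esub> a" if "a \<in> co ` elem i j ` P" "c \<in> co ` elem m n ` P" for a c
      using that gam neq by (auto simp: co_mult AC)
    show "b \<otimes>\<^bsub>ng\<^esub> c = c \<otimes>\<^bsub>ng\<^esub> b" if "b \<in> co ` elem k l ` scals" "c \<in> co ` elem m n ` P" for b c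
      using that gam neq by (auto simp: co_mult BC)
    show "bij_betw (\<lambda>a. inv\<^bsub>ng\<^esub> b \<otimes>\<^bsub>ng\<^esub> inv\<^bsub>ng\<^esub> a \<otimes>\<^bsub>ng\<^esub> b \<otimes>\<^bsub>ng\<^esub> a) (co ` elem i j ` P) (co ` elem m n ` P)"
      if b: "b \<in> co ` elem k l ` scals" "b \<noteq> \<one>\<^bsub>ng\<^esub>" for b
    proof -
      let ?\<alpha> = "\<lambda>r. co (elem i j r)" and ?\<gamma> = "\<lambda>r. co (elem m n r)"
      obtain c where c: "b = co (elem k l (scal c))" using b(1) by (auto simp: scals_def)
      have "c \<noteq> 0"
      proof
        assume "c = 0"
        then have "scal c = (\<lambda>x. 0)" by (simp add: scal_def fun_eq_iff)
        then show False using b(2) c by (simp add: elem_zero ng_def)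
      qed
      then have \<sigma>c: "\<sigma> * c \<noteq> 0" using \<sigma> by auto
      have sc: "scal c \<in> scals" "(\<lambda>x. - scal c x) \<in> scals"
        using op_group_scals by (auto simp: scals_def op_group_def)
      have val: "inv\<^bsub>ng\<^esub> b \<otimes>\<^bsub>ng\<^esub> inv\<^bsub>ng\<^esub> (?\<alpha> r) \<otimes>\<^bsub>ng\<^esub> b \<otimes>\<^bsub>ng\<^esub> ?\<alpha> r = ?\<gamma> (\<lambda>x. scal (\<sigma> * c) (r x))" if r: "r \<in> P" for r
      proof -
        have nr: "(\<lambda>x. - r x) \<in> P" using r opP by (auto simp: op_group_def)
        show ?thesis
          using r nr sc neq gam by (simp add: c co_inv inv_elem co_mult gam_comp flip: comm)
      qed
      have inj: "inj_on (\<lambda>r. co (elem a b r)) P" if "a \<noteq> b" for a b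
        using that gam by (intro inj_onI) (simp add: inj_on_eq_iff[OF co_inj_on] elem_inject)
      have \<alpha>: "bij_betw ?\<alpha> P (co ` elem i j ` P)" and \<gamma>: "bij_betw ?\<gamma> P (co ` elem m n ` P)"
        using inj neq by (auto simp: bij_betw_def image_image)
      have "bij_betw (?\<gamma> \<circ> (\<lambda>r x. scal (\<sigma> * c) (r x)) \<circ> the_inv_into P ?\<alpha>) (co ` elem i j ` P) (co ` elem m n ` P)"
        by (intro bij_betw_trans[OF bij_betw_the_inv_into[OF \<alpha>]] bij_betw_trans[OF scaled_bij[OF P \<sigma>c]] \<gamma>)
      moreover have "(?\<gamma> \<circ> (\<lambda>r x. scal (\<sigma> * c) (r x)) \<circ> the_inv_into P ?\<alpha>) a
          = inv\<^bsub>ng\<^esub> b \<otimes>\<^bsub>ng\<^esub> inv\<^bsub>ng\<^esub> a \<otimes>\<^bsub>ng\<^esub> b \<otimes>\<^bsub>ng\<^esub> a" if a: "a \<in> co ` elem i j ` P" for a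
      proof -
        obtain r where "r \<in> P" "a = ?\<alpha> r" using a by blast
        then show ?thesis using the_inv_into_f_f[OF inj[OF neq(1)], of r] by (simp only: val o_apply)
      qed
      ultimately show ?thesis by (simp cong: bij_betw_cong)
    qed
    have "card (co ` elem k l ` scals) = card (range (\<lambda>c. co (elem k l (scal c))))"
      by (simp add: scals_def image_image)
    also have "\<dots> = 5"
    proof -
      have "inj (\<lambda>c. co (elem k l (scal c)))"
        using gam[OF neq(2)] neq(2) inj_on_eq_iff[OF co_inj_on]
        by (intro injI) (simp add: scals_def elem_inject scal_inject)
      then show ?thesis by (simp add: card_image)
    qed
    \<comment> \<open>The number 9/20 is a rational just above the inverse square root of 5, as its
      square is 81/400, and it is below the threshold 1/2 of \<open>spectral_gap\<close>.\<close>
    finally show "1 / real (card (co ` elem k l ` scals)) \<le> (9 / 20)\<^sup>2" by (simp add: power2_eq_square)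
  qed simp_all
qed

lemma lin_commutes_scal:
  assumes "P = scals \<or> P = lins" "r \<in> P"
  shows "r (scal c x) = scal c (r x)"
  using assms by (auto simp: scals_def lins_def scal_scal scal_lin lin_scal mult.commute)

lemma dev_pair_left:
  assumes "finite_right_action ng X act" and P: "P = scals \<or> P = lins"
    and neq: "i \<noteq> j" "j \<noteq> k" "i \<noteq> k"
  shows "2 * finite_right_action.ip X (finite_right_action.dev act (co ` elem i j ` P) f)
      (finite_right_action.dev act (co ` elem j k ` scals) f)
    \<ge> - (9 / 20) * (finite_right_action.ip X (finite_right_action.dev act (co ` elem i j ` P) f) f
      + finite_right_action.ip X (finite_right_action.dev act (co ` elem j k ` scals) f) f)"
proof (rule dev_pair_elem[OF assms(1) P neq(1,2,3) elem_commutes(1)[OF neq] elem_commutes(2)[OF neq]])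
  fix c r assume r: "r \<in> P"
  then have "additive_op r" using P scal_additive lin_additive by (auto simp: scals_def lins_def)
  from elem_commutator'[OF this neq, of "scal c"] lin_commutes_scal[OF P r]
  show "elem j k (\<lambda>x. - scal c x) \<circ> elem i j (\<lambda>x. - r x) \<circ> elem j k (scal c) \<circ> elem i j r
    = elem i k (\<lambda>x. scal (- 1 * c) (r x))"
    by (simp add: scal_uminus[THEN fun_cong])
qed simp

lemma dev_pair_right:
  assumes "finite_right_action ng X act" and P: "P = scals \<or> P = lins"
    and neq: "i \<noteq> j" "j \<noteq> k" "i \<noteq> k"
  shows "2 * finite_right_action.ip X (finite_right_action.dev act (co ` elem j k ` P) f)
      (finite_right_action.dev act (co ` elem i j ` scals) f)
    \<ge> - (9 / 20) * (finite_right_action.ip X (finite_right_action.dev act (co ` elem j k ` P) f) f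
      + finite_right_action.ip X (finite_right_action.dev act (co ` elem i j ` scals) f) f)"
proof (rule dev_pair_elem[OF assms(1) P neq(2,1,3) elem_commutes(2)[OF neq] elem_commutes(1)[OF neq]])
  fix c r assume r: "r \<in> P"
  have add: "additive_op (\<lambda>x. - scal c x)" using scal_additive[of "- c"] by (simp only: scal_uminus)
  show "elem i j (\<lambda>x. - scal c x) \<circ> elem j k (\<lambda>x. - r x) \<circ> elem i j (scal c) \<circ> elem j k r
    = elem i k (\<lambda>x. scal (1 * c) (r x))"
    \<comment> \<open>With both entries negated, the first commutator relation has the required
      order of factors, and the two signs cancel.\<close>
    using elem_commutator[OF add neq, of "\<lambda>x. - r x"]
    by (simp only: minus_minus mult_1 additive_opD(3)[OF scal_additive])
qed simp

lemma A_subset_gam: "A1 \<union> A2 \<union> A3 \<subseteq> gam"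
  using lam_gens lam_subset_gam by blast

lemma invariant_lam:
  assumes act: "finite_right_action ng X act"
    and f: "\<forall>x\<in>X. \<forall>a\<in>co ` A1 \<union> co ` A2 \<union> co ` A3. f (act x a) = (f x :: real)"
    and \<delta>: "\<delta> \<in> lam"
  shows "\<forall>x\<in>X. f (act x (co \<delta>)) = f x"
  using \<delta> unfolding lam_def
proof (induction rule: generate.induct)
  interpret finite_right_action ng X act by (rule act)
  case one
  have one: "co \<one>\<^bsub>bijg\<^esub> = \<one>\<^bsub>ng\<^esub>" by (simp add: ng_def)
  show ?case by (intro ballI) (simp only: one act_one)
next
  case (incl s)
  then show ?case using f by blast
next
  case (inv s)
  then have "inv\<^bsub>bijg\<^esub> s \<in> A1 \<union> A2 \<union> A3" using A_subgroups[THEN subgroup.m_inv_closed] by blast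
  then show ?case using f by blast
next
  interpret finite_right_action ng X act by (rule act)
  case (eng \<gamma> \<delta>)
  have "\<gamma> \<in> gam" "\<delta> \<in> gam" using eng.hyps lam_subset_gam unfolding lam_def by blast+
  then have c: "co (\<gamma> \<otimes>\<^bsub>bijg\<^esub> \<delta>) = co \<gamma> \<otimes>\<^bsub>ng\<^esub> co \<delta>" by (simp add: co_mult)
  show ?case
  proof
    fix x assume x: "x \<in> X"
    have "act x (co \<gamma>) \<in> X" using x by simp
    then have "f (act (act x (co \<gamma>)) (co \<delta>)) = f x" using eng.IH x by simp
    then show "f (act x (co (\<gamma> \<otimes>\<^bsub>bijg\<^esub> \<delta>))) = f x" unfolding c using x by (simp add: act_mult)
  qed
qed

lemma quotient_sum_le_edges:
  assumes "quotient_data G S N" "a \<in> S"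
  shows "(\<Sum>x\<in>carrier (G Mod N n). (f (x #>\<^bsub>G\<^esub> a) - f x)\<^sup>2)
    \<le> (\<Sum>(x, y)\<in>quotient_edges G S (N n). (f x - f y :: real)\<^sup>2)"
proof -
  interpret quotient_data G S N by (rule assms(1))
  let ?i = "\<lambda>x. (x, x #>\<^bsub>G\<^esub> a)"
  have "(\<Sum>x\<in>carrier (G Mod N n). (f (x #>\<^bsub>G\<^esub> a) - f x)\<^sup>2)
      = (\<Sum>(x, y)\<in>?i ` carrier (G Mod N n). (f x - f y)\<^sup>2)"
    by (subst sum.reindex) (auto simp: inj_on_def power2_commute)
  also have "\<dots> \<le> (\<Sum>(x, y)\<in>quotient_edges G S (N n). (f x - f y)\<^sup>2)"
  proof (rule sum_mono2)
    show "finite (quotient_edges G S (N n))"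
      using finite_subset[OF quotient_edges_subset] finite_quotient by blast
    show "?i ` carrier (G Mod N n) \<subseteq> quotient_edges G S (N n)"
      using assms(2) by (auto simp: quotient_edges_iff)
  qed auto
  finally show ?thesis .
qed

lemma expander_ng: "expander (\<lambda>n. quotient_graph ng Sn (Nl n))"
\<comment> \<open>With angle bound 9/20 the gap of the three projections is 1/10, and each
  projection costs at most half of the edge sum; so 1/10 is compared with 3/2, which gives
  1/15.\<close>
proof (rule quotient_data.expander_quotientI[OF quotient_data_ng, of "1 / 15"])
  fix n and f :: "nat set \<Rightarrow> real"
  let ?X = "carrier (ng Mod Nl n)" and ?D = "\<Sum>(x, y)\<in>quotient_edges ng Sn (Nl n). (f x - f y)\<^sup>2"
  assume mean: "(\<Sum>x\<in>?X. f x) = 0"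
  note act = quotient_data.quotient_right_action[OF quotient_data_ng, of n]
  interpret finite_right_action ng ?X "\<lambda>x g. x #>\<^bsub>ng\<^esub> g" by (rule act)
  have sub: "subgroup (co ` A1) ng" "subgroup (co ` A2) ng" "subgroup (co ` A3) ng"
    using A_subgroups A_subset_gam by (simp_all add: subgroup_co_image)
  have fin: "finite (co ` A1)" "finite (co ` A2)" "finite (co ` A3)"
    using finite_scals finite_lins by (simp_all add: A1_def A2_def A3_def)
  \<comment> \<open>Every coset has a representative in \<open>lam\<close>, so \<open>lam\<close>
    acts transitively on the quotient, and a function invariant under its three generating subgroups
    is constant.\<close>
  have const: "g x = (g y :: real)"
    if g: "\<forall>x\<in>?X. \<forall>a\<in>co ` A1 \<union> co ` A2 \<union> co ` A3. g (x #>\<^bsub>ng\<^esub> a) = g x" and xy: "x \<in> ?X" "y \<in> ?X" for g x y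
  proof -
    have "g x = g (Nl n)" if x: "x \<in> ?X" for x
    proof -
      obtain a where a: "x = Nl n #>\<^bsub>ng\<^esub> a"
        using quotient_data.quotient_carrierE[OF quotient_data_ng x] by metis
      obtain \<delta> where \<delta>: "\<delta> \<in> lam" "\<forall>F\<in>lvec n. en a F = \<delta> F"
        using gam_eq_lam_on_level[OF en_gam] by blast
      have "\<delta> \<in> gam" using \<delta>(1) lam_subset_gam by blast
      then have "x = Nl n #>\<^bsub>ng\<^esub> co \<delta>"
        unfolding a by (intro Nl_coset_eqI) (simp add: \<delta>(2) en_co)
      then show ?thesis
        using bspec[OF invariant_lam[OF act g \<delta>(1)] quotient_data.N_in_quotient[OF quotient_data_ng]] by simp
    qed
    then show ?thesis using xy by simp
  qed
  have "(1 - 2 * (9 / 20)) * ip f f \<le> ip (dev (co ` A1) f) f + ip (dev (co ` A2) f) f + ip (dev (co ` A3) f) f"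
  proof (rule spectral_gap[OF sub(1) fin(1) sub(2) fin(2) sub(3) fin(3) _ _ _ _ const mean])
    show "- (9 / 20) * (ip (dev (co ` A1) f) f + ip (dev (co ` A2) f) f) \<le> 2 * ip (dev (co ` A1) f) (dev (co ` A2) f)" for f
      unfolding A1_def A2_def by (rule dev_pair_left[OF act]) simp_all
    show "- (9 / 20) * (ip (dev (co ` A3) f) f + ip (dev (co ` A2) f) f) \<le> 2 * ip (dev (co ` A3) f) (dev (co ` A2) f)" for f
      unfolding A3_def A2_def by (rule dev_pair_right[OF act]) simp_all
    show "- (9 / 20) * (ip (dev (co ` A3) f) f + ip (dev (co ` A1) f) f) \<le> 2 * ip (dev (co ` A3) f) (dev (co ` A1) f)" for f
      unfolding A3_def A1_def by (rule dev_pair_left[OF act]) simp_all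
  qed simp
  moreover have "ip (dev B f) f \<le> ?D / 2" if "B \<in> {co ` A1, co ` A2, co ` A3}" for B
  proof (rule ip_dev_self_le)
    show "subgroup B ng" "finite B" using that sub fin by auto
    show "(\<Sum>x\<in>?X. (f (x #>\<^bsub>ng\<^esub> a) - f x)\<^sup>2) \<le> ?D" if "a \<in> B" for a
      using that \<open>B \<in> _\<close> by (intro quotient_sum_le_edges[OF quotient_data_ng]) (auto simp: Sn_def S0_def)
  qed
  ultimately have "(1 - 2 * (9 / 20)) * ip f f \<le> ?D / 2 + ?D / 2 + ?D / 2" by (smt (verit) insertCI)
  then show "1 / 15 * (\<Sum>x\<in>?X. (f x)\<^sup>2) \<le> ?D" by (simp add: ip_def power2_eq_square)
qed simp

theorem corollary7p6:
  shows "(\<forall>(G :: 'g monoid) S N. quotient_data G S N \<longrightarrow>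
            geometric_property_T (box_space G N) (box_coarse_structure G S N) \<longrightarrow>
            expander (\<lambda>n. quotient_graph G S (N n))) \<and>
         (\<exists>(G :: nat monoid) S N. quotient_data G S N \<and>
            expander (\<lambda>n. quotient_graph G S (N n)) \<and>
            \<not> geometric_property_T (box_space G N) (box_coarse_structure G S N))"
  using quotient_data.geometric_property_T_imp_expander
    quotient_data_ng expander_ng ng_not_geometric_property_T by blast

end
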